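(* Let $d\ge 1$ be an integer, let $1/2\le H_0\le 1$ and $1/2\le H_1,\dots,H_d<1$, put $H=H_1+\cdots+H_d$, and assume that $d-H\le 1$ and $d-H<2H_0-1/2$. Let $\rho=(2H_0-1)-(d-H)$, $\mathfrak b=\frac{H_0(2H_0-1)}{2^{H}}\prod_{j=1}^d\frac{\Gamma(2H_j+1)}{\Gamma(H_j)}$, let $\kappa>0$, and let $\beta^{\vartheta}_1(B)$, $\vartheta>0$, be the approximate self-intersection local time on $[0,1]$ of a standard Brownian motion $B$ on $\mathbb R^d$ (defined in the context). (1) If $\rho>0$, then $\displaystyle\lim_{\vartheta\to0}\mathbf E\big[\tfrac{\kappa^2}{2}\beta^\vartheta_1(B)\big]=\frac{\kappa^2\mathfrak b}{(1+\rho)\rho}$. (2) If $\rho=0$, then there exist bounded and continuous functions $\mathsf b_i:[0,\infty)\to\mathbb R$ ($i=1,2$) such that for every $\vartheta>0$, $$\mathbf E\big[\tfrac{\kappa^2}{2}\beta^\vartheta_1(B)\big]=\begin{cases}\kappa^2\mathfrak b\,\ell(\vartheta)+\kappa^2\mathsf b_1(\vartheta)&H_0<1,\\ \kappa^2\mathfrak b\,(1+\vartheta)\log(1+1/\vartheta)+\kappa^2\mathsf b_2(\vartheta)&H_0=1,\end{cases}$$ where $$\ell(\vartheta)=\frac{1}{2\Gamma(H_0)\Gamma(1-H_0)}\int_0^{2\pi}\left|\frac{\sin\theta}{\cos\theta}\right|^{2H_0-1}\Gamma_0\Big(\vartheta\big(|\sin\theta|+|\cos\theta|\big)\Big)\,\mathrm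 d\theta,\qquad \Gamma_0(\vartheta)=\int_\vartheta^\infty e^{-z}z^{-1}\,\mathrm dz.$$ (3) If $\rho<0$, then there exists a bounded and continuous function $\mathsf z:(0,\infty)\to\mathbb R$ such that for every $\vartheta>0$, $$\mathbf E\big[\tfrac{\kappa^2}{2}\beta^\vartheta_1(B)\big]=\kappa^2\mathfrak d\,\vartheta^{\rho}+\kappa^2\mathsf z(\vartheta),$$ where $$\mathfrak d=\frac{\Gamma(-\rho)}{2^H\Gamma(d-H)\Gamma(1-H_0)}\prod_{j=0}^d\frac{\Gamma(2H_j+1)}{\Gamma(H_j)}\int_0^{\pi/2}\frac{(\cos\theta)^{-(2H_0-1)}(\sin\theta)^{d-H}}{(\cos\theta+\sin\theta)^{-\rho}}\,\mathrm d\theta.$$ Moreover, $\lim_{\vartheta\to0}\mathsf z(\vartheta)=\frac{\mathfrak b}{(1+\rho)\rho}$ if $H_0>1/2$, and $\lim_{\vartheta\to0}\mathsf z(\vartheta)=0$ if $H_0=1/2$.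
   Context: Let $J=\{1\le j\le d:H_j=1/2\}$, $\delta_0$ the Dirac mass at $0$. Let $\mathsf g(x)=\prod_{j\in J}\delta_0(x_j)\prod_{j\notin J}H_j(2H_j-1)|x_j|^{2H_j-2}$ on $\mathbb R^d$, and $\mathsf h(t)=H_0(2H_0-1)|t|^{2H_0-2}$ if $H_0>1/2$, $\mathsf h=\delta_0$ if $H_0=1/2$. For $\varepsilon>0$ let $f_\varepsilon(t,x)=\frac{\varepsilon/2}{\pi(t^2+(\varepsilon/2)^2)}\frac{e^{-|x|^2/\varepsilon}}{(\pi\varepsilon)^{d/2}}$, and $(\mathsf h\otimes\mathsf g)_\varepsilon=(\mathsf h\otimes\mathsf g)*f_{2\varepsilon}$ (convolution on $\mathbb R\times\mathbb R^d$). $B$ is a standard Brownian motion on $\mathbb R^d$ started at $0$. For $\varepsilon,t>0$, its approximate self-intersection local time on $[0,t]$ is $$\beta^\varepsilon_t(B)=\int_{[0,t]^2}(\mathsf h\otimes\mathsf g)_\varepsilon\big(s_2-s_1,B(s_2)-B(s_1)\big)\,\mathrm ds_1\,\mathrm ds_2.$$ *)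

theory Defs
  imports "HOL-Probability.Probability"
begin

section \<open>Standard Brownian motion on \<open>\<real>\<^sup>d\<close> started at 0\<close>

text \<open>
  Only times \<open>t \<ge> 0\<close> matter. All paths are continuous (not just almost all of them): this makes
  path functionals measurable without completing the probability space.
\<close>

locale standard_brownian_motion = prob_space M
  for M :: "'w measure" +
  fixes B :: "real \<Rightarrow> 'w \<Rightarrow> real ^ 'n"
  assumes measurable_BM: "\<And>t. 0 \<le> t \<Longrightarrow> random_variable borel (B t)"
    and start_BM: "AE \<omega> in M. B 0 \<omega> = 0"
    and continuous_BM: "\<And>\<omega>. \<omega> \<in> space M \<Longrightarrow> continuous_on {0..} (\<lambda>t. B t \<omega>)"
    and indep_increments_BM:
      "\<And>t n. 0 \<le> t 0 \<Longrightarrow> mono t \<Longrightarrow>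
         indep_vars (\<lambda>_. borel) (\<lambda>i \<omega>. B (t (Suc i)) \<omega> - B (t i) \<omega>) {..<n::nat}"
    and gaussian_increments_BM:
      "\<And>s t. 0 \<le> s \<Longrightarrow> s < t \<Longrightarrow>
         distributed M lborel (\<lambda>\<omega>. B t \<omega> - B s \<omega>)
           (\<lambda>x. ennreal (\<Prod>j\<in>UNIV. normal_density 0 (sqrt (t - s)) (x $ j)))"

section \<open>The covariance \<open>h \<otimes> g\<close> and its regularization\<close>

text \<open>
  As \<open>h\<close> and \<open>g\<close> may contain Dirac masses, they are rendered as measures; \<open>cov_factor a\<close> is the
  common one-dimensional factor with Hurst parameter \<open>a\<close>.
\<close>

definition cov_factor :: "real \<Rightarrow> real measure" where
  "cov_factor a =
     (if a = 1/2 then return borel 0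
      else density lborel (\<lambda>x. ennreal (a * (2 * a - 1) * \<bar>x\<bar> powr (2 * a - 2))))"

definition space_cov :: "('n::finite \<Rightarrow> real) \<Rightarrow> (real ^ 'n) measure" where
  "space_cov H = distr (PiM UNIV (\<lambda>j. cov_factor (H j))) borel (\<lambda>x. \<chi> j. x j)"

definition time_space_cov :: "real \<Rightarrow> ('n::finite \<Rightarrow> real) \<Rightarrow> (real \<times> (real ^ 'n)) measure" where
  "time_space_cov H0 H = cov_factor H0 \<Otimes>\<^sub>M space_cov H"

definition mollifier :: "real \<Rightarrow> real \<times> (real ^ 'n) \<Rightarrow> real" where
  "mollifier \<epsilon> = (\<lambda>(t, x).
     (\<epsilon> / 2) / (pi * (t\<^sup>2 + (\<epsilon> / 2)\<^sup>2)) *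
     (exp (- (norm x)\<^sup>2 / \<epsilon>) / (pi * \<epsilon>) powr (real CARD('n) / 2)))"

definition cov_reg :: "real \<Rightarrow> ('n::finite \<Rightarrow> real) \<Rightarrow> real \<Rightarrow> real \<times> (real ^ 'n) \<Rightarrow> real" where
  "cov_reg H0 H \<epsilon> z = (LINT y|time_space_cov H0 H. mollifier (2 * \<epsilon>) (z - y))"

definition approx_silt ::
  "real \<Rightarrow> ('n::finite \<Rightarrow> real) \<Rightarrow> real \<Rightarrow> real \<Rightarrow> (real \<Rightarrow> real ^ 'n) \<Rightarrow> real" where
  "approx_silt H0 H \<epsilon> t b =
     (LINT (s1, s2):{0..t} \<times> {0..t}|lborel. cov_reg H0 H \<epsilon> (s2 - s1, b s2 - b s1))"

section \<open>Constants and special functions\<close>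

definition hsum :: "('n::finite \<Rightarrow> real) \<Rightarrow> real" where
  "hsum H = (\<Sum>j\<in>UNIV. H j)"

definition rho :: "real \<Rightarrow> ('n::finite \<Rightarrow> real) \<Rightarrow> real" where
  "rho H0 H = (2 * H0 - 1) - (real CARD('n) - hsum H)"

definition b_const :: "real \<Rightarrow> ('n::finite \<Rightarrow> real) \<Rightarrow> real" where
  "b_const H0 H =
     H0 * (2 * H0 - 1) / 2 powr hsum H * (\<Prod>j\<in>UNIV. Gamma (2 * H j + 1) / Gamma (H j))"

definition Gamma0 :: "real \<Rightarrow> real" where
  "Gamma0 \<theta> = (LINT z:{\<theta>..}|lborel. exp (- z) / z)"

definition ell :: "real \<Rightarrow> real \<Rightarrow> real" where
  "ell H0 \<theta> =
     1 / (2 * Gamma H0 * Gamma (1 - H0)) *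
     (LINT u:{0..2 * pi}|lborel.
        \<bar>sin u / cos u\<bar> powr (2 * H0 - 1) * Gamma0 (\<theta> * (\<bar>sin u\<bar> + \<bar>cos u\<bar>)))"

text \<open>In \<open>d_const\<close> the factor for index \<open>j = 0\<close> of the product is written separately.\<close>

definition d_const :: "real \<Rightarrow> ('n::finite \<Rightarrow> real) \<Rightarrow> real" where
  "d_const H0 H =
     Gamma (- rho H0 H) /
       (2 powr hsum H * Gamma (real CARD('n) - hsum H) * Gamma (1 - H0)) *
     (Gamma (2 * H0 + 1) / Gamma H0 * (\<Prod>j\<in>UNIV. Gamma (2 * H j + 1) / Gamma (H j))) *
     (LINT u:{0..pi / 2}|lborel.
        cos u powr (- (2 * H0 - 1)) * sin u powr (real CARD('n) - hsum H) /
        (cos u + sin u) powr (- rho H0 H))"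

end

theory Submission
  imports Defs "HOL-Real_Asymp.Real_Asymp"
begin

text \<open>
  Put \<open>a = d - H\<close>. Tonelli's theorem and the Gaussian increments turn the expectation into
  \<open>\<kappa>\<^sup>2 c \<integral> (1 - r) h\<^sub>\<theta>(r) (r + \<theta>) powr (- a) dr\<close> over \<open>0 < r < 1\<close>, where \<open>h\<^sub>\<theta>\<close> is the Cauchy regularization
  of the time covariance. For \<open>1/2 < H0 < 1\<close>, up to a constant, \<open>\<bar>u\<bar> powr (2 * H0 - 2)\<close> is the mixture of the Cauchy densities
  of scale \<open>t\<close> with weight \<open>t powr (2 * H0 - 2)\<close>; since Cauchy densities form a convolution semigroup,
  \<open>h\<^sub>\<theta>(r) = \<theta> powr (2 * H0 - 2) * h\<^sub>1(r / \<theta>)\<close> with \<open>h\<^sub>1\<close> an explicit positive integral. Hence the integrand is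
  \<open>(1 - r) * \<theta> powr (\<rho> - 1) * p(r / \<theta>)\<close> with \<open>p(x)\<close> asymptotic to \<open>k * x powr (\<rho> - 1)\<close>.
  For \<open>\<rho> > 0\<close> dominated convergence gives the limit. For \<open>\<rho> < 0\<close> the integral of \<open>p\<close> over the half-line
  converges and yields the leading constant by Tonelli and Beta integrals. For \<open>\<rho> = 0\<close>
  both the integral of \<open>p\<close> up to \<open>1 / \<theta>\<close> and the function \<open>\<ell>\<close> differ from (multiples of) \<open>ln (1 + 1 / \<theta>)\<close> by bounded
  continuous functions; for \<open>\<ell>\<close> this rests on the angular weight having total mass \<open>2 \<Gamma>(H0) \<Gamma>(1 - H0)\<close>.
\<close>

section \<open>Change of variables and dominated convergence\<close>

text \<open>The obstacle is that time and space are regularized with the same \<theta>, so neither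
  kernel may be treated as fixed while the other degenerates. After rescaling both depend on r /
  \<theta> alone, and the locale \<open>scaling_profile\<close> records what the three regimes use
  of the profile p: continuity, an upper bound, and a leading power with an error one order smaller.
  The endpoints H0 = 1/2 (Dirac mass) and H0 = 1 (Lebesgue measure) admit no Stieltjes mixture,
  since the weight t powr (2 * H0 - 2) times the kernel is then not integrable at 0 and at infinity,
  respectively; they have explicit profiles with the same bounds. The hypothesis d - H < 2 H0 - 1/2
  enters as \<rho> > -1, which makes r powr \<rho> integrable at 0, and d - H \<le> 1 ensures H0 < 1
  whenever \<rho> < 0. Nonnegative integrals are handled in \<open>ennreal\<close>, where Tonelli
  asks for no integrability; finiteness is read off from the final value.\<close>

lemma absolutely_integrable_on_if_nn_integral_finite:
  fixes f :: "real \<Rightarrow> real"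
  assumes A: "A \<in> sets borel"
    and f: "(\<lambda>x. f x * indicator A x) \<in> borel_measurable borel"
    and nonneg: "\<And>x. x \<in> A \<Longrightarrow> 0 \<le> f x"
    and fin: "(\<integral>\<^sup>+x\<in>A. ennreal (f x) \<partial>lborel) < \<infinity>"
  shows "f absolutely_integrable_on A"
proof -
  have "(\<lambda>x. f x * indicator A x) integrable_on UNIV"
  proof (rule nn_integral_integrable_on)
    have "(\<integral>\<^sup>+x. ennreal (f x * indicator A x) \<partial>lborel) = (\<integral>\<^sup>+x\<in>A. ennreal (f x) \<partial>lborel)"
      by (intro nn_integral_cong) (auto simp: indicator_def)
    with fin show "(\<integral>\<^sup>+x. ennreal (f x * indicator A x) \<partial>lborel) < \<infinity>" by simp
  qed (use f nonneg in \<open>auto split: split_indicator\<close>)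
  moreover have "(\<lambda>x. f x * indicator A x) = (\<lambda>x. if x \<in> A then f x else 0)"
    by (auto simp: indicator_def)
  ultimately have "f integrable_on A"
    by (simp add: integrable_restrict_UNIV)
  then show ?thesis
    using nonneg by (rule nonnegative_absolutely_integrable_1)
qed

text \<open>The change of variables for gauge integrals transfers absolute integrability in both
  directions. Hence the two sides are either finite and equal or both infinite, and no integrability
  has to be known beforehand.\<close>

lemma nn_integral_change_of_variables:
  fixes f g g' :: "real \<Rightarrow> real"
  assumes S: "S \<in> sets borel" and T: "g ` S = T" "T \<in> sets borel"
    and der: "\<And>x. x \<in> S \<Longrightarrow> (g has_field_derivative g' x) (at x)"
    and inj: "inj_on g S"
    and g'_nonneg: "\<And>x. x \<in> S \<Longrightarrow> 0 \<le> g' x"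
    and f: "(\<lambda>x. f x * indicator T x) \<in> borel_measurable borel"
    and fg: "(\<lambda>x. g' x * f (g x) * indicator S x) \<in> borel_measurable borel"
    and nonneg: "\<And>x. x \<in> T \<Longrightarrow> 0 \<le> f x"
  shows "(\<integral>\<^sup>+x\<in>T. ennreal (f x) \<partial>lborel) = (\<integral>\<^sup>+x\<in>S. ennreal (g' x * f (g x)) \<partial>lborel)"
proof -
  have S': "S \<in> sets lebesgue" using S by simp
  have der': "(g has_field_derivative g' x) (at x within S)" if "x \<in> S" for x
    using der[OF that] by (rule has_field_derivative_at_within)
  note cov = has_absolute_integral_change_of_variables_1'[OF S' der' inj, of f, unfolded T]
  have eq: "(\<integral>\<^sup>+x\<in>S. ennreal (g' x * f (g x)) \<partial>lborel) = (\<integral>\<^sup>+x\<in>S. ennreal (\<bar>g' x\<bar> * f (g x)) \<partial>lborel)"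
    using g'_nonneg by (intro nn_integral_cong) (auto simp: indicator_def)
  have nonneg': "0 \<le> \<bar>g' x\<bar> * f (g x)" if "x \<in> S" for x
    using nonneg[of "g x"] that T by auto
  have fg': "(\<lambda>x. \<bar>g' x\<bar> * f (g x) * indicator S x) \<in> borel_measurable borel"
    by (rule measurable_cong[THEN iffD1, OF _ fg]) (use g'_nonneg in \<open>auto simp: indicator_def\<close>)
  show ?thesis
  proof (cases "f absolutely_integrable_on T")
    case True
    then have 1: "(f has_integral (integral T f)) T"
      by (simp add: absolutely_integrable_on_def has_integral_integral)
    from True cov have "(\<lambda>x. \<bar>g' x\<bar> * f (g x)) absolutely_integrable_on S"
      "integral S (\<lambda>x. \<bar>g' x\<bar> * f (g x)) = integral T f" by auto
    then have 2: "((\<lambda>x. \<bar>g' x\<bar> * f (g x)) has_integral (integral T f)) S"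
      by (metis absolutely_integrable_on_def has_integral_integral)
    show ?thesis
      unfolding eq using nn_integral_has_integral_lebesgue'[OF nonneg 1]
        nn_integral_has_integral_lebesgue'[OF nonneg' 2] by simp
  next
    case False
    then have "\<not> (\<lambda>x. \<bar>g' x\<bar> * f (g x)) absolutely_integrable_on S"
      using cov by auto
    then have "\<not> (\<integral>\<^sup>+x\<in>S. ennreal (\<bar>g' x\<bar> * f (g x)) \<partial>lborel) < \<infinity>"
      using absolutely_integrable_on_if_nn_integral_finite[OF S fg' nonneg'] by blast
    moreover have "\<not> (\<integral>\<^sup>+x\<in>T. ennreal (f x) \<partial>lborel) < \<infinity>"
      using absolutely_integrable_on_if_nn_integral_finite[OF T(2) f nonneg] False by blast
    ultimately show ?thesis
      unfolding eq by (simp add: not_less top_unique)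
  qed
qed

text \<open>Limits at a point within a set of reals can be tested on sequences, which carries
  dominated convergence over to a real parameter. With \<open>S = {0<..}\<close> this covers
  one-sided limits at 0.\<close>

lemma tendsto_integral_dominated:
  fixes f :: "real \<Rightarrow> 'a \<Rightarrow> real"
  assumes meas: "\<And>t. t \<in> S \<Longrightarrow> f t \<in> borel_measurable M" and g: "g \<in> borel_measurable M"
    and w: "integrable M w"
    and bound: "\<And>t. t \<in> S \<Longrightarrow> AE x in M. \<bar>f t x\<bar> \<le> w x"
    and lim: "AE x in M. ((\<lambda>t. f t x) \<longlongrightarrow> g x) (at t0 within S)"
  shows "((\<lambda>t. integral\<^sup>L M (f t)) \<longlongrightarrow> integral\<^sup>L M g) (at t0 within S)"
  unfolding tendsto_at_iff_sequentially
proof safe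
  fix X :: "nat \<Rightarrow> real"
  assume X: "\<forall>i. X i \<in> S - {t0}" "X \<longlonglongrightarrow> t0"
  have "(\<lambda>n. integral\<^sup>L M (f (X n))) \<longlonglongrightarrow> integral\<^sup>L M g"
  proof (rule integral_dominated_convergence)
    show "AE x in M. (\<lambda>n. f (X n) x) \<longlonglongrightarrow> g x"
      using lim by eventually_elim (use X in \<open>auto simp: tendsto_at_iff_sequentially comp_def\<close>)
  qed (use X meas g w bound in auto)
  then show "((\<lambda>t. integral\<^sup>L M (f t)) \<circ> X) \<longlonglongrightarrow> integral\<^sup>L M g"
    by (simp add: comp_def)
qed

lemma continuous_on_integral_dominated:
  fixes f :: "real \<Rightarrow> 'a \<Rightarrow> real"
  assumes meas: "\<And>t. t \<in> S \<Longrightarrow> f t \<in> borel_measurable M"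
    and w: "integrable M w"
    and bound: "\<And>t. t \<in> S \<Longrightarrow> AE x in M. \<bar>f t x\<bar> \<le> w x"
    and cont: "AE x in M. continuous_on S (\<lambda>t. f t x)"
  shows "continuous_on S (\<lambda>t. integral\<^sup>L M (f t))"
  unfolding continuous_on_def
proof
  fix t0 assume t0: "t0 \<in> S"
  show "((\<lambda>t. integral\<^sup>L M (f t)) \<longlongrightarrow> integral\<^sup>L M (f t0)) (at t0 within S)"
    by (rule tendsto_integral_dominated[OF meas _ w bound])
       (use meas t0 cont in \<open>auto simp: continuous_on_def\<close>)
qed

lemma integral_le_of_dominated:
  fixes f :: "'a \<Rightarrow> real"
  assumes w: "integrable M w" and bound: "AE x in M. \<bar>f x\<bar> \<le> w x"
  shows "\<bar>integral\<^sup>L M f\<bar> \<le> integral\<^sup>L M w"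
proof (cases "integrable M f")
  case True
  have "\<bar>integral\<^sup>L M f\<bar> \<le> integral\<^sup>L M (\<lambda>x. \<bar>f x\<bar>)"
    by (rule integral_abs_bound)
  also have "\<dots> \<le> integral\<^sup>L M w"
    using True w bound by (intro integral_mono_AE) auto
  finally show ?thesis .
next
  \<comment> \<open>The integral of a non-integrable function is 0 by convention, so it is enough
    that the right-hand side is nonnegative.\<close>
  case False
  moreover have "0 \<le> integral\<^sup>L M w"
    using bound by (intro integral_nonneg_AE) (auto elim!: eventually_mono)
  ultimately show ?thesis by (simp add: not_integrable_integral_eq)
qed

lemma nn_integral_powr_Ioo:
  assumes "-1 < e"
  shows "(\<integral>\<^sup>+x\<in>{0<..<1}. ennreal (x powr e) \<partial>lborel) = ennreal (1 / (e + 1))"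
proof (rule nn_integral_has_integral_lebesgue')
  have "((\<lambda>x. x powr e) has_integral (1 powr (e + 1) / (e + 1))) {0..1}"
    using has_integral_powr_from_0[of e 1] assms by simp
  then show "((\<lambda>x. x powr e) has_integral 1 / (e + 1)) {0<..<1}"
    by (simp add: has_integral_Icc_iff_Ioo)
qed auto

lemma nn_integral_powr_Ici:
  assumes "e < -1"
  shows "(\<integral>\<^sup>+x\<in>{1..}. ennreal (x powr e) \<partial>lborel) = ennreal (- 1 / (e + 1))"
proof (rule nn_integral_has_integral_lebesgue')
  show "((\<lambda>x. x powr e) has_integral - 1 / (e + 1)) {1..}"
    using has_integral_powr_to_inf[of e 1] assms by simp
qed auto

section \<open>Beta and Gamma integrals\<close>

lemma nn_integral_scale_pos:
  fixes f :: "real \<Rightarrow> ennreal"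
  assumes [measurable]: "f \<in> borel_measurable borel" and c: "0 < c"
  shows "(\<integral>\<^sup>+x\<in>{0<..}. f x \<partial>lborel) = ennreal c * (\<integral>\<^sup>+x\<in>{0<..}. f (c * x) \<partial>lborel)"
proof -
  have "(\<integral>\<^sup>+x\<in>{0<..}. f x \<partial>lborel) = ennreal \<bar>c\<bar> * (\<integral>\<^sup>+x. f (0 + c * x) * indicator {0<..} (0 + c * x) \<partial>lborel)"
    by (rule nn_integral_real_affine) (use c in auto)
  also have "\<dots> = ennreal c * (\<integral>\<^sup>+x\<in>{0<..}. f (c * x) \<partial>lborel)"
    using c by (intro arg_cong2[where f = "(*)"] nn_integral_cong)
      (auto simp: indicator_def zero_less_mult_iff)
  finally show ?thesis .
qed

text \<open>Euler's Beta integral over the unit interval under the substitution t = x / (1 +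
  x).\<close>

lemma nn_integral_Beta:
  fixes p q :: real
  assumes "0 < p" "0 < q"
  shows "(\<integral>\<^sup>+x\<in>{0<..}. ennreal (x powr (p - 1) * (1 + x) powr (- (p + q))) \<partial>lborel) = ennreal (Beta p q)"
proof -
  have "ennreal (Beta p q) = (\<integral>\<^sup>+t\<in>{0<..<1}. ennreal (t powr (p - 1) * (1 - t) powr (q - 1)) \<partial>lborel)"
    by (subst nn_integral_has_integral_lebesgue'[where I = "Beta p q"])
       (use has_integral_Beta_real[OF assms] in \<open>auto simp: has_integral_Icc_iff_Ioo\<close>)
  also have "\<dots> = (\<integral>\<^sup>+x\<in>{0<..}. ennreal (1 / (1 + x)\<^sup>2 * ((x / (1 + x)) powr (p - 1) * (1 - x / (1 + x)) powr (q - 1))) \<partial>lborel)"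
  proof (rule nn_integral_change_of_variables)
    show "(\<lambda>x::real. x / (1 + x)) ` {0<..} = {0<..<1}"
    proof safe
      fix y :: real assume "y \<in> {0<..<1}"
      then show "y \<in> (\<lambda>x. x / (1 + x)) ` {0<..}"
        by (intro image_eqI[of _ _ "y / (1 - y)"]) (auto simp: field_simps)
    qed auto
    show "inj_on (\<lambda>x::real. x / (1 + x)) {0<..}"
      by (auto simp: inj_on_def field_simps)
  qed (auto intro!: derivative_eq_intros simp: field_simps power2_eq_square)
  also have "\<dots> = (\<integral>\<^sup>+x\<in>{0<..}. ennreal (x powr (p - 1) * (1 + x) powr (- (p + q))) \<partial>lborel)"
  proof (rule nn_integral_cong)
    fix x :: real
    show "ennreal (1 / (1 + x)\<^sup>2 * ((x / (1 + x)) powr (p - 1) * (1 - x / (1 + x)) powr (q - 1))) * indicator {0<..} x =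
      ennreal (x powr (p - 1) * (1 + x) powr (- (p + q))) * indicator {0<..} x"
    proof (cases "0 < x")
      case True
      define y where "y = 1 + x"
      have y: "0 < y" "1 - x / y = 1 / y" using True by (auto simp: y_def field_simps)
      have "1 / y\<^sup>2 = y powr (-2)"
        using y by (simp add: powr_minus divide_inverse)
      with y(1) have "1 / y\<^sup>2 * ((x / y) powr (p - 1) * (1 - x / y) powr (q - 1)) = x powr (p - 1) * y powr (- (p + q))"
        using True unfolding y(2) by (simp add: powr_divide powr_diff powr_minus powr_add field_simps power2_eq_square)
      then show ?thesis by (simp add: y_def)
    qed auto
  qed
  finally show ?thesis ..
qed

text \<open>Substituting x^2 in the Beta integral with parameters 1 - s/2 and s/2; they add up to 1,
  so Gamma of the sum is 1. This value normalises both the Stieltjes mixture and the angular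
  weight.\<close>

lemma nn_integral_powr_over_one_plus_sq:
  fixes s :: real
  assumes "0 < s" "s < 2"
  shows "(\<integral>\<^sup>+x\<in>{0<..}. ennreal (x powr (1 - s) / (1 + x\<^sup>2)) \<partial>lborel)
    = ennreal (Gamma (1 - s / 2) * Gamma (s / 2) / 2)"
proof -
  have "ennreal (1/2 * Beta (1 - s/2) (s/2)) = ennreal (1/2) * ennreal (Beta (1 - s/2) (s/2))"
    by (rule ennreal_mult') simp
  also have "\<dots> =
      (\<integral>\<^sup>+x\<in>{0<..}. ennreal (1/2) * ennreal (x powr (1 - s/2 - 1) * (1 + x) powr (- (1 - s/2 + s/2))) \<partial>lborel)"
    using nn_integral_Beta[of "1 - s/2" "s/2"] assms
    by (simp only: mult.assoc) (subst nn_integral_cmult; simp)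
  also have "\<dots> = (\<integral>\<^sup>+x\<in>{0<..}. ennreal (x powr (- s/2) / (1 + x) / 2) \<partial>lborel)"
    by (intro nn_integral_cong)
       (auto simp: indicator_def ennreal_mult'[symmetric] powr_minus field_simps simp del: ennreal_half)
  also have "\<dots> = (\<integral>\<^sup>+x\<in>{0<..}. ennreal (2 * x * ((x\<^sup>2) powr (- s/2) / (1 + x\<^sup>2) / 2)) \<partial>lborel)"
  proof (rule nn_integral_change_of_variables)
    show "(\<lambda>x::real. x\<^sup>2) ` {0<..} = {0<..}"
    proof safe
      fix y :: real assume "0 < y"
      then show "y \<in> (\<lambda>x. x\<^sup>2) ` {0<..}" by (intro image_eqI[of _ _ "sqrt y"]) auto
    qed auto
  qed (auto intro!: derivative_eq_intros simp: inj_on_def)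
  also have "\<dots> = (\<integral>\<^sup>+x\<in>{0<..}. ennreal (x powr (1 - s) / (1 + x\<^sup>2)) \<partial>lborel)"
  proof (rule nn_integral_cong)
    fix x :: real
    show "ennreal (2 * x * ((x\<^sup>2) powr (- s/2) / (1 + x\<^sup>2) / 2)) * indicator {0<..} x =
      ennreal (x powr (1 - s) / (1 + x\<^sup>2)) * indicator {0<..} x"
    proof (cases "0 < x")
      case True
      have eq: "(x\<^sup>2) powr (- s/2) = x powr (- s)"
        using powr_powr[of x 2 "- s/2"] True by simp
      have "x * x powr (- s) = x powr (1 - s)"
        using True by (simp add: powr_diff powr_minus field_simps)
      moreover have "2 * x * (A / D / 2) = x * A / D" for A D :: real
        by simp
      ultimately show ?thesis unfolding eq by metis
    qed auto
  qed
  finally show ?thesis by (simp add: Beta_def)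
qed

lemma nn_integral_tan:
  fixes f :: "real \<Rightarrow> real"
  assumes [measurable]: "f \<in> borel_measurable borel" and nonneg: "\<And>y. 0 < y \<Longrightarrow> 0 \<le> f y"
  shows "(\<integral>\<^sup>+y\<in>{0<..}. ennreal (f y) \<partial>lborel) = (\<integral>\<^sup>+u\<in>{0<..<pi/2}. ennreal (1 / (cos u)\<^sup>2 * f (tan u)) \<partial>lborel)"
proof (rule nn_integral_change_of_variables)
  show "tan ` {0<..<pi/2} = {0<..}"
  proof safe
    fix y :: real assume "0 < y"
    then show "y \<in> tan ` {0<..<pi/2}"
      using arctan_ubound[of y]
      by (intro image_eqI[of _ _ "arctan y"]) (auto simp: tan_arctan)
  qed (auto simp: tan_gt_zero)
  show "inj_on tan {0<..<pi/2}"
    by (rule inj_on_inverseI[of _ arctan]) (auto intro!: arctan_tan)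
  show "(tan has_field_derivative 1 / (cos u)\<^sup>2) (at u)" if "u \<in> {0<..<pi/2}" for u
    using that cos_gt_zero[of u] by (auto intro!: derivative_eq_intros simp: field_simps)
  have [measurable]: "(tan :: real \<Rightarrow> real) \<in> borel_measurable borel"
    unfolding tan_def by measurable
  show "(\<lambda>u. 1 / (cos u)\<^sup>2 * f (tan u) * indicator {0<..<pi/2} u) \<in> borel_measurable borel"
    by measurable
qed (use nonneg in auto)

text \<open>The Jacobian of \<open>tan\<close> cancels the weight 1 / (1 + y^2), so half-line
  integrals against this weight become plain angular integrals.\<close>

lemma one_plus_tan_sq_cancel:
  fixes u P :: real
  assumes "0 < cos u"
  shows "1 / (cos u)\<^sup>2 * (P / (1 + (tan u)\<^sup>2)) = P"
proof -
  have "(cos u)\<^sup>2 * (1 + (tan u)\<^sup>2) = 1"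
    using assms sin_cos_squared_add[of u] by (simp add: tan_def power_divide distrib_left)
  then show ?thesis
    by (metis div_by_1 mult_1 times_divide_times_eq)
qed

lemma nn_integral_reflect_quarter:
  fixes f :: "real \<Rightarrow> ennreal"
  assumes [measurable]: "f \<in> borel_measurable borel"
  shows "(\<integral>\<^sup>+u\<in>{0<..<pi/2}. f u \<partial>lborel) = (\<integral>\<^sup>+u\<in>{0<..<pi/2}. f (pi/2 - u) \<partial>lborel)"
  by (subst nn_integral_real_affine[where c = "-1" and t = "pi/2"])
     (auto intro!: nn_integral_cong simp: indicator_def)

lemma Gamma_half_duplication:
  fixes x :: real
  assumes "0 < x"
  shows "Gamma x * Gamma (x + 1/2) = 2 powr (1 - 2 * x) * sqrt pi * Gamma (2 * x)"
proof -
  have "complex_of_real x \<notin> \<int>\<^sub>\<le>\<^sub>0" "complex_of_real x + 1/2 \<notin> \<int>\<^sub>\<le>\<^sub>0"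
    using assms by (auto elim!: nonpos_Ints_cases simp: complex_eq_iff)
  from Gamma_legendre_duplication[OF this]
  have "complex_of_real (Gamma x * Gamma (x + 1/2)) =
      complex_of_real (exp ((1 - 2 * x) * ln 2) * sqrt pi * Gamma (2 * x))"
    by (simp add: Gamma_complex_of_real[symmetric] exp_of_real[symmetric])
  then show ?thesis
    by (simp only: of_real_eq_iff) (simp add: powr_def)
qed

text \<open>Turns the constant of the Gaussian moment, which contains Gamma (h - 1/2), into the
  factor Gamma (2 h + 1) / Gamma h of \<open>b_const\<close>, by the duplication formula and the
  functional equation.\<close>

lemma Gamma_moment_identity:
  fixes h :: real
  assumes "1/2 < h"
  shows "h * (2 * h - 1) * 2 powr (h - 1) * Gamma (h - 1/2) / sqrt pi = 2 powr (- h) * (Gamma (2 * h + 1) / Gamma h)"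
proof -
  have G: "0 < Gamma h" using assms by (intro Gamma_real_pos) auto
  have 1: "Gamma (h + 1/2) = (h - 1/2) * Gamma (h - 1/2)"
    using Gamma_plus1[of "h - 1/2"] assms by (auto simp: algebra_simps nonpos_Ints_def)
  have 2: "Gamma (2 * h + 1) = 2 * h * Gamma (2 * h)"
    using Gamma_plus1[of "2 * h"] assms by (auto simp: nonpos_Ints_def)
  have 3: "Gamma h * Gamma (h + 1/2) = 2 powr (1 - 2 * h) * sqrt pi * Gamma (2 * h)"
    using assms by (intro Gamma_half_duplication) auto
  have "h * (2 * h - 1) * 2 powr (h - 1) * Gamma (h - 1/2) / sqrt pi * Gamma h =
      h * 2 powr h / sqrt pi * (Gamma h * Gamma (h + 1/2))"
    unfolding 1 by (simp add: powr_diff field_simps)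
  also have "\<dots> = 2 powr (- h) * (2 * h * Gamma (2 * h))"
  proof -
    have "2 powr h * 2 powr (1 - 2 * h) = 2 * (2 powr (- h) :: real)"
      using powr_add[of "2::real" 1 "- h"] by (simp add: powr_add[symmetric])
    then show ?thesis
      unfolding 3 by (simp add: field_simps)
  qed
  finally show ?thesis
    unfolding 2 using G by (simp add: field_simps)
qed

lemma nn_integral_Gamma:
  fixes q :: real
  assumes "0 < q"
  shows "(\<integral>\<^sup>+t\<in>{0<..}. ennreal (t powr (q - 1) * exp (- t)) \<partial>lborel) = ennreal (Gamma q)"
proof -
  have "ennreal (Gamma q) = (\<integral>\<^sup>+t. ennreal (indicator {0..} t * t powr (q - 1) / exp t) \<partial>lborel)"
    by (rule Gamma_conv_nn_integral_real[OF assms])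
  also have "\<dots> = (\<integral>\<^sup>+t\<in>{0<..}. ennreal (t powr (q - 1) * exp (- t)) \<partial>lborel)"
    by (intro nn_integral_cong) (auto simp: indicator_def exp_minus field_simps)
  finally show ?thesis ..
qed

lemma nn_integral_even:
  fixes f :: "real \<Rightarrow> ennreal"
  assumes [measurable]: "f \<in> borel_measurable borel" and even: "\<And>x. f (- x) = f x"
  shows "(\<integral>\<^sup>+x. f x \<partial>lborel) = 2 * (\<integral>\<^sup>+x\<in>{0<..}. f x \<partial>lborel)"
proof -
  have "(\<integral>\<^sup>+x. f x \<partial>lborel) = (\<integral>\<^sup>+x. f x * indicator {0<..} x + f x * indicator {..<0} x \<partial>lborel)"
    using AE_lborel_singleton[of "0::real"]
    by (intro nn_integral_cong_AE) (auto elim!: eventually_mono simp: indicator_def)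
  also have "\<dots> = (\<integral>\<^sup>+x\<in>{0<..}. f x \<partial>lborel) + (\<integral>\<^sup>+x\<in>{..<0}. f x \<partial>lborel)"
    by (rule nn_integral_add) auto
  also have "(\<integral>\<^sup>+x\<in>{..<0}. f x \<partial>lborel) = (\<integral>\<^sup>+x\<in>{0<..}. f x \<partial>lborel)"
    by (subst nn_integral_real_affine[where c = "-1" and t = 0])
       (auto simp: even intro!: nn_integral_cong split: split_indicator)
  finally show ?thesis by (simp add: mult_2)
qed

lemma normal_density_zero_even: "normal_density 0 \<sigma> (- x) = normal_density 0 \<sigma> x"
  by (simp add: normal_density_def)

text \<open>By evenness and t = x^2 / (2 v) the moment of order 2 h - 2 becomes a Gamma integral; it
  is finite because 2 h - 2 > -1.\<close>

lemma nn_integral_abs_powr_normal_density: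
  fixes h v :: real
  assumes h: "1/2 < h" and v: "0 < v"
  shows "(\<integral>\<^sup>+x. ennreal (\<bar>x\<bar> powr (2 * h - 2) * normal_density 0 (sqrt v) x) \<partial>lborel)
    = ennreal ((2 * v) powr (h - 1) * Gamma (h - 1/2) / sqrt pi)"
proof -
  let ?n = "\<lambda>x. ennreal (\<bar>x\<bar> powr (2 * h - 2) * normal_density 0 (sqrt v) x)"
  let ?f = "\<lambda>t::real. t powr (h - 1/2 - 1) * exp (- t)"
  \<comment> \<open>The integrand on the positive axis, already written as the Jacobian x / v times
    the Gamma integrand at x^2 / (2 v).\<close>
  let ?h = "\<lambda>x. ennreal ((2 * v) powr (h - 1) / 2 / sqrt pi) * ennreal (x / v * ?f (x\<^sup>2 / (2 * v)))"
  have "(\<integral>\<^sup>+x. ?n x \<partial>lborel)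
    = 2 * (\<integral>\<^sup>+x\<in>{0<..}. ?n x \<partial>lborel)"
    by (rule nn_integral_even) (auto simp: normal_density_zero_even)
  also have "\<dots> = 2 * (\<integral>\<^sup>+x\<in>{0<..}. ?h x \<partial>lborel)"
  proof (rule arg_cong[where f = "(*) 2"], rule nn_integral_cong)
    fix x :: real
    show "?n x * indicator {0<..} x =
      ?h x * indicator {0<..} x"
    proof (cases "0 < x")
      case True
      have eq: "(x\<^sup>2 / (2 * v)) powr (h - 1/2 - 1) = x powr (2 * h - 2) / x * ((2 * v) powr (1 - h) * sqrt (2 * v))"
      proof -
        have "(x\<^sup>2) powr (h - 1/2 - 1) = x powr (2 * h - 2) / x"
        proof -
          have "(x\<^sup>2) powr (h - 1/2 - 1) = x powr (2 * (h - 1/2 - 1))"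
            using powr_powr[of x 2 "h - 1/2 - 1"] True by simp
          also have "2 * (h - 1/2 - 1) = 2 * h - 2 - 1"
            by simp
          finally show ?thesis
            using True by (simp only: powr_diff powr_one less_imp_le)
        qed
        moreover have "(2 * v) powr (h - 1/2 - 1) = (2 * v) powr (h - 1) / sqrt (2 * v)"
        proof -
          have "h - 1/2 - 1 = h - 1 - 1/2" by simp
          then show ?thesis
            using v by (simp only: powr_diff) (simp add: powr_half_sqrt)
        qed
        moreover have "(2 * v) powr (1 - h) = 1 / (2 * v) powr (h - 1)"
          using powr_minus_divide[of "2 * v" "h - 1"] by simp
        moreover have "(x\<^sup>2 / (2 * v)) powr (h - 1/2 - 1) = (x\<^sup>2) powr (h - 1/2 - 1) / (2 * v) powr (h - 1/2 - 1)"
          by (rule powr_divide)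
        ultimately show ?thesis
          by (simp only: divide_divide_eq_right times_divide_eq_left times_divide_eq_right mult_1)
      qed
      have "x powr (2 * h - 2) * normal_density 0 (sqrt v) x =
        (2 * v) powr (h - 1) / 2 / sqrt pi * (x / v * ?f (x\<^sup>2 / (2 * v)))"
        unfolding eq using True v
        by (simp add: normal_density_def powr_diff real_sqrt_mult field_simps)
      then show ?thesis
        using True v by (simp add: ennreal_mult'[symmetric])
    qed auto
  qed
  also have "\<dots> = 2 * (ennreal ((2 * v) powr (h - 1) / 2 / sqrt pi) * (\<integral>\<^sup>+x\<in>{0<..}. ennreal (x / v * ?f (x\<^sup>2 / (2 * v))) \<partial>lborel))"
    by (simp only: mult.assoc) (subst nn_integral_cmult; simp)
  also have "(\<integral>\<^sup>+x\<in>{0<..}. ennreal (x / v * ?f (x\<^sup>2 / (2 * v))) \<partial>lborel) = (\<integral>\<^sup>+t\<in>{0<..}. ennreal (?f t) \<partial>lborel)"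
  proof (rule nn_integral_change_of_variables[symmetric])
    show "(\<lambda>x. x\<^sup>2 / (2 * v)) ` {0<..} = {0<..}"
    proof safe
      fix y :: real assume "0 < y"
      then show "y \<in> (\<lambda>x. x\<^sup>2 / (2 * v)) ` {0<..}"
        using v by (intro image_eqI[of _ _ "sqrt (2 * v * y)"]) auto
    qed (use v in auto)
  qed (use v in \<open>auto intro!: derivative_eq_intros simp: inj_on_def\<close>)
  also have "\<dots> = ennreal (Gamma (h - 1/2))"
    using h by (intro nn_integral_Gamma) auto
  also have "2 * (ennreal ((2 * v) powr (h - 1) / 2 / sqrt pi) * ennreal (Gamma (h - 1/2)))
     = ennreal ((2 * v) powr (h - 1) * Gamma (h - 1/2) / sqrt pi)"
    using h by (subst ennreal_mult'[symmetric], simp, subst ennreal_numeral[symmetric],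
        subst ennreal_mult'[symmetric]) (simp_all add: Gamma_real_nonneg)
  finally show ?thesis .
qed

section \<open>Gaussian averages of the one-dimensional covariance measures\<close>

lemma sets_cov_factor [measurable_cong, simp]: "sets (cov_factor a) = sets borel"
  by (simp add: cov_factor_def)

lemma space_cov_factor [simp]: "space (cov_factor a) = UNIV"
  by (simp add: cov_factor_def)

lemma nn_integral_cov_factor_half:
  assumes [measurable]: "f \<in> borel_measurable borel"
  shows "(\<integral>\<^sup>+x. f x \<partial>cov_factor (1/2)) = f 0"
  by (simp add: cov_factor_def nn_integral_return)

lemma nn_integral_cov_factor:
  assumes [measurable]: "f \<in> borel_measurable borel" and "a \<noteq> 1/2"
  shows "(\<integral>\<^sup>+x. f x \<partial>cov_factor a) = (\<integral>\<^sup>+x. ennreal (a * (2 * a - 1) * \<bar>x\<bar> powr (2 * a - 2)) * f x \<partial>lborel)"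
  using assms by (simp add: cov_factor_def nn_integral_density)

lemma sigma_finite_cov_factor: "sigma_finite_measure (cov_factor a)"
proof (cases "a = 1/2")
  case True
  interpret prob_space "return borel (0::real)" by (rule prob_space_return) simp
  show ?thesis using True sigma_finite_measure_axioms by (simp add: cov_factor_def)
next
  case False
  have "sigma_finite_measure (density lborel (\<lambda>x. ennreal (a * (2 * a - 1) * \<bar>x\<bar> powr (2 * a - 2))))"
    by (rule sigma_finite_measure.sigma_finite_iff_density_finite'[OF sigma_finite_lborel, THEN iffD2]) auto
  then show ?thesis using False by (simp add: cov_factor_def)
qed

text \<open>The Dirac case h = 1/2 obeys the same formula because Gamma 2 = 1 and Gamma (1/2) = sqrt
  pi. The spatial constants are therefore uniform in \<open>H j\<close>.\<close>

lemma nn_integral_cov_factor_normal_density: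
  fixes h v :: real
  assumes h: "1/2 \<le> h" and v: "0 < v"
  shows "(\<integral>\<^sup>+x. ennreal (normal_density 0 (sqrt v) x) \<partial>cov_factor h)
    = ennreal (2 powr (- h) * (Gamma (2 * h + 1) / Gamma h) * v powr (h - 1))"
proof (cases "h = 1/2")
  case True
  have "normal_density 0 (sqrt v) 0 = 2 powr (- (1/2)) * (Gamma (2 * (1/2) + 1) / Gamma (1/2)) * v powr (1/2 - 1)"
    using v by (simp add: normal_density_def Gamma_one_half_real powr_minus powr_half_sqrt real_sqrt_mult
        field_simps Gamma_numeral)
  then show ?thesis unfolding True by (subst nn_integral_cov_factor_half) auto
next
  case False
  with h have h': "1/2 < h" by simp
  have "(\<integral>\<^sup>+x. ennreal (normal_density 0 (sqrt v) x) \<partial>cov_factor h) =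
     (\<integral>\<^sup>+x. ennreal (h * (2 * h - 1)) * ennreal (\<bar>x\<bar> powr (2 * h - 2) * normal_density 0 (sqrt v) x) \<partial>lborel)"
    using h' by (subst nn_integral_cov_factor)
      (auto simp: ennreal_mult'[symmetric] mult.assoc intro!: nn_integral_cong)
  also have "\<dots> = ennreal (h * (2 * h - 1) * ((2 * v) powr (h - 1) * Gamma (h - 1/2) / sqrt pi))"
    using h' v by (subst nn_integral_cmult, simp, subst nn_integral_abs_powr_normal_density)
      (simp_all add: ennreal_mult'[symmetric])
  also have "h * (2 * h - 1) * ((2 * v) powr (h - 1) * Gamma (h - 1/2) / sqrt pi) =
     (h * (2 * h - 1) * 2 powr (h - 1) * Gamma (h - 1/2) / sqrt pi) * v powr (h - 1)"
    using v by (simp add: powr_mult)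
  also have "\<dots> = 2 powr (- h) * (Gamma (2 * h + 1) / Gamma h) * v powr (h - 1)"
    unfolding Gamma_moment_identity[OF h'] ..
  finally show ?thesis .
qed

section \<open>The Cauchy regularization of the time covariance\<close>

abbreviation cauchy_density :: "real \<Rightarrow> real \<Rightarrow> real" where
  "cauchy_density e x \<equiv> e / (pi * (x\<^sup>2 + e\<^sup>2))"

text \<open>Partial fractions: the hypothesis \<open>r \<noteq> 0\<close> keeps the common denominator
  \<open>N = (r\<^sup>2 + (e - t)\<^sup>2) (r\<^sup>2 + (e + t)\<^sup>2)\<close> away from \<open>0\<close> when \<open>e = t\<close>.\<close>

lemma nn_integral_cauchy_convolution:
  fixes e t r :: real
  assumes e: "0 < e" and t: "0 < t" and r: "r \<noteq> 0"
  shows "(\<integral>\<^sup>+u. ennreal (t / (u\<^sup>2 + t\<^sup>2) * (e / ((r - u)\<^sup>2 + e\<^sup>2))) \<partial>lborel)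
    = ennreal (pi * ((e + t) / (r\<^sup>2 + (e + t)\<^sup>2)))"
proof -
  define N where "N = (r\<^sup>2 + (e - t)\<^sup>2) * (r\<^sup>2 + (e + t)\<^sup>2)"
  have N1: "0 < r\<^sup>2 + (e - t)\<^sup>2" "0 < r\<^sup>2 + (e + t)\<^sup>2"
    using r by (auto intro!: add_pos_nonneg)
  then have N: "0 < N" by (simp add: N_def)
  define A B D where "A = 2 * r / N" and "B = (r\<^sup>2 + e\<^sup>2 - t\<^sup>2) / N" and "D = (r\<^sup>2 - e\<^sup>2 + t\<^sup>2) / N"
  let ?f = "\<lambda>u. t / (u\<^sup>2 + t\<^sup>2) * (e / ((r - u)\<^sup>2 + e\<^sup>2))"
  \<comment> \<open>Antiderivative of the partial fractions. Its limits at the two ends are I and -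
    I: the logarithms cancel since the ratio of their arguments tends to 1, and only the arctangents
    survive.\<close>
  define F where "F u = t * e * (A / 2 * (ln (u\<^sup>2 + t\<^sup>2) - ln ((u - r)\<^sup>2 + e\<^sup>2))
      + B / t * arctan (u / t) + D / e * arctan ((u - r) / e))" for u
  define I where "I = t * e * (B / t * (pi / 2) + D / e * (pi / 2))"
  have pos: "0 < u\<^sup>2 + t\<^sup>2" "0 < (u - r)\<^sup>2 + e\<^sup>2" for u
    using e t by (auto intro!: add_nonneg_pos)
  have id: "(A * u + B) / (u\<^sup>2 + t\<^sup>2) + (- A * (u - r) + D) / ((u - r)\<^sup>2 + e\<^sup>2)
      = 1 / ((u\<^sup>2 + t\<^sup>2) * ((u - r)\<^sup>2 + e\<^sup>2))" for u
  proof -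
    have "(A * u + B) * ((u - r)\<^sup>2 + e\<^sup>2) + (- A * (u - r) + D) * (u\<^sup>2 + t\<^sup>2)
      = ((2 * r * u + (r\<^sup>2 + e\<^sup>2 - t\<^sup>2)) * ((u - r)\<^sup>2 + e\<^sup>2)
        + (- 2 * r * (u - r) + (r\<^sup>2 - e\<^sup>2 + t\<^sup>2)) * (u\<^sup>2 + t\<^sup>2)) / N"
      unfolding A_def B_def D_def by (simp add: add_divide_distrib diff_divide_distrib algebra_simps)
    also have "(2 * r * u + (r\<^sup>2 + e\<^sup>2 - t\<^sup>2)) * ((u - r)\<^sup>2 + e\<^sup>2)
        + (- 2 * r * (u - r) + (r\<^sup>2 - e\<^sup>2 + t\<^sup>2)) * (u\<^sup>2 + t\<^sup>2) = N"
      unfolding N_def by (simp add: power2_eq_square algebra_simps)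
    also have "N / N = 1"
      using N by simp
    finally show ?thesis
      using pos[of u] by (subst add_frac_eq) auto
  qed
  have der: "(F has_field_derivative ?f u) (at u)" for u
  proof -
    have d1: "((\<lambda>u. ln (u\<^sup>2 + t\<^sup>2)) has_field_derivative 2 * u / (u\<^sup>2 + t\<^sup>2)) (at u)"
      using pos[of u] by (auto intro!: derivative_eq_intros)
    have d2: "((\<lambda>u. ln ((u - r)\<^sup>2 + e\<^sup>2)) has_field_derivative 2 * (u - r) / ((u - r)\<^sup>2 + e\<^sup>2)) (at u)"
      using pos[of u] by (auto intro!: derivative_eq_intros)
    have d3: "((\<lambda>u. arctan (u / t)) has_field_derivative 1 / t / (1 + (u / t)\<^sup>2)) (at u)"
      by (auto intro!: derivative_eq_intros simp: divide_inverse)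
    have d4: "((\<lambda>u. arctan ((u - r) / e)) has_field_derivative 1 / e / (1 + ((u - r) / e)\<^sup>2)) (at u)"
      by (auto intro!: derivative_eq_intros simp: divide_inverse)
    have "(F has_field_derivative t * e * (A / 2 * (2 * u / (u\<^sup>2 + t\<^sup>2) - 2 * (u - r) / ((u - r)\<^sup>2 + e\<^sup>2))
       + B / t * (1 / t / (1 + (u / t)\<^sup>2)) + D / e * (1 / e / (1 + ((u - r) / e)\<^sup>2)))) (at u)"
      unfolding F_def by (intro DERIV_cmult DERIV_add DERIV_diff d1 d2 d3 d4)
    also have "B / t * (1 / t / (1 + (u / t)\<^sup>2)) = B / (u\<^sup>2 + t\<^sup>2)"
      using t pos[of u] by (simp add: field_simps power2_eq_square)
    also have "D / e * (1 / e / (1 + ((u - r) / e)\<^sup>2)) = D / ((u - r)\<^sup>2 + e\<^sup>2)"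
      using e pos[of u] by (simp add: field_simps power2_eq_square)
    also have "t * e * (A / 2 * (2 * u / (u\<^sup>2 + t\<^sup>2) - 2 * (u - r) / ((u - r)\<^sup>2 + e\<^sup>2))
       + B / (u\<^sup>2 + t\<^sup>2) + D / ((u - r)\<^sup>2 + e\<^sup>2)) =
       t * e * ((A * u + B) / (u\<^sup>2 + t\<^sup>2) + (- A * (u - r) + D) / ((u - r)\<^sup>2 + e\<^sup>2))"
      by (simp add: add_divide_distrib diff_divide_distrib algebra_simps)
    also have "\<dots> = ?f u"
      unfolding id by (simp add: power2_commute[of u r])
    finally show ?thesis .
  qed
  have top: "(F \<longlongrightarrow> I) at_top"
  proof -
    have "((\<lambda>u. ln (u\<^sup>2 + t\<^sup>2) - ln ((u - r)\<^sup>2 + e\<^sup>2)) \<longlongrightarrow> 0) at_top"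
      by real_asymp
    moreover have "((\<lambda>u. arctan (u / t)) \<longlongrightarrow> pi / 2) at_top"
      using t by real_asymp
    moreover have "((\<lambda>u. arctan ((u - r) / e)) \<longlongrightarrow> pi / 2) at_top"
      using e by real_asymp
    ultimately have "(F \<longlongrightarrow> t * e * (A / 2 * 0 + B / t * (pi / 2) + D / e * (pi / 2))) at_top"
      unfolding F_def by (intro tendsto_intros)
    then show ?thesis by (simp add: I_def)
  qed
  have bot: "(F \<longlongrightarrow> - I) at_bot"
  proof -
    have "((\<lambda>u. ln (u\<^sup>2 + t\<^sup>2) - ln ((u - r)\<^sup>2 + e\<^sup>2)) \<longlongrightarrow> 0) at_bot"
      by real_asymp
    moreover have "((\<lambda>u. arctan (u / t)) \<longlongrightarrow> - (pi / 2)) at_bot"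
      using t by real_asymp
    moreover have "((\<lambda>u. arctan ((u - r) / e)) \<longlongrightarrow> - (pi / 2)) at_bot"
      using e by real_asymp
    ultimately have "(F \<longlongrightarrow> t * e * (A / 2 * 0 + B / t * (- (pi / 2)) + D / e * (- (pi / 2)))) at_bot"
      unfolding F_def by (intro tendsto_intros)
    also have "t * e * (A / 2 * 0 + B / t * (- (pi / 2)) + D / e * (- (pi / 2))) = - I"
      by (simp add: I_def algebra_simps)
    finally show ?thesis .
  qed
  have cont: "isCont ?f u" for u
    using pos[of u] by (intro continuous_intros) (auto simp: power2_commute[of u r])
  have nonneg: "0 \<le> ?f u" for u
    using e t by simp
  have *: "set_integrable lborel (einterval (-\<infinity>) \<infinity>) ?f" "(LBINT u=-\<infinity>..\<infinity>. ?f u) = I - (- I)"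
    using interval_integral_FTC_nonneg[of "-\<infinity>" "\<infinity>" F ?f "- I" I] der cont nonneg top bot
    by (auto simp: ereal_tendsto_simps)
  then have "integrable lborel ?f" "integral\<^sup>L lborel ?f = 2 * I"
    by (simp_all add: set_integrable_def interval_lebesgue_integral_def set_lebesgue_integral_def)
  then have "(\<integral>\<^sup>+u. ennreal (?f u) \<partial>lborel) = ennreal (2 * I)"
    using nonneg by (subst nn_integral_eq_integral) auto
  also have "2 * I = pi * ((e + t) / (r\<^sup>2 + (e + t)\<^sup>2))"
  proof -
    have "2 * I = pi * (e * B + t * D)"
      unfolding I_def using e t by (simp add: field_simps)
    \<comment> \<open>Here the scales add up: the factor r^2 + (e - t)^2 splits off and cancels
      against N, leaving the kernel of scale e + t.\<close>
    also have "e * B + t * D = (e + t) * (r\<^sup>2 + (e - t)\<^sup>2) / N"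
      unfolding B_def D_def by (simp add: add_divide_distrib[symmetric]) (simp add: power2_eq_square algebra_simps)
    also have "\<dots> = (e + t) / (r\<^sup>2 + (e + t)\<^sup>2)"
      unfolding N_def using r by simp
    finally show ?thesis .
  qed
  finally show ?thesis .
qed

lemma nn_integral_powr_over_sq_sum:
  fixes s u :: real
  assumes s: "0 < s" "s < 2" and u: "0 < u"
  shows "(\<integral>\<^sup>+t\<in>{0<..}. ennreal (t powr (1 - s) / (t\<^sup>2 + u\<^sup>2)) \<partial>lborel)
    = ennreal (Gamma (1 - s / 2) * Gamma (s / 2) / 2 * u powr (- s))"
proof -
  have "(\<integral>\<^sup>+t\<in>{0<..}. ennreal (t powr (1 - s) / (t\<^sup>2 + u\<^sup>2)) \<partial>lborel)
    = ennreal u * (\<integral>\<^sup>+t\<in>{0<..}. ennreal ((u * t) powr (1 - s) / ((u * t)\<^sup>2 + u\<^sup>2)) \<partial>lborel)"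
    by (rule nn_integral_scale_pos) (use u in auto)
  also have "(\<integral>\<^sup>+t\<in>{0<..}. ennreal ((u * t) powr (1 - s) / ((u * t)\<^sup>2 + u\<^sup>2)) \<partial>lborel)
    = (\<integral>\<^sup>+t\<in>{0<..}. ennreal (u powr (- s - 1)) * ennreal (t powr (1 - s) / (1 + t\<^sup>2)) \<partial>lborel)"
  proof (intro nn_integral_cong)
    fix t :: real
    have "(u * t) powr (1 - s) / ((u * t)\<^sup>2 + u\<^sup>2) = u powr (- s - 1) * (t powr (1 - s) / (1 + t\<^sup>2))" if "0 < t"
    proof -
      have "u powr (1 - s) = u powr (- s - 1) * u\<^sup>2"
        using u powr_add[of u "- s - 1" 2] by simp
      moreover have "(u * t)\<^sup>2 + u\<^sup>2 = u\<^sup>2 * (1 + t\<^sup>2)"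
        by (simp add: power_mult_distrib algebra_simps)
      ultimately show ?thesis
        using u that by (simp add: powr_mult)
    qed
    then show "ennreal ((u * t) powr (1 - s) / ((u * t)\<^sup>2 + u\<^sup>2)) * indicator {0<..} t =
      ennreal (u powr (- s - 1)) * ennreal (t powr (1 - s) / (1 + t\<^sup>2)) * indicator {0<..} t"
      by (auto simp: indicator_def ennreal_mult'[symmetric])
  qed
  also have "\<dots> = ennreal (u powr (- s - 1)) * ennreal (Gamma (1 - s / 2) * Gamma (s / 2) / 2)"
    by (simp only: mult.assoc, subst nn_integral_cmult)
       (simp_all add: nn_integral_powr_over_one_plus_sq[OF s])
  also have "ennreal u * \<dots> = ennreal (u * (u powr (- s - 1) * (Gamma (1 - s / 2) * Gamma (s / 2) / 2)))"
    using u by (subst ennreal_mult', simp, subst ennreal_mult') simp_all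
  also have "u * (u powr (- s - 1) * (Gamma (1 - s / 2) * Gamma (s / 2) / 2)) = 
     (u powr 1 * u powr (- s - 1)) * (Gamma (1 - s / 2) * Gamma (s / 2) / 2)"
    using u by simp
  also have "u powr 1 * u powr (- s - 1) = u powr (- s)"
    by (simp only: powr_add[symmetric]) simp
  finally show ?thesis by (simp add: mult.commute)
qed

text \<open>The convolution of the Cauchy density of scale \<open>e\<close> with \<^term>\<open>cov_factor h\<close> is
  \<open>e powr (2 * h - 2) * cauchy_cov h (x / e)\<close>. For \<open>1/2 < h < 1\<close> the integral is a Stieltjes
  mixture of Cauchy densities.\<close>

definition stieltjes_const :: "real \<Rightarrow> real" where
  "stieltjes_const h = h * (2 * h - 1) * 2 / (Gamma h * Gamma (1 - h))"

abbreviation stieltjes_integrand :: "real \<Rightarrow> real \<Rightarrow> real \<Rightarrow> real" where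
  "stieltjes_integrand h x t \<equiv> t powr (2 * h - 2) * ((1 + t) / ((1 + t)\<^sup>2 + x\<^sup>2))"

definition cauchy_cov :: "real \<Rightarrow> real \<Rightarrow> real" where
  "cauchy_cov h x = (if h = 1 then 1 else if h = 1/2 then 1 / (pi * (1 + x\<^sup>2))
     else stieltjes_const h * (LINT t:{0<..}|lborel. stieltjes_integrand h x t))"

lemma stieltjes_const_nonneg:
  assumes "1/2 < h" "h < 1" shows "0 \<le> stieltjes_const h"
  unfolding stieltjes_const_def using assms
  by (intro divide_nonneg_nonneg mult_nonneg_nonneg) (auto simp: Gamma_real_nonneg)

lemma nn_integral_powr_over_add:
  fixes s a w :: real
  assumes s: "s < 1" "1 < s + a" and w: "0 < w"
  shows "(\<integral>\<^sup>+t\<in>{0<..}. ennreal (t powr (- s) * (t + w) powr (- a)) \<partial>lborel)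
    = ennreal (Beta (1 - s) (s + a - 1) * w powr (1 - s - a))"
proof -
  have "(\<integral>\<^sup>+t\<in>{0<..}. ennreal (t powr (- s) * (t + w) powr (- a)) \<partial>lborel)
    = ennreal w * (\<integral>\<^sup>+t\<in>{0<..}. ennreal ((w * t) powr (- s) * (w * t + w) powr (- a)) \<partial>lborel)"
    by (rule nn_integral_scale_pos) (use w in auto)
  also have "(\<integral>\<^sup>+t\<in>{0<..}. ennreal ((w * t) powr (- s) * (w * t + w) powr (- a)) \<partial>lborel)
    = (\<integral>\<^sup>+t\<in>{0<..}. ennreal (w powr (- s - a)) * ennreal (t powr (1 - s - 1) * (1 + t) powr (- (1 - s + (s + a - 1)))) \<partial>lborel)"
  proof (intro nn_integral_cong)
    fix t :: real
    have "(w * t) powr (- s) * (w * t + w) powr (- a) = w powr (- s - a) * (t powr (- s) * (1 + t) powr (- a))" if "0 < t"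
    proof -
      have "w * t + w = w * (1 + t)" by (simp add: algebra_simps)
      moreover have "w powr (- s - a) = w powr (- s) * w powr (- a)"
        by (simp add: powr_add[symmetric])
      ultimately show ?thesis
        using w that by (simp add: powr_mult)
    qed
    then show "ennreal ((w * t) powr (- s) * (w * t + w) powr (- a)) * indicator {0<..} t =
      ennreal (w powr (- s - a)) * ennreal (t powr (1 - s - 1) * (1 + t) powr (- (1 - s + (s + a - 1)))) * indicator {0<..} t"
      by (auto simp: indicator_def ennreal_mult'[symmetric])
  qed
  also have "\<dots> = ennreal (w powr (- s - a)) * ennreal (Beta (1 - s) (s + a - 1))"
    using nn_integral_Beta[of "1 - s" "s + a - 1"] s
    by (simp only: mult.assoc, subst nn_integral_cmult) simp_all
  also have "ennreal w * \<dots> = ennreal (w * (w powr (- s - a) * Beta (1 - s) (s + a - 1)))"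
    using w by (subst ennreal_mult', simp, subst ennreal_mult') simp_all
  also have "w * (w powr (- s - a) * Beta (1 - s) (s + a - 1)) = 
     (w powr 1 * w powr (- s - a)) * Beta (1 - s) (s + a - 1)"
    using w by simp
  also have "w powr 1 * w powr (- s - a) = w powr (1 - s - a)"
    by (simp only: powr_add[symmetric]) (simp add: algebra_simps)
  finally show ?thesis by (simp add: mult.commute)
qed

lemma set_integral_of_nn_integral:
  fixes f :: "real \<Rightarrow> real"
  assumes [measurable]: "f \<in> borel_measurable borel" "A \<in> sets borel" and "\<And>x. x \<in> A \<Longrightarrow> 0 \<le> f x"
    and "(\<integral>\<^sup>+x\<in>A. ennreal (f x) \<partial>lborel) = ennreal c" "0 \<le> c"
  shows "set_integrable lborel A f" "(LINT x:A|lborel. f x) = c"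
proof -
  have "(\<integral>\<^sup>+x. ennreal (indicator A x * f x) \<partial>lborel) = ennreal c"
    unfolding assms(4)[symmetric] by (intro nn_integral_cong) (auto simp: indicator_def)
  then have "has_bochner_integral lborel (\<lambda>x. indicator A x * f x) c"
    using assms by (intro has_bochner_integral_nn_integral) (auto simp: indicator_def)
  then show "set_integrable lborel A f" "(LINT x:A|lborel. f x) = c"
    by (auto simp: has_bochner_integral_iff set_integrable_def set_lebesgue_integral_def)
qed

lemma nn_integral_eq_set_integral:
  fixes f :: "real \<Rightarrow> real"
  assumes f: "set_integrable lborel A f" and "A \<in> sets borel" and nonneg: "\<And>x. x \<in> A \<Longrightarrow> 0 \<le> f x"
  shows "(\<integral>\<^sup>+x\<in>A. ennreal (f x) \<partial>lborel) = ennreal (LINT x:A|lborel. f x)"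
proof -
  have "(\<integral>\<^sup>+x\<in>A. ennreal (f x) \<partial>lborel) = (\<integral>\<^sup>+x. ennreal (indicator A x *\<^sub>R f x) \<partial>lborel)"
    by (intro nn_integral_cong) (auto simp: indicator_def)
  also have "\<dots> = ennreal (LINT x:A|lborel. f x)"
    unfolding set_lebesgue_integral_def
    by (rule nn_integral_eq_integral) (use f nonneg in \<open>auto simp: set_integrable_def indicator_def\<close>)
  finally show ?thesis .
qed

text \<open>Comparison with 2 / (t + w) for w = 1 + x. Against t powr (2 h - 2) this has a closed
  form proportional to w powr (2 h - 2), which is the source of the decay in x.\<close>

lemma stieltjes_kernel_le:
  fixes t x :: real
  assumes "0 < t" "0 \<le> x"
  shows "(1 + t) / ((1 + t)\<^sup>2 + x\<^sup>2) \<le> 2 / (t + (1 + x))"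
proof -
  have "(1 + t) * (t + (1 + x)) \<le> 2 * ((1 + t)\<^sup>2 + x\<^sup>2)"
  proof -
    \<comment> \<open>Completing the square in 1 + t and x exhibits the difference as a sum of
      squares.\<close>
    have "2 * ((1 + t)\<^sup>2 + x\<^sup>2) - (1 + t) * (t + (1 + x)) = (1 + t - x)\<^sup>2 / 2 + (1 + t)\<^sup>2 / 2 + 3 / 2 * x\<^sup>2"
      by (simp add: power2_eq_square field_simps)
    moreover have "0 \<le> \<dots>" by (intro add_nonneg_nonneg) auto
    ultimately show ?thesis by linarith
  qed
  moreover have "0 < (1 + t)\<^sup>2 + x\<^sup>2" "0 < t + (1 + x)"
    using assms by (auto intro!: add_pos_nonneg)
  ultimately show ?thesis
    by (simp add: frac_le_eq divide_simps mult.commute)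
qed

text \<open>Origin of \<open>stieltjes_const\<close>: the integral of t powr (2 h - 2) * (t / (t^2 +
  u^2)) over t > 0 is the bracket here times |u| powr (2 h - 2), and the constant is chosen so that
  the density of \<open>cov_factor h\<close> results.\<close>

lemma stieltjes_const_Gamma:
  assumes "1/2 < h" "h < 1"
  shows "stieltjes_const h * (Gamma (1 - (2 - 2 * h) / 2) * Gamma ((2 - 2 * h) / 2) / 2) = h * (2 * h - 1)"
proof -
  have "0 < Gamma h" "0 < Gamma (1 - h)" using assms by (auto intro!: Gamma_real_pos)
  moreover have eq: "1 - (2 - 2 * h) / 2 = h" "(2 - 2 * h) / 2 = 1 - h" by (auto simp: field_simps)
  ultimately show ?thesis unfolding eq stieltjes_const_def by simp
qed

lemma nn_integral_cauchy:
  fixes e r :: real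
  assumes e: "0 < e"
  shows "(\<integral>\<^sup>+u. ennreal (cauchy_density e (r - u)) \<partial>lborel) = 1"
proof -
  have "(\<integral>\<^sup>+u. ennreal (cauchy_density e (r - u)) \<partial>lborel) = (\<integral>\<^sup>+u. ennreal (cauchy_density e u) \<partial>lborel)"
    by (subst nn_integral_real_affine[where c = "-1" and t = r]) auto
  also have "\<dots> = 2 * (\<integral>\<^sup>+u\<in>{0<..}. ennreal (cauchy_density e u) \<partial>lborel)"
    by (rule nn_integral_even) auto
  also have "(\<integral>\<^sup>+u\<in>{0<..}. ennreal (cauchy_density e u) \<partial>lborel) =
     (\<integral>\<^sup>+u\<in>{0<..}. ennreal (e / pi) * ennreal (u powr (1 - 1) / (u\<^sup>2 + e\<^sup>2)) \<partial>lborel)"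
    using e by (intro nn_integral_cong) (auto simp: indicator_def ennreal_mult'[symmetric])
  also have "\<dots> = ennreal (e / pi) * ennreal (pi / 2 * e powr (- 1))"
    using nn_integral_powr_over_sq_sum[of 1 e] e
    by (simp only: mult.assoc, subst nn_integral_cmult)
       (simp_all add: Gamma_one_half_real)
  also have "\<dots> = ennreal (1 / 2)"
    using e by (subst ennreal_mult'[symmetric]) (simp_all add: powr_minus field_simps del: ennreal_half)
  also have "2 * ennreal (1 / 2) = 1"
    by (subst ennreal_numeral[symmetric], subst ennreal_mult'[symmetric]) simp_all
  finally show ?thesis .
qed

text \<open>Both ends of the range of h matter: 2 h - 2 > -1 gives integrability at 0, and 2 h - 3 <
  -1 at infinity.\<close>

lemma stieltjes_integral:
  fixes h x w :: real
  assumes h: "1/2 < h" "h < 1"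
  shows "set_integrable lborel {0<..} (\<lambda>t. stieltjes_integrand h x t)"
    and "0 < w \<Longrightarrow> set_integrable lborel {0<..} (\<lambda>t. t powr (2 * h - 2) * (t + w) powr (- 1))"
    and "0 < w \<Longrightarrow> (LINT t:{0<..}|lborel. t powr (2 * h - 2) * (t + w) powr (- 1)) = Beta (2 * h - 1) (2 - 2 * h) * w powr (2 * h - 2)"
proof -
  have B: "0 \<le> Beta (2 * h - 1) (2 - 2 * h)"
    unfolding Beta_def using h by (intro divide_nonneg_nonneg mult_nonneg_nonneg Gamma_real_nonneg) auto
  have *: "set_integrable lborel {0<..} (\<lambda>t. t powr (2 * h - 2) * (t + w) powr (- 1))"
    "(LINT t:{0<..}|lborel. t powr (2 * h - 2) * (t + w) powr (- 1)) = Beta (2 * h - 1) (2 - 2 * h) * w powr (2 * h - 2)"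
    if "0 < w" for w
  proof -
    have "(\<integral>\<^sup>+t\<in>{0<..}. ennreal (t powr (2 * h - 2) * (t + w) powr (- 1)) \<partial>lborel)
      = ennreal (Beta (2 * h - 1) (2 - 2 * h) * w powr (2 * h - 2))"
      using nn_integral_powr_over_add[of "2 - 2 * h" 1 w] h that by simp
    from set_integral_of_nn_integral[OF _ _ _ this] B
    show "set_integrable lborel {0<..} (\<lambda>t. t powr (2 * h - 2) * (t + w) powr (- 1))"
      "(LINT t:{0<..}|lborel. t powr (2 * h - 2) * (t + w) powr (- 1)) = Beta (2 * h - 1) (2 - 2 * h) * w powr (2 * h - 2)"
      by auto
  qed
  then show "0 < w \<Longrightarrow> set_integrable lborel {0<..} (\<lambda>t. t powr (2 * h - 2) * (t + w) powr (- 1))"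
    and "0 < w \<Longrightarrow> (LINT t:{0<..}|lborel. t powr (2 * h - 2) * (t + w) powr (- 1)) = Beta (2 * h - 1) (2 - 2 * h) * w powr (2 * h - 2)"
    by blast+
  show "set_integrable lborel {0<..} (\<lambda>t. stieltjes_integrand h x t)"
  proof (rule set_integrable_bound[OF *(1)[of 1]])
    have "(1 + t) / ((1 + t)\<^sup>2 + x\<^sup>2) \<le> (t + 1) powr (- 1)" if "0 < t" for t
    proof -
      have "(1 + t) / ((1 + t)\<^sup>2 + x\<^sup>2) \<le> (1 + t) / (1 + t)\<^sup>2"
        using that by (intro divide_left_mono) (auto intro!: mult_pos_pos add_pos_nonneg)
      also have "\<dots> = (t + 1) powr (- 1)"
        using that by (simp add: power2_eq_square powr_minus divide_inverse add.commute)
      finally show ?thesis .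
    qed
    then have "stieltjes_integrand h x t \<le> t powr (2 * h - 2) * (t + 1) powr (- 1)" if "0 < t" for t
      using that by (intro mult_left_mono) auto
    moreover have "norm (stieltjes_integrand h x t) = stieltjes_integrand h x t"
      "norm (t powr (2 * h - 2) * (t + 1) powr (- 1)) = t powr (2 * h - 2) * (t + 1) powr (- 1)" if "0 < t" for t
      using that by simp_all
    ultimately show "AE t in lborel. t \<in> {0<..} \<longrightarrow> norm (stieltjes_integrand h x t)
       \<le> norm (t powr (2 * h - 2) * (t + 1) powr (- 1))"
      by (intro AE_I2 impI) (simp only: greaterThan_iff)
  qed (auto simp: set_borel_measurable_def)
qed

lemma cauchy_cov_nonneg:
  assumes "1/2 \<le> h" "h \<le> 1" shows "0 \<le> cauchy_cov h x"
  using assms stieltjes_const_nonneg[of h] unfolding cauchy_cov_def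
  by (auto simp: set_lebesgue_integral_def indicator_def intro!: mult_nonneg_nonneg Bochner_Integration.integral_nonneg)

lemma continuous_on_cauchy_cov:
  assumes "1/2 \<le> h" "h \<le> 1" shows "continuous_on A (cauchy_cov h)"
proof (cases "h = 1/2 \<or> h = 1")
  case True
  have "1 + x\<^sup>2 \<noteq> 0" for x :: real
    by (metis add_pos_nonneg less_numeral_extra(1) less_irrefl zero_le_power2)
  then show ?thesis
    using True unfolding cauchy_cov_def by (auto intro!: continuous_intros)
next
  case False
  with assms have h: "1/2 < h" "h < 1" by auto
  have "continuous_on A (\<lambda>x. LINT t:{0<..}|lborel. stieltjes_integrand h x t)"
    unfolding set_lebesgue_integral_def
  proof (rule continuous_on_integral_dominated)
    \<comment> \<open>The kernel is largest at x = 0, which supplies a majorant independent of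
      x.\<close>
    show "integrable lborel (\<lambda>t. indicator {0<..} t *\<^sub>R (stieltjes_integrand h 0 t))"
      using stieltjes_integral(1)[OF h, of 0] unfolding set_integrable_def .
    show "AE t in lborel. \<bar>indicator {0<..} t *\<^sub>R (stieltjes_integrand h x t)\<bar>
      \<le> indicator {0<..} t *\<^sub>R (stieltjes_integrand h 0 t)" for x
      by (rule AE_I2) (auto simp: indicator_def abs_mult intro!: mult_left_mono divide_left_mono mult_pos_pos add_pos_nonneg)
    have "(1 + t)\<^sup>2 + x\<^sup>2 \<noteq> 0" if "0 < t" for t x :: real
      using that by (simp add: sum_power2_eq_zero_iff)
    then show "AE t in lborel. continuous_on A (\<lambda>x. indicator {0<..} t *\<^sub>R (stieltjes_integrand h x t))"
      by (intro AE_I2) (auto intro!: continuous_intros simp: indicator_def)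
  qed auto
  then have "continuous_on A (\<lambda>x. stieltjes_const h * (LINT t:{0<..}|lborel. stieltjes_integrand h x t))"
    by (intro continuous_intros)
  then show ?thesis
    using h unfolding cauchy_cov_def by simp
qed

text \<open>The decay at infinity is that of the unregularized covariance, while the singularity at
  0 is gone.\<close>

lemma cauchy_cov_le:
  assumes h: "1/2 \<le> h" "h \<le> 1"
  obtains K where "0 < K" "\<And>x. 0 \<le> x \<Longrightarrow> cauchy_cov h x \<le> K * (1 + x) powr (2 * h - 2)"
proof -
  consider "h = 1/2" | "h = 1" | "1/2 < h" "h < 1" using h by linarith
  then show ?thesis
  proof cases
    case 1
    have "1 / (pi * (1 + x\<^sup>2)) \<le> 2 * (1 + x) powr (- 1)" if "0 \<le> x" for x
    proof -
      have "1 + x \<le> 2 * (1 + x\<^sup>2)"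
        using zero_le_square[of "x - 1/2"] by (simp add: power2_eq_square algebra_simps) (use zero_le_square[of x] in linarith)
      also have "\<dots> \<le> 2 * (pi * (1 + x\<^sup>2))"
        using pi_ge_two by (intro mult_left_mono) (auto simp: mult_le_cancel_right1 not_less intro!: add_nonneg_nonneg)
      finally show ?thesis
        using that by (simp add: powr_minus field_simps add_pos_nonneg)
    qed
    then show ?thesis by (intro that[of 2]) (simp_all add: 1 cauchy_cov_def)
  next
    case 2
    have "cauchy_cov h x \<le> 1 * (1 + x) powr (2 * h - 2)" if "0 \<le> x" for x
      using 2 that by (simp add: cauchy_cov_def)
    then show ?thesis by (intro that[of 1]) auto
  next
    case 3
    let ?B = "Beta (2 * h - 1) (2 - 2 * h)"
    \<comment> \<open>The summand 1 is there to make the constant positive.\<close>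
    have "cauchy_cov h x \<le> (stieltjes_const h * (2 * ?B) + 1) * (1 + x) powr (2 * h - 2)" if x: "0 \<le> x" for x
    proof -
      have "(LINT t:{0<..}|lborel. stieltjes_integrand h x t)
        \<le> (LINT t:{0<..}|lborel. 2 * (t powr (2 * h - 2) * (t + (1 + x)) powr (- 1)))"
      proof (rule set_integral_mono)
        show "set_integrable lborel {0<..} (\<lambda>t. 2 * (t powr (2 * h - 2) * (t + (1 + x)) powr (- 1)))"
          using stieltjes_integral(2)[OF 3, of "1 + x"] x by (intro set_integrable_mult_right) auto
        show "stieltjes_integrand h x t \<le> 2 * (t powr (2 * h - 2) * (t + (1 + x)) powr (- 1))"
          if "t \<in> {0<..}" for t
        proof -
          have "(1 + t) / ((1 + t)\<^sup>2 + x\<^sup>2) \<le> 2 * (t + (1 + x)) powr (- 1)"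
            using stieltjes_kernel_le[of t x] x that by (simp add: powr_minus divide_inverse)
          then have "stieltjes_integrand h x t \<le> t powr (2 * h - 2) * (2 * (t + (1 + x)) powr (- 1))"
            by (rule mult_left_mono) simp
          then show ?thesis by (simp only: mult.left_commute)
        qed
      qed (rule stieltjes_integral(1)[OF 3])
      also have "\<dots> = 2 * (?B * (1 + x) powr (2 * h - 2))"
        using x by (subst set_integral_mult_right, subst stieltjes_integral(3)[OF 3]) simp_all
      finally have "stieltjes_const h * (LINT t:{0<..}|lborel. stieltjes_integrand h x t)
        \<le> stieltjes_const h * (2 * (?B * (1 + x) powr (2 * h - 2)))"
        using stieltjes_const_nonneg[OF 3] by (intro mult_left_mono) auto
      then show ?thesis
        using 3 by (simp add: cauchy_cov_def algebra_simps add_increasing)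
    qed
    moreover have "0 < stieltjes_const h * (2 * ?B) + 1"
      unfolding Beta_def using 3 stieltjes_const_nonneg[OF 3]
      by (intro add_nonneg_pos mult_nonneg_nonneg divide_nonneg_nonneg) (auto intro!: Gamma_real_nonneg)
    ultimately show ?thesis by (intro that)
  qed
qed

text \<open>Replacing 1 + t by t in the mixture gives the power of x exactly. The kernels differ by
  at most 1 / (t^2 + x^2), whose integral against t powr (2 h - 2) is one order smaller. For h = 1/2
  the leading coefficient vanishes, and for h = 1 there is no error.\<close>

lemma cauchy_cov_asymp:
  assumes h: "1/2 \<le> h" "h \<le> 1"
  obtains K where "0 < K" "\<And>x. 0 < x \<Longrightarrow> \<bar>cauchy_cov h x - h * (2 * h - 1) * x powr (2 * h - 2)\<bar> \<le> K * x powr (2 * h - 3)"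
proof -
  consider "h = 1/2" | "h = 1" | "1/2 < h" "h < 1" using h by linarith
  then show ?thesis
  proof cases
    case 1
    have "\<bar>1 / (pi * (1 + x\<^sup>2))\<bar> \<le> 1 * x powr (- 2)" if "0 < x" for x
    proof -
      have "x\<^sup>2 \<le> 1 + x\<^sup>2" by simp
      also have "\<dots> \<le> pi * (1 + x\<^sup>2)"
        using pi_ge_two by (auto simp: mult_le_cancel_right1 not_less intro!: add_nonneg_nonneg)
      finally have "1 / (pi * (1 + x\<^sup>2)) \<le> 1 / x\<^sup>2"
        using that by (intro divide_left_mono) (auto intro!: mult_pos_pos add_pos_nonneg)
      then show ?thesis
        using that by (simp add: powr_minus divide_inverse abs_mult)
    qed
    then show ?thesis by (intro that[of 1]) (simp_all add: 1 cauchy_cov_def)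
  next
    case 2
    then show ?thesis by (intro that[of 1]) (auto simp: cauchy_cov_def)
  next
    case 3
    let ?G = "Gamma (1 - (2 - 2 * h) / 2) * Gamma ((2 - 2 * h) / 2) / 2"
    let ?G' = "Gamma (1 - (3 - 2 * h) / 2) * Gamma ((3 - 2 * h) / 2) / 2"
    have G: "0 \<le> ?G" "0 \<le> ?G'" using 3 by (auto intro!: mult_nonneg_nonneg Gamma_real_nonneg)
    have CG: "stieltjes_const h * ?G = h * (2 * h - 1)"
      by (rule stieltjes_const_Gamma[OF 3])
    have "\<bar>cauchy_cov h x - h * (2 * h - 1) * x powr (2 * h - 2)\<bar> \<le> (stieltjes_const h * ?G' + 1) * x powr (2 * h - 3)" if x: "0 < x" for x
    proof -
      let ?f = "\<lambda>t. stieltjes_integrand h x t"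
      let ?g = "\<lambda>t. t powr (2 * h - 1) / (t\<^sup>2 + x\<^sup>2)"
      let ?k = "\<lambda>t. t powr (2 * h - 2) / (t\<^sup>2 + x\<^sup>2)"
      have f: "set_integrable lborel {0<..} ?f" by (rule stieltjes_integral(1)[OF 3])
      have "(\<integral>\<^sup>+t\<in>{0<..}. ennreal (?g t) \<partial>lborel) = ennreal (?G * x powr (2 * h - 2))"
        using nn_integral_powr_over_sq_sum[of "2 - 2 * h" x] 3 x by simp
      note g = set_integral_of_nn_integral[OF _ _ _ this mult_nonneg_nonneg[OF G(1) powr_ge_zero]]
      have g: "set_integrable lborel {0<..} ?g" "(LINT t:{0<..}|lborel. ?g t) = ?G * x powr (2 * h - 2)"
        by (rule g; simp)+
      have "(\<integral>\<^sup>+t\<in>{0<..}. ennreal (?k t) \<partial>lborel) = ennreal (?G' * x powr (2 * h - 3))"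
        using nn_integral_powr_over_sq_sum[of "3 - 2 * h" x] 3 x by simp
      note k = set_integral_of_nn_integral[OF _ _ _ this mult_nonneg_nonneg[OF G(2) powr_ge_zero]]
      have k: "set_integrable lborel {0<..} ?k" "(LINT t:{0<..}|lborel. ?k t) = ?G' * x powr (2 * h - 3)"
        by (rule k; simp)+
      have ptw: "\<bar>?f t - ?g t\<bar> \<le> ?k t" if t: "0 < t" for t
      proof -
        define a b where "a = (1 + t)\<^sup>2 + x\<^sup>2" and "b = t\<^sup>2 + x\<^sup>2"
        have ab: "0 < a" "0 < b" using x t by (auto simp: a_def b_def intro!: add_pos_pos)
        have "(1 + t) * b - t * a = x\<^sup>2 - t * (1 + t)"
          unfolding a_def b_def by (simp add: power2_eq_square algebra_simps)
        moreover have "\<bar>x\<^sup>2 - t * (1 + t)\<bar> \<le> a"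
          unfolding a_def using t by (simp add: abs_le_iff power2_eq_square algebra_simps)
        ultimately have "\<bar>(1 + t) / a - t / b\<bar> \<le> 1 / b"
          using ab by (subst diff_frac_eq) (auto simp: abs_mult field_simps)
        then have "t powr (2 * h - 2) * \<bar>(1 + t) / a - t / b\<bar> \<le> t powr (2 * h - 2) * (1 / b)"
          by (rule mult_left_mono) simp
        moreover have "t powr (2 * h - 1) = t powr (2 * h - 2) * t"
          using powr_add[of t "2 * h - 2" 1] t by simp
        moreover have "P * ((1 + t) / a) - P * t / b = P * ((1 + t) / a - t / b)" for P
          by (simp add: right_diff_distrib)
        moreover have "\<bar>t powr (2 * h - 2) * ((1 + t) / a - t / b)\<bar> = t powr (2 * h - 2) * \<bar>(1 + t) / a - t / b\<bar>"
          by (simp add: abs_mult)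
        ultimately show ?thesis
          unfolding a_def[symmetric] b_def[symmetric] by (simp only: times_divide_eq_right mult_1_right)
      qed
      have "\<bar>(LINT t:{0<..}|lborel. ?f t) - (LINT t:{0<..}|lborel. ?g t)\<bar> = \<bar>LINT t:{0<..}|lborel. ?f t - ?g t\<bar>"
        using f g by (subst set_integral_diff(2)) auto
      also have "\<dots> \<le> (LINT t:{0<..}|lborel. ?k t)"
        unfolding set_lebesgue_integral_def
        by (rule integral_le_of_dominated) (use k(1) ptw in \<open>auto simp: set_integrable_def indicator_def\<close>)
      finally have "stieltjes_const h * \<bar>(LINT t:{0<..}|lborel. ?f t) - ?G * x powr (2 * h - 2)\<bar> \<le> stieltjes_const h * (?G' * x powr (2 * h - 3))"
        unfolding g k using stieltjes_const_nonneg[OF 3] by (intro mult_left_mono) auto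
      also have "stieltjes_const h * \<bar>(LINT t:{0<..}|lborel. ?f t) - ?G * x powr (2 * h - 2)\<bar> =
         \<bar>stieltjes_const h * (LINT t:{0<..}|lborel. ?f t) - stieltjes_const h * ?G * x powr (2 * h - 2)\<bar>"
        using stieltjes_const_nonneg[OF 3] by (simp add: abs_mult_pos' right_diff_distrib mult.assoc)
      also have "\<dots> = \<bar>cauchy_cov h x - h * (2 * h - 1) * x powr (2 * h - 2)\<bar>"
        unfolding CG using 3 by (simp add: cauchy_cov_def)
      finally show ?thesis by (simp add: algebra_simps add_increasing)
    qed
    moreover have "0 < stieltjes_const h * ?G' + 1"
      using stieltjes_const_nonneg[OF 3] G by (intro add_nonneg_pos mult_nonneg_nonneg) auto
    ultimately show ?thesis by (intro that)
  qed
qed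

lemma cauchy_cov_scaled:
  fixes h e r :: real
  assumes h: "1/2 < h" "h < 1" and e: "0 < e"
  shows "(\<integral>\<^sup>+t\<in>{0<..}. ennreal (stieltjes_const h * (t powr (2 * h - 2) * ((t + e) / ((t + e)\<^sup>2 + r\<^sup>2)))) \<partial>lborel)
    = ennreal (e powr (2 * h - 2) * cauchy_cov h (r / e))"
proof -
  let ?C = "stieltjes_const h"
  let ?f = "\<lambda>t. t powr (2 * h - 2) * ((1 + t) / ((1 + t)\<^sup>2 + (r / e)\<^sup>2))"
  have C: "0 \<le> ?C" by (rule stieltjes_const_nonneg[OF h])
  have "(\<integral>\<^sup>+t\<in>{0<..}. ennreal (?C * (t powr (2 * h - 2) * ((t + e) / ((t + e)\<^sup>2 + r\<^sup>2)))) \<partial>lborel)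
    = ennreal e * (\<integral>\<^sup>+t\<in>{0<..}. ennreal (?C * ((e * t) powr (2 * h - 2) * ((e * t + e) / ((e * t + e)\<^sup>2 + r\<^sup>2)))) \<partial>lborel)"
    by (rule nn_integral_scale_pos) (use e in auto)
  also have "\<dots> = ennreal e * (\<integral>\<^sup>+t\<in>{0<..}. ennreal (?C * e powr (2 * h - 2) / e) * ennreal (?f t) \<partial>lborel)"
  proof (rule arg_cong[where f = "(*) (ennreal e)"], rule nn_integral_cong)
    fix t :: real
    have "(e * t) powr (2 * h - 2) * ((e * t + e) / ((e * t + e)\<^sup>2 + r\<^sup>2)) = e powr (2 * h - 2) / e * ?f t" if "0 < t"
    proof -
      have 1: "e * t + e = e * (1 + t)" by (simp add: algebra_simps)
      have 2: "(e * (1 + t))\<^sup>2 + r\<^sup>2 = e\<^sup>2 * ((1 + t)\<^sup>2 + (r / e)\<^sup>2)"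
        unfolding power_mult_distrib distrib_left[of "e\<^sup>2"] using e by (simp add: power_divide)
      show ?thesis
        unfolding 1 2 using e that by (simp add: powr_mult power2_eq_square)
    qed
    moreover have "?C * (P / e * F) = ?C * P / e * F" for P F
      by simp
    ultimately have "?C * ((e * t) powr (2 * h - 2) * ((e * t + e) / ((e * t + e)\<^sup>2 + r\<^sup>2))) = ?C * e powr (2 * h - 2) / e * ?f t" if "0 < t"
      using that by (simp only:)
    then show "ennreal (?C * ((e * t) powr (2 * h - 2) * ((e * t + e) / ((e * t + e)\<^sup>2 + r\<^sup>2)))) * indicator {0<..} t
      = ennreal (?C * e powr (2 * h - 2) / e) * ennreal (?f t) * indicator {0<..} t"
      using C e by (cases "0 < t") (simp_all only: ennreal_mult'[symmetric] divide_nonneg_nonneg mult_nonneg_nonneg powr_ge_zero less_imp_le, simp)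
  qed
  also have "\<dots> = ennreal e * (ennreal (?C * e powr (2 * h - 2) / e) * ennreal (LINT t:{0<..}|lborel. ?f t))"
    by (simp only: mult.assoc, subst nn_integral_cmult, simp,
        subst nn_integral_eq_set_integral[OF stieltjes_integral(1)[OF h]]) simp_all
  also have "\<dots> = ennreal (e * (?C * e powr (2 * h - 2) / e * (LINT t:{0<..}|lborel. ?f t)))"
    using e C by (subst ennreal_mult', simp, subst ennreal_mult') simp_all
  also have "e * (?C * e powr (2 * h - 2) / e * (LINT t:{0<..}|lborel. ?f t)) = e powr (2 * h - 2) * cauchy_cov h (r / e)"
    using e h by (simp add: cauchy_cov_def)
  finally show ?thesis .
qed

text \<open>The point r = 0 is excluded by the Cauchy convolution; in the time integral it
  corresponds to the diagonal s1 = s2, a null set.\<close>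

lemma nn_integral_cov_factor_cauchy:
  fixes h e r :: real
  assumes h: "1/2 \<le> h" "h \<le> 1" and e: "0 < e" and r: "r \<noteq> 0"
  shows "(\<integral>\<^sup>+u. ennreal (cauchy_density e (r - u)) \<partial>cov_factor h)
    = ennreal (e powr (2 * h - 2) * cauchy_cov h (r / e))"
proof -
  let ?m = "\<lambda>u t. ennreal (stieltjes_const h * (t powr (2 * h - 2) * (t / (u\<^sup>2 + t\<^sup>2))))"
  consider "h = 1/2" | "h = 1" | "1/2 < h" "h < 1" using h by linarith
  then show ?thesis
  proof cases
    case 1
    have "cauchy_density e r = e powr (- 1) * (1 / (pi * (1 + (r / e)\<^sup>2)))"
    proof -
      have "r\<^sup>2 + e\<^sup>2 = e\<^sup>2 * (1 + (r / e)\<^sup>2)"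
        using e by (simp add: power_divide distrib_left)
      then show ?thesis
        using e by (simp add: powr_minus power2_eq_square divide_inverse)
    qed
    then show ?thesis
      unfolding 1 by (subst nn_integral_cov_factor_half) (auto simp: cauchy_cov_def)
  next
    case 2
    have "(\<integral>\<^sup>+u. ennreal (cauchy_density e (r - u)) \<partial>cov_factor h)
       = (\<integral>\<^sup>+u. ennreal (cauchy_density e (r - u)) \<partial>lborel)"
      \<comment> \<open>For h = 1 the density of \<open>cov_factor\<close> is 1 except at the
        origin, where \<open>0 powr 0 = 0\<close>.\<close>
      using AE_lborel_singleton[of "0::real"] unfolding 2
      by (subst nn_integral_cov_factor) (auto intro!: nn_integral_cong_AE elim!: eventually_mono)
    then show ?thesis
      using 2 e by (simp add: nn_integral_cauchy cauchy_cov_def)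
  next
    case 3
    let ?G = "Gamma (1 - (2 - 2 * h) / 2) * Gamma ((2 - 2 * h) / 2) / 2"
    let ?C = "stieltjes_const h"
    have C: "0 \<le> ?C" by (rule stieltjes_const_nonneg[OF 3])
    have CG: "?C * ?G = h * (2 * h - 1)"
      by (rule stieltjes_const_Gamma[OF 3])
    \<comment> \<open>At u = 0 the left side is 0 while the mixture diverges; a single point does
      not affect the integral over u.\<close>
    have mix: "ennreal (h * (2 * h - 1) * \<bar>u\<bar> powr (2 * h - 2)) =
        (\<integral>\<^sup>+t\<in>{0<..}. ?m u t \<partial>lborel)" if "u \<noteq> 0" for u
    proof -
      have "ennreal (h * (2 * h - 1) * \<bar>u\<bar> powr (2 * h - 2)) = ennreal ?C * ennreal (?G * \<bar>u\<bar> powr (- (2 - 2 * h)))"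
        unfolding CG[symmetric] using C by (subst ennreal_mult'[symmetric]) (simp_all add: mult.assoc)
      also have "\<dots> = ennreal ?C * (\<integral>\<^sup>+t\<in>{0<..}. ennreal (t powr (1 - (2 - 2 * h)) / (t\<^sup>2 + \<bar>u\<bar>\<^sup>2)) \<partial>lborel)"
        using that 3 by (subst nn_integral_powr_over_sq_sum) auto
      also have "\<dots> = (\<integral>\<^sup>+t. ennreal ?C * (ennreal (t powr (1 - (2 - 2 * h)) / (t\<^sup>2 + \<bar>u\<bar>\<^sup>2)) * indicator {0<..} t) \<partial>lborel)"
        by (subst nn_integral_cmult) auto
      also have "\<dots> = (\<integral>\<^sup>+t\<in>{0<..}. ?m u t \<partial>lborel)"
      proof (rule nn_integral_cong)
        fix t :: real
        have "t powr (1 - (2 - 2 * h)) = t powr (2 * h - 2) * t" if "0 < t"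
          using powr_add[of t "2 * h - 2" 1] that by simp
        then show "ennreal ?C * (ennreal (t powr (1 - (2 - 2 * h)) / (t\<^sup>2 + \<bar>u\<bar>\<^sup>2)) * indicator {0<..} t) =
          ?m u t * indicator {0<..} t"
          using C by (auto simp: indicator_def ennreal_mult'[symmetric] add.commute)
      qed
      finally show ?thesis .
    qed
    have "(\<integral>\<^sup>+u. ennreal (cauchy_density e (r - u)) \<partial>cov_factor h)
      = (\<integral>\<^sup>+u. ennreal (h * (2 * h - 1) * \<bar>u\<bar> powr (2 * h - 2)) * ennreal (cauchy_density e (r - u)) \<partial>lborel)"
      using 3 by (subst nn_integral_cov_factor) auto
    also have "\<dots> = (\<integral>\<^sup>+u. (\<integral>\<^sup>+t\<in>{0<..}. ?m u t \<partial>lborel)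
         * ennreal (cauchy_density e (r - u)) \<partial>lborel)"
      using AE_lborel_singleton[of "0::real"]
      by (intro nn_integral_cong_AE) (auto elim!: eventually_mono simp: mix)
    also have "\<dots> = (\<integral>\<^sup>+u. (\<integral>\<^sup>+t. ?m u t * indicator {0<..} t
         * ennreal (cauchy_density e (r - u)) \<partial>lborel) \<partial>lborel)"
      by (subst nn_integral_multc) auto
    also have "\<dots> = (\<integral>\<^sup>+t. (\<integral>\<^sup>+u. ?m u t * indicator {0<..} t
         * ennreal (cauchy_density e (r - u)) \<partial>lborel) \<partial>lborel)"
      by (rule lborel_pair.Fubini') measurable
    also have "\<dots> = (\<integral>\<^sup>+t\<in>{0<..}. ennreal (?C * (t powr (2 * h - 2) * ((t + e) / ((t + e)\<^sup>2 + r\<^sup>2)))) \<partial>lborel)"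
    proof (rule nn_integral_cong)
      fix t :: real
      show "(\<integral>\<^sup>+u. ?m u t * indicator {0<..} t
         * ennreal (cauchy_density e (r - u)) \<partial>lborel) =
         ennreal (?C * (t powr (2 * h - 2) * ((t + e) / ((t + e)\<^sup>2 + r\<^sup>2)))) * indicator {0<..} t"
      proof (cases "0 < t")
        case True
        have "(\<integral>\<^sup>+u. ?m u t * indicator {0<..} t
           * ennreal (cauchy_density e (r - u)) \<partial>lborel) =
          (\<integral>\<^sup>+u. ennreal (?C * t powr (2 * h - 2) / pi) * ennreal (t / (u\<^sup>2 + t\<^sup>2) * (e / ((r - u)\<^sup>2 + e\<^sup>2))) \<partial>lborel)"
          using True C e by (intro nn_integral_cong) (auto simp: ennreal_mult'[symmetric] mult_ac)
        also have "\<dots> = ennreal (?C * t powr (2 * h - 2) / pi) * ennreal (pi * ((e + t) / (r\<^sup>2 + (e + t)\<^sup>2)))"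
          by (subst nn_integral_cmult, simp, subst nn_integral_cauchy_convolution[OF e True r]) simp
        also have "\<dots> = ennreal (?C * (t powr (2 * h - 2) * ((t + e) / ((t + e)\<^sup>2 + r\<^sup>2))))"
          using C by (subst ennreal_mult'[symmetric]) (auto simp: add.commute)
        finally show ?thesis using True by simp
      qed auto
    qed
    also have "\<dots> = ennreal (e powr (2 * h - 2) * cauchy_cov h (r / e))"
      by (rule cauchy_cov_scaled[OF 3 e])
    finally show ?thesis .
  qed
qed

text \<open>The substitution x = (t + 1) y turns the kernel into 1 / (1 + y^2) and leaves t only in
  t powr (2 h - 2) and (1 + (t + 1) y) powr (- a). The t-integral is then a Beta integral,
  convergent at infinity because a > 2 h - 1, that is, \<rho> < 0.\<close>

lemma nn_integral_cauchy_cov_mixture: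
  fixes h a :: real
  assumes h: "1/2 < h" "h < 1" and a: "2 * h - 1 < a"
  shows "(\<integral>\<^sup>+x\<in>{0<..}. ennreal (cauchy_cov h x * (1 + x) powr (- a)) \<partial>lborel)
    = ennreal (stieltjes_const h * Beta (2 * h - 1) (a - (2 * h - 1))) *
      (\<integral>\<^sup>+y\<in>{0<..}. ennreal (y powr (1 - 2 * h) * (1 + y) powr (2 * h - 1 - a) / (1 + y\<^sup>2)) \<partial>lborel)"
proof -
  let ?C = "stieltjes_const h"
  let ?B = "Beta (2 * h - 1) (a - (2 * h - 1))"
  let ?I = "\<lambda>t x. ennreal (?C * (t powr (2 * h - 2) * ((t + 1) / ((t + 1)\<^sup>2 + x\<^sup>2)))) * indicator {0<..} t *
        (ennreal ((1 + x) powr (- a)) * indicator {0<..} x)"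
  let ?J = "\<lambda>t y. ennreal (?C / (1 + y\<^sup>2) * (t powr (2 * h - 2) * (1 + (t + 1) * y) powr (- a))) *
       indicator {0<..} t * indicator {0<..} y"
  let ?K = "\<lambda>y. ennreal (y powr (1 - 2 * h) * (1 + y) powr (2 * h - 1 - a) / (1 + y\<^sup>2))"
  have C: "0 \<le> ?C" by (rule stieltjes_const_nonneg[OF h])
  have B: "0 \<le> ?B"
    unfolding Beta_def using h a by (intro divide_nonneg_nonneg mult_nonneg_nonneg Gamma_real_nonneg) auto
  have "(\<integral>\<^sup>+x\<in>{0<..}. ennreal (cauchy_cov h x * (1 + x) powr (- a)) \<partial>lborel)
    = (\<integral>\<^sup>+x. (\<integral>\<^sup>+t. ?I t x \<partial>lborel) \<partial>lborel)"
  proof (rule nn_integral_cong)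
    fix x :: real
    have "ennreal (cauchy_cov h x * (1 + x) powr (- a)) * indicator {0<..} x =
      ennreal (cauchy_cov h x) * (ennreal ((1 + x) powr (- a)) * indicator {0<..} x)"
      using cauchy_cov_nonneg[of h x] h by (simp add: ennreal_mult' mult.assoc)
    also have "ennreal (cauchy_cov h x) = (\<integral>\<^sup>+t\<in>{0<..}. ennreal (?C * (t powr (2 * h - 2) * ((t + 1) / ((t + 1)\<^sup>2 + x\<^sup>2)))) \<partial>lborel)"
      using cauchy_cov_scaled[OF h, of 1 x] by simp
    finally show "ennreal (cauchy_cov h x * (1 + x) powr (- a)) * indicator {0<..} x =
      (\<integral>\<^sup>+t. ?I t x \<partial>lborel)"
      by (subst nn_integral_multc) auto
  qed
  also have "\<dots> = (\<integral>\<^sup>+t. (\<integral>\<^sup>+x. ?I t x \<partial>lborel) \<partial>lborel)"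
    by (rule lborel_pair.Fubini') measurable
  also have "\<dots> = (\<integral>\<^sup>+t. (\<integral>\<^sup>+y. ?J t y \<partial>lborel) \<partial>lborel)"
  proof (rule nn_integral_cong)
    fix t :: real
    show "(\<integral>\<^sup>+x. ?I t x \<partial>lborel) =
      (\<integral>\<^sup>+y. ?J t y \<partial>lborel)"
    proof (cases "0 < t")
      case True
      have "(\<integral>\<^sup>+x. ?I t x \<partial>lborel)
        = (\<integral>\<^sup>+x\<in>{0<..}. ennreal (?C * (t powr (2 * h - 2) * ((t + 1) / ((t + 1)\<^sup>2 + x\<^sup>2))) * (1 + x) powr (- a)) \<partial>lborel)"
        using True C by (intro nn_integral_cong) (auto simp: indicator_def ennreal_mult'[symmetric] mult_ac)
      also have "\<dots> = ennreal (t + 1) * (\<integral>\<^sup>+y\<in>{0<..}. ennreal (?C * (t powr (2 * h - 2) * ((t + 1) / ((t + 1)\<^sup>2 + ((t + 1) * y)\<^sup>2)))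
          * (1 + (t + 1) * y) powr (- a)) \<partial>lborel)"
        by (rule nn_integral_scale_pos) (use True in auto)
      also have "\<dots> = (\<integral>\<^sup>+y. ennreal (t + 1) * (ennreal (?C * (t powr (2 * h - 2) * ((t + 1) / ((t + 1)\<^sup>2 + ((t + 1) * y)\<^sup>2)))
          * (1 + (t + 1) * y) powr (- a)) * indicator {0<..} y) \<partial>lborel)"
        by (subst nn_integral_cmult) auto
      also have "\<dots> = (\<integral>\<^sup>+y. ?J t y \<partial>lborel)"
      proof (rule nn_integral_cong)
        fix y :: real
        define T where "T = t + 1"
        have T: "0 < T" using True by (simp add: T_def)
        have eq: "T\<^sup>2 + (T * y)\<^sup>2 = T * (T * (1 + y\<^sup>2))"
          by (simp add: power2_eq_square algebra_simps)
        have "T * (?C * (P * (T / (T\<^sup>2 + (T * y)\<^sup>2))) * Q) = ?C / (1 + y\<^sup>2) * (P * Q)" for P Q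
          unfolding eq using T by simp
        note ptw = this[of "t powr (2 * h - 2)" "(1 + T * y) powr (- a)"]
        show "ennreal (t + 1) * (ennreal (?C * (t powr (2 * h - 2) * ((t + 1) / ((t + 1)\<^sup>2 + ((t + 1) * y)\<^sup>2)))
          * (1 + (t + 1) * y) powr (- a)) * indicator {0<..} y) =
          ?J t y"
          unfolding T_def[symmetric] using True T
          unfolding ptw[symmetric] by (cases "0 < y") (simp_all add: ennreal_mult'[symmetric])
      qed
      finally show ?thesis .
    qed auto
  qed
  also have "\<dots> = (\<integral>\<^sup>+y. (\<integral>\<^sup>+t. ?J t y \<partial>lborel) \<partial>lborel)"
    by (rule lborel_pair.Fubini') measurable
  also have "\<dots> = (\<integral>\<^sup>+y. ennreal (?C * ?B) *
     (?K y * indicator {0<..} y) \<partial>lborel)"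
  proof (rule nn_integral_cong)
    fix y :: real
    show "(\<integral>\<^sup>+t. ?J t y \<partial>lborel) =
      ennreal (?C * ?B) * (?K y * indicator {0<..} y)"
    proof (cases "0 < y")
      case True
      \<comment> \<open>Chosen so that 1 + (t + 1) y = y (t + w).\<close>
      define w where "w = (1 + y) / y"
      have w: "0 < w" using True by (simp add: w_def)
      have "(\<integral>\<^sup>+t. ?J t y \<partial>lborel)
       = (\<integral>\<^sup>+t. ennreal (?C / (1 + y\<^sup>2) * y powr (- a)) * (ennreal (t powr (2 * h - 2) * (t + w) powr (- a)) * indicator {0<..} t) \<partial>lborel)"
      proof (rule nn_integral_cong)
        fix t :: real
        have "(1 + (t + 1) * y) powr (- a) = y powr (- a) * (t + w) powr (- a)" if "0 < t"
        proof -
          have "1 + (t + 1) * y = y * (t + w)" using True by (simp add: w_def field_simps)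
          then show ?thesis using True w that by (simp add: powr_mult)
        qed
        then show "?J t y =
          ennreal (?C / (1 + y\<^sup>2) * y powr (- a)) * (ennreal (t powr (2 * h - 2) * (t + w) powr (- a)) * indicator {0<..} t)"
          using True C by (auto simp: indicator_def ennreal_mult'[symmetric] mult_ac)
      qed
      also have "\<dots> = ennreal (?C / (1 + y\<^sup>2) * y powr (- a)) * (\<integral>\<^sup>+t\<in>{0<..}. ennreal (t powr (2 * h - 2) * (t + w) powr (- a)) \<partial>lborel)"
        by (subst nn_integral_cmult) auto
      also have "(\<integral>\<^sup>+t\<in>{0<..}. ennreal (t powr (2 * h - 2) * (t + w) powr (- a)) \<partial>lborel) = ennreal (?B * w powr (2 * h - 1 - a))"
        using nn_integral_powr_over_add[of "2 - 2 * h" a w] h a w by (simp add: algebra_simps)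
      also have "ennreal (?C / (1 + y\<^sup>2) * y powr (- a)) * \<dots> = ennreal (?C / (1 + y\<^sup>2) * y powr (- a) * (?B * w powr (2 * h - 1 - a)))"
        using C by (subst ennreal_mult') auto
      also have "?C / (1 + y\<^sup>2) * y powr (- a) * (?B * w powr (2 * h - 1 - a)) =
         ?C * ?B * ((y powr (- a) * w powr (2 * h - 1 - a)) / (1 + y\<^sup>2))"
        by simp
      also have "w powr (2 * h - 1 - a) = (1 + y) powr (2 * h - 1 - a) * y powr (a - (2 * h - 1))"
        using True powr_minus_divide[of y "2 * h - 1 - a"] by (simp add: w_def powr_divide algebra_simps)
      also have "y powr (- a) * ((1 + y) powr (2 * h - 1 - a) * y powr (a - (2 * h - 1))) =
         (y powr (- a) * y powr (a - (2 * h - 1))) * (1 + y) powr (2 * h - 1 - a)"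
        by (simp only: mult_ac)
      also have "y powr (- a) * y powr (a - (2 * h - 1)) = y powr (1 - 2 * h)"
        by (simp add: powr_add[symmetric])
      finally show ?thesis
        using True C B by (simp add: ennreal_mult'[symmetric])
    qed auto
  qed
  also have "\<dots> = ennreal (?C * ?B) * (\<integral>\<^sup>+y\<in>{0<..}. ?K y \<partial>lborel)"
    by (subst nn_integral_cmult) auto
  finally show ?thesis .
qed

text \<open>Under y = tan u sine and cosine come out exchanged relative to \<open>d_const\<close>;
  the reflection of u in the quarter circle restores them.\<close>

lemma nn_integral_angular:
  fixes h a :: real
  shows "(\<integral>\<^sup>+y\<in>{0<..}. ennreal (y powr (1 - 2 * h) * (1 + y) powr (2 * h - 1 - a) / (1 + y\<^sup>2)) \<partial>lborel)
    = (\<integral>\<^sup>+u\<in>{0..pi/2}. ennreal (cos u powr (- (2 * h - 1)) * sin u powr a / (cos u + sin u) powr (a - (2 * h - 1))) \<partial>lborel)"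
proof -
  let ?T = "\<lambda>u. 1 / (cos u)\<^sup>2 * (tan u powr (1 - 2 * h) * (1 + tan u) powr (2 * h - 1 - a) / (1 + (tan u)\<^sup>2))"
  let ?g = "\<lambda>c s. c powr (- (2 * h - 1)) * s powr a / (c + s) powr (a - (2 * h - 1))"
  have "(\<integral>\<^sup>+y\<in>{0<..}. ennreal (y powr (1 - 2 * h) * (1 + y) powr (2 * h - 1 - a) / (1 + y\<^sup>2)) \<partial>lborel)
    = (\<integral>\<^sup>+u\<in>{0<..<pi/2}. ennreal (?T u) \<partial>lborel)"
    by (rule nn_integral_tan) auto
  also have "\<dots> = (\<integral>\<^sup>+u\<in>{0<..<pi/2}. ennreal (?g (sin u) (cos u)) \<partial>lborel)"
  proof (rule nn_integral_cong)
    fix u :: real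
    have "?T u = ?g (sin u) (cos u)"
      if u: "u \<in> {0<..<pi/2}"
    proof -
      have c: "0 < cos u" and s: "0 < sin u"
        using u by (auto intro!: cos_gt_zero sin_gt_zero)
      have "?T u
         = tan u powr (1 - 2 * h) * (1 + tan u) powr (2 * h - 1 - a)"
        by (rule one_plus_tan_sq_cancel[OF c])
      also have "\<dots> = tan u powr (1 - 2 * h) * ((sin u + cos u) / cos u) powr (2 * h - 1 - a)"
        using c by (simp add: tan_def add_divide_distrib add.commute)
      also have "\<dots> = sin u powr (1 - 2 * h) * (sin u + cos u) powr (2 * h - 1 - a) / (cos u powr (1 - 2 * h) * cos u powr (2 * h - 1 - a))"
        using c s by (simp add: tan_def powr_divide)
      also have "cos u powr (1 - 2 * h) * cos u powr (2 * h - 1 - a) = cos u powr (- a)"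
        by (simp add: powr_add[symmetric])
      also have "(sin u + cos u) powr (2 * h - 1 - a) = 1 / (sin u + cos u) powr (a - (2 * h - 1))"
        using powr_minus_divide[of "sin u + cos u" "a - (2 * h - 1)"] by (simp add: algebra_simps)
      also have "sin u powr (1 - 2 * h) * (1 / (sin u + cos u) powr (a - (2 * h - 1))) / cos u powr (- a) = ?g (sin u) (cos u)"
        by (simp add: powr_minus_divide)
      finally show ?thesis .
    qed
    then show "ennreal (?T u) * indicator {0<..<pi/2} u =
      ennreal (?g (sin u) (cos u)) * indicator {0<..<pi/2} u"
      by (cases "u \<in> {0<..<pi/2}") (simp_all only: indicator_simps, simp)
  qed
  also have "\<dots> = (\<integral>\<^sup>+u\<in>{0<..<pi/2}. ennreal (?g (sin (pi/2 - u)) (cos (pi/2 - u))) \<partial>lborel)"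
    by (rule nn_integral_reflect_quarter) auto
  also have "\<dots> = (\<integral>\<^sup>+u\<in>{0..pi/2}. ennreal (?g (cos u) (sin u)) \<partial>lborel)"
    using AE_lborel_singleton[of "0::real"] AE_lborel_singleton[of "pi/2"]
    by (intro nn_integral_cong_AE) (auto elim!: eventually_elim2 simp: sin_diff cos_diff split: split_indicator)
  finally show ?thesis .
qed

text \<open>D is \<open>d_const\<close> without its spatial constant, so this integral will be the
  coefficient of the leading power when \<rho> < 0. At h = 1/2 the Gamma quotient reduces to 1 / pi,
  the constant of the Cauchy density.\<close>

lemma cauchy_cov_integral:
  fixes h a :: real
  assumes h: "1/2 \<le> h" "h < 1" and a: "2 * h - 1 < a" "0 < a"
  defines "D \<equiv> Gamma (a - (2 * h - 1)) / (Gamma a * Gamma (1 - h)) * (Gamma (2 * h + 1) / Gamma h) *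
     (LINT u:{0..pi/2}|lborel. cos u powr (- (2 * h - 1)) * sin u powr a / (cos u + sin u) powr (a - (2 * h - 1)))"
  shows "set_integrable lborel {0<..} (\<lambda>x. cauchy_cov h x * (1 + x) powr (- a))"
    and "(LINT x:{0<..}|lborel. cauchy_cov h x * (1 + x) powr (- a)) = D"
proof -
  let ?y = "\<lambda>y. y powr (1 - 2 * h) * (1 + y) powr (2 * h - 1 - a) / (1 + y\<^sup>2)"
  let ?Y = "\<integral>\<^sup>+y\<in>{0<..}. ennreal (?y y) \<partial>lborel"
  let ?c = "Gamma (a - (2 * h - 1)) / (Gamma a * Gamma (1 - h)) * (Gamma (2 * h + 1) / Gamma h)"
  let ?g = "\<lambda>u. cos u powr (- (2 * h - 1)) * sin u powr a / (cos u + sin u) powr (a - (2 * h - 1))"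
  have c: "0 \<le> ?c"
    using h a by (intro mult_nonneg_nonneg divide_nonneg_nonneg Gamma_real_nonneg) auto
  have main: "(\<integral>\<^sup>+x\<in>{0<..}. ennreal (cauchy_cov h x * (1 + x) powr (- a)) \<partial>lborel) = ennreal ?c * ?Y"
  proof (cases "h = 1/2")
    case True
    have "0 < Gamma a" using a by (intro Gamma_real_pos) auto
    then have c: "?c = 1 / pi"
      unfolding True by (simp add: Gamma_one_half_real Gamma_numeral)
    have "(\<integral>\<^sup>+x\<in>{0<..}. ennreal (cauchy_cov h x * (1 + x) powr (- a)) \<partial>lborel) =
       (\<integral>\<^sup>+y. ennreal ?c * (ennreal (?y y) * indicator {0<..} y) \<partial>lborel)"
      unfolding c unfolding True
      by (intro nn_integral_cong) (auto simp: indicator_def ennreal_mult'[symmetric] cauchy_cov_def)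
    then show ?thesis by (subst (asm) nn_integral_cmult) auto
  next
    case False
    with h have h': "1/2 < h" by simp
    \<comment> \<open>Two uses of the functional equation expose Gamma (2 h - 1), the factor
      contributed by the Beta integral of the mixture.\<close>
    have "Gamma (2 * h + 1) = 2 * h * Gamma (2 * h)"
      using Gamma_plus1[of "2 * h"] h' by (auto simp: nonpos_Ints_def)
    also have "Gamma (2 * h) = (2 * h - 1) * Gamma (2 * h - 1)"
      using Gamma_plus1[of "2 * h - 1"] h' by (auto simp: nonpos_Ints_def)
    finally have "?c = stieltjes_const h * Beta (2 * h - 1) (a - (2 * h - 1))"
      unfolding stieltjes_const_def Beta_def by (simp add: mult_ac)
    then show ?thesis
      using nn_integral_cauchy_cov_mixture[OF h' h(2) a(1)] by simp
  qed
  \<comment> \<open>Finiteness has to be shown because the angular integral in D is a Bochner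
    integral. The dropped factor is at most 1, its exponent 2 h - 1 - a being negative.\<close>
  have "?Y \<le> (\<integral>\<^sup>+y\<in>{0<..}. ennreal (y powr (1 - 2 * h) / (1 + y\<^sup>2)) \<partial>lborel)"
  proof (rule nn_integral_mono)
    fix y :: real
    have "?y y \<le> y powr (1 - 2 * h) / (1 + y\<^sup>2)" if "0 < y"
    proof -
      have "(1 + y) powr (2 * h - 1 - a) \<le> (1 + y) powr 0"
        using that a by (intro powr_mono) auto
      then have "(1 + y) powr (2 * h - 1 - a) \<le> 1" using that by simp
      then show ?thesis
        by (intro divide_right_mono) (auto simp: mult_left_le)
    qed
    then show "ennreal (?y y) * indicator {0<..} y \<le> ennreal (y powr (1 - 2 * h) / (1 + y\<^sup>2)) * indicator {0<..} y"
      by (auto simp: indicator_def intro!: ennreal_leI)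
  qed
  also have "\<dots> < \<infinity>"
    using nn_integral_powr_over_one_plus_sq[of "2 * h"] h by simp
  finally have Y: "?Y < \<infinity>" .
  then obtain Y where Y': "?Y = ennreal Y" "0 \<le> Y"
    by (cases ?Y) auto
  have g: "0 \<le> ?g u" for u by simp
  have "(LINT u:{0..pi/2}|lborel. ?g u) = Y"
    by (rule set_integral_of_nn_integral(2)) (use Y' g nn_integral_angular[of h a] in auto)
  then have D: "D = ?c * Y"
    unfolding D_def by simp
  have nn: "(\<integral>\<^sup>+x\<in>{0<..}. ennreal (cauchy_cov h x * (1 + x) powr (- a)) \<partial>lborel) = ennreal (?c * Y)"
    unfolding main Y' using c by (rule ennreal_mult'[symmetric])
  have [measurable]: "cauchy_cov h \<in> borel_measurable borel"
    using h by (intro borel_measurable_continuous_onI continuous_on_cauchy_cov) auto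
  have nonneg: "0 \<le> cauchy_cov h x * (1 + x) powr (- a)" for x
    using cauchy_cov_nonneg[of h x] h by simp
  note r = set_integral_of_nn_integral[OF _ _ nonneg nn mult_nonneg_nonneg[OF c Y'(2)]]
  show "set_integrable lborel {0<..} (\<lambda>x. cauchy_cov h x * (1 + x) powr (- a))"
    and "(LINT x:{0<..}|lborel. cauchy_cov h x * (1 + x) powr (- a)) = D"
    unfolding D by (rule r; measurable)+
qed

section \<open>Asymptotics of the scaled integrals\<close>

lemma LINT_powr_Ioo:
  fixes e :: real
  assumes "-1 < e"
  shows "set_integrable lborel {0<..<1} (\<lambda>x::real. x powr e)" "(LINT x:{0<..<1}|lborel. x powr e) = 1 / (e + 1)"
  by (rule set_integral_of_nn_integral[OF _ _ _ nn_integral_powr_Ioo[OF assms]]; use assms in simp)+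

lemma LINT_powr_Ici:
  fixes e :: real
  assumes "e < -1"
  shows "set_integrable lborel {1..} (\<lambda>x::real. x powr e)" "(LINT x:{1..}|lborel. x powr e) = - 1 / (e + 1)"
  by (rule set_integral_of_nn_integral[OF _ _ _ nn_integral_powr_Ici[OF assms]]; use assms in \<open>simp add: divide_le_0_iff\<close>)+

text \<open>One K serves for both estimates. The condition \<rho> \<le> 1 makes powers with exponent
  \<rho> - 1 nonincreasing, so that e + r may be replaced by r or by e in upper bounds.\<close>

locale scaling_profile =
  fixes p :: "real \<Rightarrow> real" and k K \<rho> :: real
  assumes cont: "continuous_on {0..} p"
    and nonneg: "0 \<le> x \<Longrightarrow> 0 \<le> p x"
    and upper: "0 \<le> x \<Longrightarrow> p x \<le> K * (1 + x) powr (\<rho> - 1)"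
    and asymp: "0 < x \<Longrightarrow> \<bar>p x - k * x powr (\<rho> - 1)\<bar> \<le> K * x powr (\<rho> - 2)"
    and \<rho>_le_1: "\<rho> \<le> 1"
begin

text \<open>The prefactor is the one for which the leading power of p becomes independent of
  e.\<close>

definition scaled :: "real \<Rightarrow> real \<Rightarrow> real" where
  "scaled e r = e powr (\<rho> - 1) * p (r / e)"

text \<open>Up to the factor 2 the weight 1 - r is the density of the distance between two uniform
  times in [0, 1].\<close>

definition energy :: "real \<Rightarrow> real" where
  "energy e = (LINT r:{0<..<1}|lborel. (1 - r) * scaled e r)"

lemma K_nonneg: "0 \<le> K"
  using nonneg[of 0] upper[of 0] by simp

lemma p_measurable [measurable]: "(\<lambda>x. indicator {0<..} x * p x) \<in> borel_measurable borel"
proof -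
  have "(\<lambda>x. indicator {0..} x *\<^sub>R p x) \<in> borel_measurable borel"
    using cont by (intro borel_measurable_continuous_on_indicator) auto
  then have "(\<lambda>x. indicator {0<..} x * (indicator {0..} x *\<^sub>R p x)) \<in> borel_measurable borel"
    by measurable
  also have "(\<lambda>x. indicator {0<..} x * (indicator {0..} x *\<^sub>R p x)) = (\<lambda>x. indicator {0<..} x * p x)"
    by (auto simp: indicator_def)
  finally show ?thesis .
qed

lemma scaled_measurable:
  assumes "0 < e" "A \<in> sets borel" "A \<subseteq> {0<..}" and [measurable]: "g \<in> borel_measurable borel"
  shows "(\<lambda>r. indicator A r * (g r * scaled e r)) \<in> borel_measurable borel"
proof -
  have [measurable]: "A \<in> sets borel" by fact
  have "(\<lambda>r. indicator A r * (g r * e powr (\<rho> - 1) * (\<lambda>x. indicator {0<..} x * p x) (r / e))) \<in> borel_measurable borel"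
    by (intro borel_measurable_times measurable_compose[OF _ p_measurable]) auto
  also have "(\<lambda>r. indicator A r * (g r * e powr (\<rho> - 1) * (\<lambda>x. indicator {0<..} x * p x) (r / e)))
    = (\<lambda>r. indicator A r * (g r * scaled e r))"
    using assms(1,3) by (auto simp: scaled_def indicator_def fun_eq_iff)
  finally show ?thesis .
qed

lemma scaled_nonneg: "0 < e \<Longrightarrow> 0 < r \<Longrightarrow> 0 \<le> scaled e r"
  using nonneg[of "r / e"] by (simp add: scaled_def)

lemma scaled_le:
  assumes "0 < e" "0 < r"
  shows "scaled e r \<le> K * (e + r) powr (\<rho> - 1)"
proof -
  have "scaled e r \<le> e powr (\<rho> - 1) * (K * (1 + r / e) powr (\<rho> - 1))"
    unfolding scaled_def using assms by (intro mult_left_mono upper) auto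
  also have "1 + r / e = (e + r) / e" using assms by (simp add: field_simps)
  also have "e powr (\<rho> - 1) * (K * ((e + r) / e) powr (\<rho> - 1)) = K * (e + r) powr (\<rho> - 1)"
    using assms by (simp add: powr_divide)
  finally show ?thesis .
qed

lemma scaled_le_powr:
  assumes "0 < e" "0 < r"
  shows "scaled e r \<le> K * r powr (\<rho> - 1)"
proof -
  have "(e + r) powr (\<rho> - 1) \<le> r powr (\<rho> - 1)"
    using assms \<rho>_le_1 by (intro powr_mono2') auto
  then show ?thesis
    using scaled_le[OF assms] K_nonneg by (meson mult_left_mono order_trans)
qed

text \<open>Multiplying \<open>asymp\<close> at r / e by e powr (\<rho> - 1) leaves a main term free
  of e and an error of order e.\<close>

lemma scaled_tendsto:
  assumes "0 < r"
  shows "((\<lambda>e. scaled e r) \<longlongrightarrow> k * r powr (\<rho> - 1)) (at_right 0)"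
proof -
  have "\<bar>scaled e r - k * r powr (\<rho> - 1)\<bar> \<le> K * e * r powr (\<rho> - 2)" if e: "0 < e" for e
  proof -
    have 1: "e powr (\<rho> - 1) * (r / e) powr (\<rho> - 1) = r powr (\<rho> - 1)"
      using e assms by (simp add: powr_divide)
    have "e powr (\<rho> - 1) = e * e powr (\<rho> - 2)"
      using powr_add[of e 1 "\<rho> - 2"] e by simp
    then have 2: "e powr (\<rho> - 1) * (r / e) powr (\<rho> - 2) = e * r powr (\<rho> - 2)"
      using e assms by (simp add: powr_divide)
    have "e powr (\<rho> - 1) * \<bar>p (r / e) - k * (r / e) powr (\<rho> - 1)\<bar> \<le> e powr (\<rho> - 1) * (K * (r / e) powr (\<rho> - 2))"
      using asymp[of "r / e"] e assms by (intro mult_left_mono) auto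
    also have "\<dots> = K * (e powr (\<rho> - 1) * (r / e) powr (\<rho> - 2))"
      by (simp only: mult_ac)
    also have "\<dots> = K * e * r powr (\<rho> - 2)"
      unfolding 2 by simp
    also have "e powr (\<rho> - 1) * \<bar>p (r / e) - k * (r / e) powr (\<rho> - 1)\<bar> =
      \<bar>e powr (\<rho> - 1) * (p (r / e) - k * (r / e) powr (\<rho> - 1))\<bar>"
      by (simp add: abs_mult)
    also have "e powr (\<rho> - 1) * (p (r / e) - k * (r / e) powr (\<rho> - 1)) =
       scaled e r - k * (e powr (\<rho> - 1) * (r / e) powr (\<rho> - 1))"
      by (simp only: scaled_def right_diff_distrib mult_ac)
    finally show ?thesis unfolding 1 .
  qed
  then have "eventually (\<lambda>e. norm (scaled e r - k * r powr (\<rho> - 1)) \<le> K * e * r powr (\<rho> - 2)) (at_right 0)"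
    by (auto simp: eventually_at_right_less intro: eventually_at_rightI[of 0 1])
  moreover have "((\<lambda>e. K * e * r powr (\<rho> - 2)) \<longlongrightarrow> 0) (at_right 0)"
    by (auto intro!: tendsto_eq_intros)
  ultimately have "((\<lambda>e. scaled e r - k * r powr (\<rho> - 1)) \<longlongrightarrow> 0) (at_right 0)"
    by (rule Lim_null_comparison)
  then show ?thesis by (simp only: LIM_zero_iff)
qed

lemma scaled_continuous:
  assumes "0 < r" shows "continuous_on {0<..} (\<lambda>e. scaled e r)"
  unfolding scaled_def
  by (intro continuous_intros continuous_on_compose2[OF cont]) (use assms in auto)

text \<open>The majorant K * r powr (\<rho> - 1) is integrable at 0 because \<rho> > 0. The limit is
  k (1 / \<rho> - 1 / (\<rho> + 1)).\<close>

lemma energy_tendsto_pos: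
  assumes \<rho>: "0 < \<rho>"
  shows "(energy \<longlongrightarrow> k / ((1 + \<rho>) * \<rho>)) (at_right 0)"
proof -
  have "((\<lambda>e. LINT r|lborel. indicator {0<..<1} r * ((1 - r) * scaled e r)) \<longlongrightarrow>
      (LINT r|lborel. indicator {0<..<1} r * ((1 - r) * (k * r powr (\<rho> - 1))))) (at_right 0)"
  proof (rule tendsto_integral_dominated)
    show "integrable lborel (\<lambda>r. indicator {0<..<1} r * (K * r powr (\<rho> - 1)))"
      using set_integrable_mult_right[OF LINT_powr_Ioo(1)[of "\<rho> - 1"], of K] \<rho> by (simp add: set_integrable_def)
    show "(\<lambda>r. indicator {0<..<1} r * ((1 - r) * scaled e r)) \<in> borel_measurable lborel" if "e \<in> {0<..}" for e
      using that scaled_measurable[of e "{0<..<1}" "\<lambda>r. 1 - r"] by (simp add: subset_eq)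
    show "AE r in lborel. \<bar>indicator {0<..<1} r * ((1 - r) * scaled e r)\<bar> \<le> indicator {0<..<1} r * (K * r powr (\<rho> - 1))"
      if "e \<in> {0<..}" for e
    proof (rule AE_I2)
      fix r :: real
      show "\<bar>indicator {0<..<1} r * ((1 - r) * scaled e r)\<bar> \<le> indicator {0<..<1} r * (K * r powr (\<rho> - 1))"
      proof (cases "r \<in> {0<..<1}")
        case True
        then have "(1 - r) * scaled e r \<le> 1 * scaled e r"
          using that scaled_nonneg[of e r] by (intro mult_right_mono) auto
        then show ?thesis
          using True that scaled_nonneg[of e r] scaled_le_powr[of e r] by (auto simp: abs_mult)
      qed auto
    qed
    show "AE r in lborel. ((\<lambda>e. indicator {0<..<1} r * ((1 - r) * scaled e r)) \<longlongrightarrow>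
        indicator {0<..<1} r * ((1 - r) * (k * r powr (\<rho> - 1)))) (at_right 0)"
    proof (rule AE_I2)
      fix r :: real
      show "((\<lambda>e. indicator {0<..<1} r * ((1 - r) * scaled e r)) \<longlongrightarrow>
        indicator {0<..<1} r * ((1 - r) * (k * r powr (\<rho> - 1)))) (at_right 0)"
        using scaled_tendsto[of r] by (cases "r \<in> {0<..<1}") (auto intro!: tendsto_intros)
    qed
  qed auto
  also have "(LINT r|lborel. indicator {0<..<1} r * ((1 - r) * (k * r powr (\<rho> - 1)))) =
      (LINT r:{0<..<1}|lborel. k * r powr (\<rho> - 1) - k * r powr \<rho>)"
    unfolding set_lebesgue_integral_def
  proof (rule Bochner_Integration.integral_cong)
    fix r :: real
    show "indicator {0<..<1} r * ((1 - r) * (k * r powr (\<rho> - 1))) = indicator {0<..<1} r *\<^sub>R (k * r powr (\<rho> - 1) - k * r powr \<rho>)"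
      using powr_add[of r 1 "\<rho> - 1"] by (auto simp: indicator_def algebra_simps)
  qed auto
  also have "\<dots> = k * (1 / \<rho>) - k * (1 / (\<rho> + 1))"
    using LINT_powr_Ioo[of "\<rho> - 1"] LINT_powr_Ioo[of \<rho>] \<rho> by (subst set_integral_diff) auto
  also have "\<dots> = k / ((1 + \<rho>) * \<rho>)"
    using \<rho> by (simp add: field_simps)
  finally show ?thesis
    by (simp add: energy_def[abs_def] set_lebesgue_integral_def)
qed

end

text \<open>Common majorant for the two logarithmic subtractions: the one in the energy for \<rho> =
  0 and the one in \<open>Gamma0\<close>.\<close>

abbreviation inverse_square_tail :: "real \<Rightarrow> real" where
  "inverse_square_tail z \<equiv> indicator {0<..<1} z + indicator {1..} z * z powr (- 2)"

lemma inverse_square_tail_integrable: "integrable lborel inverse_square_tail"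
proof -
  have "integrable lborel (indicator {0<..<1} :: real \<Rightarrow> real)"
    by (intro integrable_real_indicator) auto
  moreover have "integrable lborel (\<lambda>x. indicator {1..} x * x powr (- 2) :: real)"
    using LINT_powr_Ici(1)[of "- 2"] by (simp add: set_integrable_def)
  ultimately show ?thesis by (rule Bochner_Integration.integrable_add)
qed

text \<open>Limit of \<open>remainder_integrand\<close> up to the factor k, and its majorant up to
  K. It behaves like r powr \<rho> at 0 and like r powr (\<rho> - 1) at infinity, hence the range -1
  < \<rho> < 0.\<close>

abbreviation capped_powr :: "real \<Rightarrow> real \<Rightarrow> real" where
  "capped_powr \<rho> r \<equiv> indicator {0<..} r * (min r 1 * r powr (\<rho> - 1))"

lemma capped_powr_integral:
  fixes \<rho> :: real
  assumes "-1 < \<rho>" "\<rho> < 0"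
  shows "integrable lborel (capped_powr \<rho>)"
    and "(LINT r|lborel. capped_powr \<rho> r) = - 1 / ((1 + \<rho>) * \<rho>)"
proof -
  have split: "(capped_powr \<rho>) =
     (\<lambda>r. indicator {0<..<1} r *\<^sub>R r powr \<rho> + indicator {1..} r *\<^sub>R r powr (\<rho> - 1))"
  proof
    fix r :: real
    have "r * r powr (\<rho> - 1) = r powr \<rho>" if "0 < r"
      using powr_add[of r 1 "\<rho> - 1"] that by simp
    then show "capped_powr \<rho> r =
      indicator {0<..<1} r *\<^sub>R r powr \<rho> + indicator {1..} r *\<^sub>R r powr (\<rho> - 1)"
      by (auto simp: indicator_def min_def)
  qed
  have 1: "integrable lborel (\<lambda>r. indicator {0<..<1} r *\<^sub>R r powr \<rho>)"
    "(LINT r|lborel. indicator {0<..<1} r *\<^sub>R r powr \<rho>) = 1 / (\<rho> + 1)"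
    using LINT_powr_Ioo[of \<rho>] assms by (simp_all add: set_integrable_def set_lebesgue_integral_def)
  have 2: "integrable lborel (\<lambda>r. indicator {1..} r *\<^sub>R r powr (\<rho> - 1))"
    "(LINT r|lborel. indicator {1..} r *\<^sub>R r powr (\<rho> - 1)) = - 1 / \<rho>"
    using LINT_powr_Ici[of "\<rho> - 1"] assms by (simp_all add: set_integrable_def set_lebesgue_integral_def)
  show "integrable lborel (capped_powr \<rho>)"
    unfolding split by (rule Bochner_Integration.integrable_add[OF 1(1) 2(1)])
  have "(LINT r|lborel. capped_powr \<rho> r) = 1 / (\<rho> + 1) - 1 / \<rho>"
    unfolding split Bochner_Integration.integral_add[OF 1(1) 2(1)] 1(2) 2(2) by simp
  also have "\<dots> = - 1 / ((1 + \<rho>) * \<rho>)"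
    using assms by (simp add: field_simps)
  finally show "(LINT r|lborel. capped_powr \<rho> r) = - 1 / ((1 + \<rho>) * \<rho>)" .
qed

lemma LINT_inverse_one_plus:
  fixes T :: real
  assumes "0 \<le> T"
  shows "set_integrable lborel {0<..<T} (\<lambda>x. 1 / (1 + x))" "(LINT x:{0<..<T}|lborel. 1 / (1 + x)) = ln (1 + T)"
proof -
  have "((\<lambda>x. 1 / (1 + x)) has_integral ln (1 + T) - ln (1 + 0)) {0..T}"
    using assms
    by (intro fundamental_theorem_of_calculus)
       (auto intro!: derivative_eq_intros simp: has_real_derivative_iff_has_vector_derivative[symmetric])
  then have "((\<lambda>x. 1 / (1 + x)) has_integral ln (1 + T)) {0<..<T}"
    by (simp add: has_integral_Icc_iff_Ioo)
  from nn_integral_has_integral_lebesgue'[OF _ this]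
  have "(\<integral>\<^sup>+x\<in>{0<..<T}. ennreal (1 / (1 + x)) \<partial>lborel) = ennreal (ln (1 + T))"
    by simp
  from set_integral_of_nn_integral[OF _ _ _ this] assms
  show "set_integrable lborel {0<..<T} (\<lambda>x. 1 / (1 + x))" "(LINT x:{0<..<T}|lborel. 1 / (1 + x)) = ln (1 + T)"
    by auto
qed

section \<open>The regime \<rho> < 0\<close>

context scaling_profile
begin

abbreviation remainder_integrand :: "real \<Rightarrow> real \<Rightarrow> real" where
  "remainder_integrand e r \<equiv> indicator {0<..} r * (min r 1 * scaled e r)"

text \<open>As \<open>max (1 - r) 0 = 1 - min r 1\<close>, the energy is the integral of \<^const>\<open>scaled\<close> over the half-line,
  a pure power of \<open>e\<close>, plus this remainder.\<close>

definition remainder :: "real \<Rightarrow> real" where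
  "remainder e = - (LINT r|lborel. remainder_integrand e r)"

lemma remainder_le:
  assumes "e \<in> {0<..}"
  shows "AE r in lborel. \<bar>remainder_integrand e r\<bar> \<le> K * (capped_powr \<rho> r)"
proof (rule AE_I2)
  fix r :: real
  show "\<bar>remainder_integrand e r\<bar> \<le> K * (capped_powr \<rho> r)"
  proof (cases "0 < r")
    case True
    have "min r 1 * scaled e r \<le> min r 1 * (K * r powr (\<rho> - 1))"
      using True assms scaled_le_powr[of e r] by (intro mult_left_mono) auto
    moreover have "0 \<le> min r 1 * scaled e r"
      using True assms scaled_nonneg[of e r] by (intro mult_nonneg_nonneg) auto
    ultimately show ?thesis
      using True by (simp add: mult.left_commute)
  qed auto
qed

lemma remainder_measurable:
  assumes "e \<in> {0<..}"
  shows "(\<lambda>r. remainder_integrand e r) \<in> borel_measurable lborel"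
  using scaled_measurable[of e "{0<..}" "\<lambda>r. min r 1"] assms by simp

context
  assumes \<rho>: "-1 < \<rho>" "\<rho> < 0"
begin

lemma remainder_continuous: "continuous_on {0<..} remainder"
  unfolding remainder_def[abs_def]
proof (intro continuous_on_minus continuous_on_integral_dominated)
  show "integrable lborel (\<lambda>r. K * (capped_powr \<rho> r))"
    by (intro integrable_mult_right capped_powr_integral \<rho>)
  show "AE r in lborel. continuous_on {0<..} (\<lambda>e. remainder_integrand e r)"
  proof (rule AE_I2)
    fix r :: real
    show "continuous_on {0<..} (\<lambda>e. remainder_integrand e r)"
      using scaled_continuous[of r] by (cases "0 < r") (auto intro!: continuous_intros)
  qed
qed (rule remainder_le remainder_measurable, assumption)+

lemma remainder_bounded: "bounded (remainder ` {0<..})"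
proof -
  have "norm (remainder e) \<le> (LINT r|lborel. K * (capped_powr \<rho> r))" if "e \<in> {0<..}" for e
    unfolding remainder_def real_norm_def abs_minus_cancel
    by (rule integral_le_of_dominated[OF _ remainder_le[OF that]])
       (intro integrable_mult_right capped_powr_integral \<rho>)
  then show ?thesis by (auto intro!: boundedI)
qed

lemma remainder_tendsto: "(remainder \<longlongrightarrow> k / ((1 + \<rho>) * \<rho>)) (at_right 0)"
proof -
  have "(remainder \<longlongrightarrow> - (LINT r|lborel. k * (capped_powr \<rho> r))) (at_right 0)"
    unfolding remainder_def[abs_def]
  proof (intro tendsto_minus tendsto_integral_dominated)
    show "integrable lborel (\<lambda>r. K * (capped_powr \<rho> r))"
      by (intro integrable_mult_right capped_powr_integral \<rho>)
    show "AE r in lborel. ((\<lambda>e. remainder_integrand e r) \<longlongrightarrow>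
      k * (capped_powr \<rho> r)) (at_right 0)"
    proof (rule AE_I2)
      fix r :: real
      show "((\<lambda>e. remainder_integrand e r) \<longlongrightarrow>
        k * (capped_powr \<rho> r)) (at_right 0)"
      proof (cases "0 < r")
        case True
        then have "((\<lambda>e. min r 1 * scaled e r) \<longlongrightarrow> min r 1 * (k * r powr (\<rho> - 1))) (at_right 0)"
          by (intro tendsto_intros scaled_tendsto)
        then show ?thesis using True by (simp add: mult.left_commute)
      qed auto
    qed
  qed (use remainder_le remainder_measurable in auto)
  then show ?thesis
    using capped_powr_integral(2)[OF \<rho>] by simp
qed

lemma energy_eq_neg:
  assumes p: "set_integrable lborel {0<..} p" and e: "0 < e"
  shows "energy e = (LINT x:{0<..}|lborel. p x) * e powr \<rho> + remainder e"
proof -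
  let ?f = "\<lambda>x. indicator {0<..} x * p x"
  have f: "integrable lborel ?f"
    using p by (simp add: set_integrable_def)
  \<comment> \<open>Substitution r = e x: the Jacobian e and the prefactor e powr (\<rho> - 1)
    combine to e powr \<rho>.\<close>
  have eq: "(\<lambda>r. indicator {0<..} r * scaled e r) = (\<lambda>r. e powr (\<rho> - 1) * ?f (0 + (1 / e) * r))"
    using e by (auto simp: scaled_def indicator_def fun_eq_iff zero_less_divide_iff)
  have 1: "integrable lborel (\<lambda>r. indicator {0<..} r * scaled e r)"
    unfolding eq using e lborel_integrable_real_affine[OF f, of "1 / e" 0] by simp
  have "integral\<^sup>L lborel ?f = \<bar>1 / e\<bar> *\<^sub>R (LINT r|lborel. ?f (0 + (1 / e) * r))"
    using e by (intro lborel_integral_real_affine) simp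
  then have "(LINT r|lborel. ?f (0 + (1 / e) * r)) = e * integral\<^sup>L lborel ?f"
    using e by (simp add: field_simps)
  then have "(LINT r|lborel. indicator {0<..} r * scaled e r) = e powr (\<rho> - 1) * (e * integral\<^sup>L lborel ?f)"
    unfolding eq by simp
  also have "\<dots> = integral\<^sup>L lborel ?f * e powr \<rho>"
    using powr_add[of e "\<rho> - 1" 1] e by (simp add: mult_ac)
  finally have 2: "(LINT r|lborel. indicator {0<..} r * scaled e r) = (LINT x:{0<..}|lborel. p x) * e powr \<rho>"
    by (simp add: set_lebesgue_integral_def)
  have 3: "integrable lborel (\<lambda>r. remainder_integrand e r)"
    by (rule Bochner_Integration.integrable_bound[OF integrable_mult_right[OF capped_powr_integral(1)[OF \<rho>], of K]])
       (use remainder_measurable[of e] remainder_le[of e] e in \<open>auto elim!: eventually_mono\<close>)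
  have "energy e = (LINT r|lborel. indicator {0<..} r * scaled e r - remainder_integrand e r)"
    unfolding energy_def set_lebesgue_integral_def
    by (intro Bochner_Integration.integral_cong) (auto simp: indicator_def min_def algebra_simps)
  also have "\<dots> = (LINT x:{0<..}|lborel. p x) * e powr \<rho> + remainder e"
    unfolding Bochner_Integration.integral_diff[OF 1 3] 2 remainder_def by simp
  finally show ?thesis .
qed

end

section \<open>The regime \<rho> = 0\<close>

abbreviation bulk_integrand :: "real \<Rightarrow> real \<Rightarrow> real" where
  "bulk_integrand e x \<equiv> indicator {0<..} x * (if e * x < 1 then p x - k / (1 + x) else 0)"

abbreviation edge_integrand :: "real \<Rightarrow> real \<Rightarrow> real" where
  "edge_integrand e r \<equiv> indicator {0<..<1} r * (if e = 0 then k else r * scaled e r)"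

text \<open>Of the weight 1 - r, the summand 1 rescales to the integral of p over 0 < x < 1 / e;
  subtracting k / (1 + x) makes it converge as e tends to 0. The cut-off is written e * x < 1 so
  that e = 0 yields the whole half-line.\<close>

definition log_bulk :: "real \<Rightarrow> real" where
  "log_bulk e = (LINT x|lborel. bulk_integrand e x)"

text \<open>Contribution of the summand r of the weight 1 - r. At e = 0 the integrand is set to its
  limit r * (k * r powr (- 1)) = k, which gives continuity up to 0.\<close>

definition log_edge :: "real \<Rightarrow> real" where
  "log_edge e = (LINT r|lborel. edge_integrand e r)"

context
  assumes \<rho>_0: "\<rho> = 0"
begin

text \<open>Subtracting k / (1 + x) instead of k / x keeps the integrand bounded near 0; at infinity
  the two differ only by order x powr (- 2), the size of the error of p itself.\<close>

lemma log_bulk_dominated: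
  shows "integrable lborel (\<lambda>x. (K + \<bar>k\<bar>) * inverse_square_tail x)"
    and "\<bar>bulk_integrand e x\<bar>
      \<le> (K + \<bar>k\<bar>) * inverse_square_tail x"
proof -
  show "integrable lborel (\<lambda>x. (K + \<bar>k\<bar>) * inverse_square_tail x)"
    by (rule integrable_mult_right[OF inverse_square_tail_integrable])
  have small: "\<bar>p x - k / (1 + x)\<bar> \<le> (K + \<bar>k\<bar>) * 1" if "0 < x" "x < 1"
  proof -
    have "p x \<le> K * (1 + x) powr (- 1)" using upper[of x] that \<rho>_0 by simp
    also have "\<dots> \<le> K * 1"
      using that K_nonneg by (intro mult_left_mono) (auto simp: powr_minus field_simps)
    finally have "\<bar>p x\<bar> \<le> K" using nonneg[of x] that by simp
    moreover have "\<bar>k / (1 + x)\<bar> \<le> \<bar>k\<bar>"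
      using that by (simp add: abs_divide divide_le_eq mult_le_cancel_left1)
    ultimately show ?thesis
      using abs_triangle_ineq4[of "p x" "k / (1 + x)"] by simp
  qed
  have large: "\<bar>p x - k / (1 + x)\<bar> \<le> (K + \<bar>k\<bar>) * x powr (- 2)" if "1 \<le> x"
  proof -
    have "\<bar>p x - k / x\<bar> \<le> K * x powr (- 2)"
      using asymp[of x] that \<rho>_0 by (simp add: powr_minus divide_inverse)
    moreover have "\<bar>k / x - k / (1 + x)\<bar> \<le> \<bar>k\<bar> * x powr (- 2)"
    proof -
      have "k / x - k / (1 + x) = k * (1 / (x * (1 + x)))"
        using that by (simp add: field_simps)
      moreover have "1 / (x * (1 + x)) \<le> 1 / x\<^sup>2"
        using that by (intro divide_left_mono) (auto simp: power2_eq_square)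
      moreover have "1 / x\<^sup>2 = x powr (- 2)"
        using that by (simp add: powr_minus divide_inverse)
      moreover have "0 \<le> 1 / (x * (1 + x))" using that by simp
      ultimately show ?thesis
        by (simp only: abs_mult) (intro mult_left_mono; simp)
    qed
    ultimately show ?thesis by (simp add: distrib_right)
  qed
  show "\<bar>bulk_integrand e x\<bar>
      \<le> (K + \<bar>k\<bar>) * inverse_square_tail x"
    using small large K_nonneg by (cases "0 < x"; cases "x < 1") (auto simp: indicator_def)
qed

lemma log_bulk_measurable: "(\<lambda>x. bulk_integrand e x) \<in> borel_measurable lborel"
proof -
  have "(\<lambda>x. if e * x < 1 then indicator {0<..} x * p x - indicator {0<..} x * (k / (1 + x)) else 0) \<in> borel_measurable borel"
    by measurable
  also have "(\<lambda>x. if e * x < 1 then indicator {0<..} x * p x - indicator {0<..} x * (k / (1 + x)) else 0) =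
     (\<lambda>x. bulk_integrand e x)"
    by (auto simp: indicator_def)
  finally show ?thesis by simp
qed

text \<open>For fixed x the integrand is locally constant in e unless e * x = 1, so for each t0 the
  only exceptional point is x = 1 / t0.\<close>

lemma log_bulk_continuous: "continuous_on {0..} log_bulk"
  unfolding continuous_on_def
proof
  fix t0 :: real assume t0: "t0 \<in> {0..}"
  show "(log_bulk \<longlongrightarrow> log_bulk t0) (at t0 within {0..})"
    unfolding log_bulk_def[abs_def]
  proof (rule tendsto_integral_dominated[OF log_bulk_measurable log_bulk_measurable log_bulk_dominated(1)])
    show "AE x in lborel. ((\<lambda>t. bulk_integrand t x) \<longlongrightarrow>
        bulk_integrand t0 x) (at t0 within {0..})"
      using AE_lborel_singleton[of "1 / t0"]
    proof eventually_elim
      case (elim x)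
      have lim: "((\<lambda>t. t * x) \<longlongrightarrow> t0 * x) (at t0 within {0..})"
        by (intro tendsto_intros)
      have ne: "t0 * x \<noteq> 1"
      proof
        assume "t0 * x = 1"
        then have "x = 1 / t0" by (metis mult_zero_left nonzero_mult_div_cancel_left zero_neq_one)
        with elim show False by simp
      qed
      have "eventually (\<lambda>t. (t * x < 1) = (t0 * x < 1)) (at t0 within {0..})"
      proof (cases "t0 * x < 1")
        case True
        with order_tendstoD(2)[OF lim True] show ?thesis by (auto elim!: eventually_mono)
      next
        case False
        with ne have "1 < t0 * x" by simp
        from order_tendstoD(1)[OF lim this] show ?thesis using False by (auto elim!: eventually_mono)
      qed
      then have "eventually (\<lambda>t. bulk_integrand t x =
          bulk_integrand t0 x) (at t0 within {0..})"
        by (rule eventually_mono) simp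
      then show ?case
        by (rule tendsto_eventually)
    qed
  qed (use log_bulk_dominated(2) in auto)
qed

lemma log_bulk_bounded: "bounded (log_bulk ` {0..})"
proof -
  have "norm (log_bulk e) \<le> (LINT x|lborel. (K + \<bar>k\<bar>) * inverse_square_tail x)" for e
    unfolding log_bulk_def real_norm_def
    by (rule integral_le_of_dominated[OF log_bulk_dominated(1)]) (use log_bulk_dominated(2) in auto)
  then show ?thesis by (auto intro!: boundedI)
qed

lemma log_edge_dominated:
  assumes "e \<in> {0..}"
  shows "\<bar>edge_integrand e r\<bar> \<le> (K + \<bar>k\<bar>) * indicator {0<..<1} r"
proof (cases "r \<in> {0<..<1} \<and> e \<noteq> 0")
  case True
  then have "0 < e" "0 < r" using assms by auto
  then have "r * scaled e r \<le> r * (K * r powr (\<rho> - 1))" "0 \<le> r * scaled e r"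
    using scaled_le_powr[of e r] scaled_nonneg[of e r] by (auto intro!: mult_left_mono)
  moreover have "r * (K * r powr (\<rho> - 1)) = K"
    using \<open>0 < r\<close> \<rho>_0 by (simp add: powr_minus field_simps)
  ultimately show ?thesis using True by simp
qed (use K_nonneg in \<open>auto simp: indicator_def\<close>)

lemma log_edge_measurable:
  assumes "e \<in> {0..}"
  shows "(\<lambda>r. edge_integrand e r) \<in> borel_measurable lborel"
  using scaled_measurable[of e "{0<..<1}" "\<lambda>r. r"] assms by (cases "e = 0") (auto simp: subset_eq)

lemma log_edge_integrable: "integrable lborel (\<lambda>r. (K + \<bar>k\<bar>) * indicator {0<..<1::real} r)"
  by (intro integrable_mult_right integrable_real_indicator) auto

text \<open>At e = 0 the continuity of the integrand is \<open>scaled_tendsto\<close>, at e > 0 it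
  is the continuity of p.\<close>

lemma log_edge_continuous: "continuous_on {0..} log_edge"
  unfolding log_edge_def[abs_def]
proof (rule continuous_on_integral_dominated[OF log_edge_measurable log_edge_integrable])
  show "AE r in lborel. continuous_on {0..} (\<lambda>e. edge_integrand e r)"
  proof (rule AE_I2)
    fix r :: real
    show "continuous_on {0..} (\<lambda>e. edge_integrand e r)"
    proof (cases "r \<in> {0<..<1}")
      case True
      then have r: "0 < r" by simp
      let ?f = "\<lambda>e. if e = 0 then k else r * scaled e r"
      have "continuous (at t0 within {0..}) ?f" if "t0 \<in> {0..}" for t0
      proof (cases "t0 = 0")
        case True
        have "((\<lambda>e. r * scaled e r) \<longlongrightarrow> r * (k * r powr (\<rho> - 1))) (at_right 0)"
          by (intro tendsto_intros scaled_tendsto r)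
        also have "r * (k * r powr (\<rho> - 1)) = k"
          using r \<rho>_0 by (simp add: powr_minus field_simps)
        finally have "(?f \<longlongrightarrow> k) (at_right 0)"
          by (rule Lim_transform_eventually) (auto simp: eventually_at_filter)
        then have "(?f \<longlongrightarrow> ?f 0) (at 0 within {0..})"
          by (simp add: at_within_Ici_at_right)
        then show ?thesis using True by (simp add: continuous_within)
      next
        case False
        with that have "0 < t0" by auto
        have "continuous_on {0<..} ?f"
          by (rule continuous_on_cong[THEN iffD1, OF refl _ continuous_on_mult_left[OF scaled_continuous[OF r], of r]]) auto
        then have "isCont ?f t0"
          using \<open>0 < t0\<close> by (simp add: continuous_on_eq_continuous_at)
        then show ?thesis by (rule continuous_at_imp_continuous_at_within)
      qed
      then have "continuous_on {0..} ?f"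
        by (simp add: continuous_on_eq_continuous_within)
      then show ?thesis using True by (auto intro!: continuous_intros)
    qed auto
  qed
qed (use log_edge_dominated in auto)

lemma log_edge_bounded: "bounded (log_edge ` {0..})"
proof -
  have "norm (log_edge e) \<le> (LINT r|lborel. (K + \<bar>k\<bar>) * indicator {0<..<1::real} r)" if "e \<in> {0..}" for e
    unfolding log_edge_def real_norm_def
    by (rule integral_le_of_dominated[OF log_edge_integrable]) (use log_edge_dominated that in auto)
  then show ?thesis by (auto intro!: boundedI)
qed

text \<open>The logarithm is the integral of the subtracted 1 / (1 + x) up to 1 / e.\<close>

lemma energy_eq_zero:
  assumes e: "0 < e"
  shows "energy e = k * ln (1 + 1 / e) + log_bulk e - log_edge e"
proof -
  let ?T = "1 / e"
  have bulk: "integrable lborel (\<lambda>x. bulk_integrand e x)"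
    by (rule Bochner_Integration.integrable_bound[OF log_bulk_dominated(1) log_bulk_measurable])
       (use log_bulk_dominated(2)[of _ e] K_nonneg in \<open>auto simp: abs_mult\<close>)
  have inv: "integrable lborel (\<lambda>x. k * (indicator {0<..<?T} x * (1 / (1 + x))))"
    "(LINT x|lborel. k * (indicator {0<..<?T} x * (1 / (1 + x)))) = k * ln (1 + 1 / e)"
  proof -
    have 1: "integrable lborel (\<lambda>x. indicator {0<..<?T} x * (1 / (1 + x)))"
      "(LINT x|lborel. indicator {0<..<?T} x * (1 / (1 + x))) = ln (1 + 1 / e)"
      using LINT_inverse_one_plus[of ?T] e by (simp_all add: set_integrable_def set_lebesgue_integral_def)
    show "integrable lborel (\<lambda>x. k * (indicator {0<..<?T} x * (1 / (1 + x))))"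
      by (rule integrable_mult_right[OF 1(1)])
    show "(LINT x|lborel. k * (indicator {0<..<?T} x * (1 / (1 + x)))) = k * ln (1 + 1 / e)"
      by (subst integral_mult_right_zero) (simp only: 1(2))
  qed
  have eq: "indicator {0<..<?T} x * p x = k * (indicator {0<..<?T} x * (1 / (1 + x))) +
      bulk_integrand e x" for x
    using e by (auto simp: indicator_def field_simps)
  have p_int: "integrable lborel (\<lambda>x. indicator {0<..<?T} x * p x)"
    unfolding eq by (intro Bochner_Integration.integrable_add inv bulk)
  have p_eq: "(LINT x|lborel. indicator {0<..<?T} x * p x) = k * ln (1 + 1 / e) + log_bulk e"
    unfolding eq log_bulk_def by (subst Bochner_Integration.integral_add[OF inv(1) bulk]) (simp only: inv(2))
  have sc: "indicator {0<..<1} r * scaled e r = 1 / e * (indicator {0<..<?T} (0 + (1 / e) * r) * p (0 + (1 / e) * r))" for r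
    unfolding scaled_def using e \<rho>_0 by (auto simp: indicator_def powr_minus field_simps)
  have s_int: "integrable lborel (\<lambda>r. indicator {0<..<1} r * scaled e r)"
    unfolding sc using e lborel_integrable_real_affine[OF p_int, of "1 / e" 0] by simp
  have "(LINT x|lborel. indicator {0<..<?T} x * p x) = \<bar>1 / e\<bar> *\<^sub>R (LINT r|lborel. indicator {0<..<?T} (0 + (1 / e) * r) * p (0 + (1 / e) * r))"
    using e by (intro lborel_integral_real_affine) simp
  then have s_eq: "(LINT r|lborel. indicator {0<..<1} r * scaled e r) = k * ln (1 + 1 / e) + log_bulk e"
    unfolding sc using e by (simp add: p_eq)
  have e_int: "integrable lborel (\<lambda>r. edge_integrand e r)"
    by (rule Bochner_Integration.integrable_bound[OF log_edge_integrable log_edge_measurable])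
       (use log_edge_dominated[of e] e K_nonneg in \<open>auto simp: abs_mult\<close>)
  have "energy e = (LINT r|lborel. indicator {0<..<1} r * scaled e r - edge_integrand e r)"
    unfolding energy_def set_lebesgue_integral_def using e
    by (intro Bochner_Integration.integral_cong) (auto simp: indicator_def algebra_simps)
  then show ?thesis
    unfolding Bochner_Integration.integral_diff[OF s_int e_int] s_eq log_edge_def by simp
qed

end

end

section \<open>The logarithmic term\<close>

text \<open>The integrand of \<open>Gamma0\<close> minus 1 / (z (1 + z)). The latter has the same
  singularity at 0 and the antiderivative ln (z / (1 + z)), so it carries the whole
  logarithm.\<close>

definition exp_gap :: "real \<Rightarrow> real" where
  "exp_gap z = (exp (- z) - 1 / (1 + z)) / z"

definition Gamma0_log_gap :: "real \<Rightarrow> real" where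
  "Gamma0_log_gap v = (LINT z:{v<..}|lborel. exp_gap z)"

text \<open>The numerator is at most z in absolute value because exp (- z) \<ge> 1 - z, and at most
  1 / z because it lies below 1 / (1 + z).\<close>

lemma exp_gap_bound:
  assumes z: "0 < z"
  shows "\<bar>exp_gap z\<bar> \<le> inverse_square_tail z"
proof -
  have "exp (- z) \<le> 1 / (1 + z)"
    using exp_ge_add_one_self[of z] z by (simp add: exp_minus field_simps)
  then have "\<bar>exp_gap z\<bar> = (1 / (1 + z) - exp (- z)) / z"
    using z by (simp add: exp_gap_def abs_divide)
  moreover have "(1 / (1 + z) - exp (- z)) / z \<le> 1"
  proof -
    have "1 / (1 + z) - exp (- z) \<le> 1 - (1 - z)"
      using exp_ge_add_one_self[of "- z"] z by (intro diff_mono) auto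
    then show ?thesis using z by simp
  qed
  moreover have "(1 / (1 + z) - exp (- z)) / z \<le> z powr (- 2)"
  proof -
    have "1 / (1 + z) - exp (- z) \<le> 1 / z"
      using z by (smt (verit) exp_gt_zero frac_le)
    then have "(1 / (1 + z) - exp (- z)) / z \<le> 1 / z / z"
      using z by (intro divide_right_mono) auto
    then show ?thesis using z by (simp add: powr_minus divide_inverse power2_eq_square)
  qed
  ultimately show ?thesis by (auto simp: indicator_def z)
qed

lemma exp_gap_measurable [measurable]: "exp_gap \<in> borel_measurable borel"
  unfolding exp_gap_def by measurable

lemma exp_gap_integrand_le:
  assumes "0 \<le> v"
  shows "\<bar>indicator {v<..} z *\<^sub>R exp_gap z\<bar> \<le> inverse_square_tail z"
  using exp_gap_bound[of z] assms by (cases "v < z") (auto simp: indicator_def)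

lemma Gamma0_log_gap_bounded:
  obtains L where "0 \<le> L" "\<And>v. 0 \<le> v \<Longrightarrow> \<bar>Gamma0_log_gap v\<bar> \<le> L"
proof -
  have "\<bar>Gamma0_log_gap v\<bar> \<le> (LINT z|lborel. inverse_square_tail z)" if "0 \<le> v" for v
    unfolding Gamma0_log_gap_def set_lebesgue_integral_def
    by (rule integral_le_of_dominated[OF inverse_square_tail_integrable])
       (use exp_gap_integrand_le[OF that] in auto)
  moreover from this[of 0] have "0 \<le> (LINT z|lborel. inverse_square_tail z)"
    by linarith
  ultimately show ?thesis by (intro that)
qed

lemma Gamma0_log_gap_continuous: "continuous_on {0..} Gamma0_log_gap"
  unfolding continuous_on_def
proof
  fix t0 :: real assume t0: "t0 \<in> {0..}"
  show "(Gamma0_log_gap \<longlongrightarrow> Gamma0_log_gap t0) (at t0 within {0..})"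
    unfolding Gamma0_log_gap_def[abs_def] set_lebesgue_integral_def
  proof (rule tendsto_integral_dominated[OF _ _ inverse_square_tail_integrable])
    show "AE z in lborel. ((\<lambda>v. indicator {v<..} z *\<^sub>R exp_gap z) \<longlongrightarrow> indicator {t0<..} z *\<^sub>R exp_gap z) (at t0 within {0..})"
      using AE_lborel_singleton[of t0]
    proof eventually_elim
      case (elim z)
      have lim: "((\<lambda>v. v) \<longlongrightarrow> t0) (at t0 within {0..})" by (rule tendsto_ident_at)
      have "eventually (\<lambda>v. (v < z) = (t0 < z)) (at t0 within {0..})"
      proof (cases "t0 < z")
        case True
        with order_tendstoD(2)[OF lim True] show ?thesis by (auto elim!: eventually_mono)
      next
        case False
        with elim have "z < t0" by simp
        from order_tendstoD(1)[OF lim this] show ?thesis using False by (auto elim!: eventually_mono)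
      qed
      then have "eventually (\<lambda>v. indicator {v<..} z *\<^sub>R exp_gap z = indicator {t0<..} z *\<^sub>R exp_gap z) (at t0 within {0..})"
        by (rule eventually_mono) (simp add: indicator_def)
      then show ?case by (rule tendsto_eventually)
    qed
    show "AE z in lborel. \<bar>indicator {v<..} z *\<^sub>R exp_gap z\<bar> \<le> inverse_square_tail z" if "v \<in> {0..}" for v
      using exp_gap_integrand_le[of v] that by auto
  qed auto
qed

lemma LINT_inverse_times_one_plus:
  fixes v :: real
  assumes v: "0 < v"
  shows "set_integrable lborel {v..} (\<lambda>z. 1 / (z * (1 + z)))" "(LINT z:{v..}|lborel. 1 / (z * (1 + z))) = ln (1 + 1 / v)"
proof -
  have "(\<integral>\<^sup>+z. ennreal (1 / (z * (1 + z))) * indicator {v..} z \<partial>lborel) = ennreal (0 - (ln v - ln (1 + v)))"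
  proof (rule nn_integral_FTC_atLeast)
    show "((\<lambda>z. ln z - ln (1 + z)) has_field_derivative 1 / (z * (1 + z))) (at z)" if "v \<le> z" for z
      using that v by (auto intro!: derivative_eq_intros simp: field_simps)
    show "((\<lambda>z::real. ln z - ln (1 + z)) \<longlongrightarrow> 0) at_top" by real_asymp
  qed (use v in auto)
  also have "0 - (ln v - ln (1 + v)) = ln (1 + 1 / v)"
    using v ln_div[of "1 + v" v] by (simp add: add_divide_distrib add.commute)
  finally have nn: "(\<integral>\<^sup>+z\<in>{v..}. ennreal (1 / (z * (1 + z))) \<partial>lborel) = ennreal (ln (1 + 1 / v))" .
  from set_integral_of_nn_integral[OF _ _ _ nn] v
  show "set_integrable lborel {v..} (\<lambda>z. 1 / (z * (1 + z)))" "(LINT z:{v..}|lborel. 1 / (z * (1 + z))) = ln (1 + 1 / v)"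
    by auto
qed

lemma Gamma0_eq:
  assumes v: "0 < v"
  shows "Gamma0 v = ln (1 + 1 / v) + Gamma0_log_gap v"
proof -
  have 1: "integrable lborel (\<lambda>z. indicator {v..} z *\<^sub>R (1 / (z * (1 + z))))"
    using LINT_inverse_times_one_plus(1)[OF v] by (simp add: set_integrable_def)
  have 2: "integrable lborel (\<lambda>z. indicator {v<..} z *\<^sub>R exp_gap z)"
    by (rule Bochner_Integration.integrable_bound[OF inverse_square_tail_integrable])
       (use exp_gap_integrand_le[of v] v in \<open>auto simp: abs_of_nonneg\<close>)
  have "Gamma0 v = (LINT z|lborel. indicator {v..} z *\<^sub>R (1 / (z * (1 + z))) + indicator {v<..} z *\<^sub>R exp_gap z)"
    unfolding Gamma0_def set_lebesgue_integral_def
  proof (rule integral_cong_AE)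
    show "AE z in lborel. indicator {v..} z *\<^sub>R (exp (- z) / z) =
      indicator {v..} z *\<^sub>R (1 / (z * (1 + z))) + indicator {v<..} z *\<^sub>R exp_gap z"
      using AE_lborel_singleton[of v]
    proof eventually_elim
      case (elim z)
      show ?case
      proof (cases "v < z")
        case True
        have "exp_gap z = exp (- z) / z - 1 / (1 + z) / z"
          by (simp add: exp_gap_def diff_divide_distrib)
        then show ?thesis
          using True by (simp add: mult.commute)
      qed (use elim in auto)
    qed
  qed auto
  also have "\<dots> = ln (1 + 1 / v) + Gamma0_log_gap v"
    unfolding Bochner_Integration.integral_add[OF 1 2]
    using LINT_inverse_times_one_plus(2)[OF v] by (simp add: Gamma0_log_gap_def set_lebesgue_integral_def)
  finally show ?thesis .
qed

section \<open>Angular averages and the function \<open>ell\<close>\<close>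

lemma nn_integral_full_circle:
  fixes F :: "real \<Rightarrow> ennreal"
  assumes [measurable]: "F \<in> borel_measurable borel"
    and per: "\<And>u. F (pi + u) = F u" and refl: "\<And>u. F (pi - u) = F u"
  shows "(\<integral>\<^sup>+u\<in>{0..2*pi}. F u \<partial>lborel) = 4 * (\<integral>\<^sup>+u\<in>{0<..<pi/2}. F u \<partial>lborel)"
proof -
  let ?Q = "\<integral>\<^sup>+u\<in>{0<..<pi/2}. F u \<partial>lborel"
  have half: "(\<integral>\<^sup>+u\<in>{0<..<pi}. F u \<partial>lborel) = ?Q + ?Q"
  proof -
    have "(\<integral>\<^sup>+u\<in>{0<..<pi}. F u \<partial>lborel) = (\<integral>\<^sup>+u. F u * indicator {0<..<pi/2} u + F u * indicator {pi/2<..<pi} u \<partial>lborel)"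
      using AE_lborel_singleton[of "pi/2"]
      by (intro nn_integral_cong_AE) (auto elim!: eventually_mono split: split_indicator)
    also have "\<dots> = ?Q + (\<integral>\<^sup>+u\<in>{pi/2<..<pi}. F u \<partial>lborel)"
      by (rule nn_integral_add) auto
    also have "(\<integral>\<^sup>+u\<in>{pi/2<..<pi}. F u \<partial>lborel) = ?Q"
      by (subst nn_integral_real_affine[where c = "-1" and t = pi])
         (auto simp: refl intro!: nn_integral_cong split: split_indicator)
    finally show ?thesis .
  qed
  have "(\<integral>\<^sup>+u\<in>{0..2*pi}. F u \<partial>lborel) = (\<integral>\<^sup>+u. F u * indicator {0<..<pi} u + F u * indicator {pi<..<2*pi} u \<partial>lborel)"
    using AE_lborel_singleton[of 0] AE_lborel_singleton[of pi] AE_lborel_singleton[of "2*pi"]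
    by (intro nn_integral_cong_AE, eventually_elim) (auto split: split_indicator)
  also have "\<dots> = (\<integral>\<^sup>+u\<in>{0<..<pi}. F u \<partial>lborel) + (\<integral>\<^sup>+u\<in>{pi<..<2*pi}. F u \<partial>lborel)"
    by (rule nn_integral_add) auto
  also have "(\<integral>\<^sup>+u\<in>{pi<..<2*pi}. F u \<partial>lborel) = (\<integral>\<^sup>+u\<in>{0<..<pi}. F u \<partial>lborel)"
    by (subst nn_integral_real_affine[where c = 1 and t = pi])
       (auto simp: per intro!: nn_integral_cong split: split_indicator)
  also have "(\<integral>\<^sup>+u\<in>{0<..<pi}. F u \<partial>lborel) + (\<integral>\<^sup>+u\<in>{0<..<pi}. F u \<partial>lborel) = 4 * ?Q"
  proof -
    have "x + x + (x + x) = (1 + 1 + (1 + 1)) * x" for x :: ennreal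
      by (simp only: distrib_right mult_1)
    then show ?thesis unfolding half by simp
  qed
  finally show ?thesis .
qed

text \<open>On a quarter circle y = tan u turns the weight into y powr (2 h - 1) / (1 + y^2). The
  total mass is the reciprocal of the prefactor of \<open>ell\<close>, so the logarithm enters
  \<open>ell\<close> with coefficient 1.\<close>

lemma angular_weight:
  fixes h :: real
  assumes h: "0 < h" "h < 1"
  shows "set_integrable lborel {0..2*pi} (\<lambda>u. \<bar>sin u / cos u\<bar> powr (2 * h - 1))"
    and "(LINT u:{0..2*pi}|lborel. \<bar>sin u / cos u\<bar> powr (2 * h - 1)) = 2 * Gamma h * Gamma (1 - h)"
proof -
  let ?W = "\<lambda>u. \<bar>sin u / cos u\<bar> powr (2 * h - 1)"
  have G: "0 \<le> Gamma h * Gamma (1 - h)"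
    using h by (intro mult_nonneg_nonneg Gamma_real_nonneg) auto
  have "(\<integral>\<^sup>+u\<in>{0..2*pi}. ennreal (?W u) \<partial>lborel)
    = 4 * (\<integral>\<^sup>+u\<in>{0<..<pi/2}. ennreal (?W u) \<partial>lborel)"
    by (rule nn_integral_full_circle) (auto simp: sin_add cos_add sin_diff cos_diff)
  also have "(\<integral>\<^sup>+u\<in>{0<..<pi/2}. ennreal (?W u) \<partial>lborel)
    = (\<integral>\<^sup>+u\<in>{0<..<pi/2}. ennreal (1 / (cos u)\<^sup>2 * (tan u powr (1 - (2 - 2 * h)) / (1 + (tan u)\<^sup>2))) \<partial>lborel)"
  proof (rule nn_integral_cong)
    fix u :: real
    have "1 / (cos u)\<^sup>2 * (tan u powr (1 - (2 - 2 * h)) / (1 + (tan u)\<^sup>2)) = ?W u"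
      if u: "u \<in> {0<..<pi/2}"
    proof -
      have c: "0 < cos u" and s: "0 < sin u"
        using u by (auto intro!: cos_gt_zero sin_gt_zero)
      have "1 / (cos u)\<^sup>2 * (tan u powr (1 - (2 - 2 * h)) / (1 + (tan u)\<^sup>2)) = tan u powr (1 - (2 - 2 * h))"
        by (rule one_plus_tan_sq_cancel[OF c])
      then show ?thesis
        using c s by (simp add: tan_def)
    qed
    then show "ennreal (?W u) * indicator {0<..<pi/2} u =
      ennreal (1 / (cos u)\<^sup>2 * (tan u powr (1 - (2 - 2 * h)) / (1 + (tan u)\<^sup>2))) * indicator {0<..<pi/2} u"
      by (cases "u \<in> {0<..<pi/2}") (simp_all only: indicator_simps, simp)
  qed
  also have "\<dots> = (\<integral>\<^sup>+y\<in>{0<..}. ennreal (y powr (1 - (2 - 2 * h)) / (1 + y\<^sup>2)) \<partial>lborel)"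
    by (rule nn_integral_tan[symmetric]) auto
  also have "\<dots> = ennreal (Gamma h * Gamma (1 - h) / 2)"
  proof -
    have eq: "1 - (2 - 2 * h) / 2 = h" "(2 - 2 * h) / 2 = 1 - h" by (auto simp: field_simps)
    show ?thesis
      using nn_integral_powr_over_one_plus_sq[of "2 - 2 * h"] h unfolding eq by simp
  qed
  also have "4 * ennreal (Gamma h * Gamma (1 - h) / 2) = ennreal (2 * Gamma h * Gamma (1 - h))"
    by (subst ennreal_numeral[symmetric], subst ennreal_mult'[symmetric]) (simp_all add: mult.assoc)
  finally have nn: "(\<integral>\<^sup>+u\<in>{0..2*pi}. ennreal (?W u) \<partial>lborel) = ennreal (2 * Gamma h * Gamma (1 - h))" .
  note r = set_integral_of_nn_integral[OF _ _ _ nn]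
  show "set_integrable lborel {0..2*pi} (\<lambda>u. ?W u)"
    and "(LINT u:{0..2*pi}|lborel. ?W u) = 2 * Gamma h * Gamma (1 - h)"
    by (rule r; use G in \<open>simp add: mult.assoc\<close>)+
qed

text \<open>With m = |sin u| + |cos u|, the last logarithm comes from 1 + 1 / (\<theta> m) = (1 + 1
  / \<theta>) * ((\<theta> m + 1) / (m (\<theta> + 1))): it is what the angle adds to ln (1 + 1 /
  \<theta>).\<close>

definition ell_gap :: "real \<Rightarrow> real \<Rightarrow> real" where
  "ell_gap h \<theta> = 1 / (2 * Gamma h * Gamma (1 - h)) *
     (LINT u|lborel. indicator {0..2*pi} u * (\<bar>sin u / cos u\<bar> powr (2 * h - 1) *
        (Gamma0_log_gap (\<theta> * (\<bar>sin u\<bar> + \<bar>cos u\<bar>)) +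
         ln ((\<theta> * (\<bar>sin u\<bar> + \<bar>cos u\<bar>) + 1) / ((\<bar>sin u\<bar> + \<bar>cos u\<bar>) * (\<theta> + 1))))))"

lemma abs_sin_add_abs_cos_bounds:
  fixes u :: real
  shows "1 \<le> \<bar>sin u\<bar> + \<bar>cos u\<bar>" "\<bar>sin u\<bar> + \<bar>cos u\<bar> \<le> 2"
proof -
  have "1\<^sup>2 \<le> (\<bar>sin u\<bar> + \<bar>cos u\<bar>)\<^sup>2"
    using sin_cos_squared_add[of u] by (simp add: power2_sum)
  then show "1 \<le> \<bar>sin u\<bar> + \<bar>cos u\<bar>"
    by (rule power2_le_imp_le) auto
  show "\<bar>sin u\<bar> + \<bar>cos u\<bar> \<le> 2"
    using abs_sin_le_one[of u] abs_cos_le_one[of u] by linarith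
qed

text \<open>The ratio stays between 1/2 and 1 whatever \<theta> is.\<close>

lemma log_ratio_bound:
  fixes m \<theta> :: real
  assumes m: "1 \<le> m" "m \<le> 2" and \<theta>: "0 \<le> \<theta>"
  shows "\<bar>ln ((\<theta> * m + 1) / (m * (\<theta> + 1)))\<bar> \<le> ln 2"
proof -
  have pos: "0 < \<theta> * m + 1" "0 < m * (\<theta> + 1)"
    using assms by (auto intro!: add_nonneg_pos mult_pos_pos)
  have "\<theta> * m + 1 \<le> m * (\<theta> + 1)" using m by (simp add: algebra_simps)
  then have "(\<theta> * m + 1) / (m * (\<theta> + 1)) \<le> 1" using pos by simp
  then have 1: "ln ((\<theta> * m + 1) / (m * (\<theta> + 1))) \<le> 0"
    using pos by (subst ln_le_zero_iff) auto
  have "0 \<le> \<theta> * m" using m \<theta> by simp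
  then have "m * (\<theta> + 1) \<le> 2 * (\<theta> * m + 1)" using m by (simp add: algebra_simps)
  then have "1 / 2 \<le> (\<theta> * m + 1) / (m * (\<theta> + 1))"
    using pos by (simp add: field_simps)
  then have "ln (1 / 2) \<le> ln ((\<theta> * m + 1) / (m * (\<theta> + 1)))"
    using pos by (subst ln_le_cancel_iff) auto
  with 1 show ?thesis by (simp add: ln_div)
qed

text \<open>Continuity is available on the closed half-line; the truncation by \<open>max\<close>
  turns it into measurability on the whole line.\<close>

lemma Gamma0_log_gap_measurable:
  "(\<lambda>v. Gamma0_log_gap (max 0 v)) \<in> borel_measurable borel"
  by (intro borel_measurable_continuous_onI continuous_on_compose2[OF Gamma0_log_gap_continuous]) (auto intro!: continuous_intros)

text \<open>Both summands inside the gap are bounded uniformly in \<theta> and u, so a multiple of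
  the integrable angular weight dominates; this yields continuity and boundedness at once.\<close>

lemma
  fixes h :: real
  assumes h: "0 < h" "h < 1"
  shows ell_gap_continuous: "continuous_on {0..} (ell_gap h)"
    and ell_gap_bounded: "bounded (ell_gap h ` {0..})"
    and ell_eq: "0 < \<theta> \<Longrightarrow> ell h \<theta> = ln (1 + 1 / \<theta>) + ell_gap h \<theta>"
proof -
  obtain L where L: "0 \<le> L" "\<And>v. 0 \<le> v \<Longrightarrow> \<bar>Gamma0_log_gap v\<bar> \<le> L"
    using Gamma0_log_gap_bounded by blast
  let ?W = "\<lambda>u. \<bar>sin u / cos u\<bar> powr (2 * h - 1)"
  let ?m = "\<lambda>u. \<bar>sin u\<bar> + \<bar>cos u\<bar>"
  let ?g = "\<lambda>\<theta> u. Gamma0_log_gap (\<theta> * ?m u) + ln ((\<theta> * ?m u + 1) / (?m u * (\<theta> + 1)))"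
  let ?c = "1 / (2 * Gamma h * Gamma (1 - h))"
  define f where "f \<theta> u = indicator {0..2*pi} u * (?W u * ?g \<theta> u)" for \<theta> u
  define w where "w u = (L + ln 2) * (indicator {0..2*pi} u * ?W u)" for u
  have W: "integrable lborel (\<lambda>u. indicator {0..2*pi} u * ?W u)"
    using angular_weight(1)[OF h] by (simp add: set_integrable_def)
  then have w: "integrable lborel w"
    unfolding w_def by (rule integrable_mult_right)
  have gap: "ell_gap h \<theta> = ?c * integral\<^sup>L lborel (f \<theta>)" for \<theta>
    unfolding ell_gap_def f_def ..
  have meas: "f \<theta> \<in> borel_measurable lborel" if "\<theta> \<in> {0..}" for \<theta>
  proof -
    have meas_max: "(\<lambda>u. indicator {0..2*pi} u * (?W u * (Gamma0_log_gap (max 0 (\<theta> * ?m u)) + ln ((\<theta> * ?m u + 1) / (?m u * (\<theta> + 1))))))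
      \<in> borel_measurable borel"
      using measurable_compose[OF _ Gamma0_log_gap_measurable, of "\<lambda>u. \<theta> * ?m u" borel] by measurable
    have max: "max 0 (\<theta> * ?m u) = \<theta> * ?m u" for u
      using that by (intro max_absorb2) auto
    have "f \<theta> \<in> borel_measurable borel"
      using meas_max unfolding f_def[abs_def] max .
    then show ?thesis by simp
  qed
  have bound: "\<bar>f \<theta> u\<bar> \<le> w u" if "\<theta> \<in> {0..}" for \<theta> u
  proof -
    have "\<bar>?g \<theta> u\<bar> \<le> L + ln 2"
      by (intro order_trans[OF abs_triangle_ineq] add_mono L(2) log_ratio_bound abs_sin_add_abs_cos_bounds)
         (use that in auto)
    then have "?W u * \<bar>?g \<theta> u\<bar> \<le> ?W u * (L + ln 2)"
      by (rule mult_left_mono) simp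
    then show ?thesis
      unfolding f_def w_def by (cases "u \<in> {0..2*pi}") (simp_all add: abs_mult mult.commute)
  qed
  have "continuous_on {0..} (\<lambda>\<theta>. integral\<^sup>L lborel (f \<theta>))"
  proof (rule continuous_on_integral_dominated[OF meas w])
    show "AE u in lborel. continuous_on {0..} (\<lambda>\<theta>. f \<theta> u)"
    proof (rule AE_I2)
      fix u :: real
      have m: "1 \<le> ?m u" by (rule abs_sin_add_abs_cos_bounds)
      have "continuous_on {0..} (\<lambda>\<theta>. Gamma0_log_gap (\<theta> * ?m u))"
        by (rule continuous_on_compose2[OF Gamma0_log_gap_continuous]) (auto intro!: continuous_intros)
      moreover have "continuous_on {0..} (\<lambda>\<theta>. ln ((\<theta> * ?m u + 1) / (?m u * (\<theta> + 1))))"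
      proof (intro continuous_intros)
        show "\<forall>\<theta>\<in>{0..}. ?m u * (\<theta> + 1) \<noteq> 0" using m by auto
        show "\<forall>\<theta>\<in>{0..}. (\<theta> * ?m u + 1) / (?m u * (\<theta> + 1)) \<noteq> 0"
        proof
          fix \<theta> :: real assume "\<theta> \<in> {0..}"
          then have "0 < \<theta> * ?m u + 1" by (intro add_nonneg_pos mult_nonneg_nonneg) auto
          then show "(\<theta> * ?m u + 1) / (?m u * (\<theta> + 1)) \<noteq> 0" using m \<open>\<theta> \<in> {0..}\<close> by auto
        qed
      qed
      ultimately show "continuous_on {0..} (\<lambda>\<theta>. f \<theta> u)"
        unfolding f_def by (intro continuous_on_mult_left continuous_on_add)
    qed
  qed (use bound in auto)
  then show "continuous_on {0..} (ell_gap h)"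
    unfolding gap[abs_def] by (intro continuous_intros)
  have "norm (ell_gap h \<theta>) \<le> \<bar>?c\<bar> * integral\<^sup>L lborel w" if "\<theta> \<in> {0..}" for \<theta>
    unfolding gap real_norm_def abs_mult
    by (intro mult_left_mono integral_le_of_dominated[OF w]) (use bound[OF that] in auto)
  then show "bounded (ell_gap h ` {0..})"
    by (auto intro!: boundedI)
  show "ell h \<theta> = ln (1 + 1 / \<theta>) + ell_gap h \<theta>" if \<theta>: "0 < \<theta>"
  proof -
    have f_int: "integrable lborel (f \<theta>)"
      by (rule Bochner_Integration.integrable_bound[OF w meas]) (use bound[of \<theta>] \<theta> in \<open>auto intro: order_trans[OF _ abs_ge_self]\<close>)
    have eq: "indicator {0..2*pi} u *\<^sub>R (?W u * Gamma0 (\<theta> * ?m u)) = ln (1 + 1 / \<theta>) * (indicator {0..2*pi} u * ?W u) + f \<theta> u" for u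
    proof -
      have m: "1 \<le> ?m u" by (rule abs_sin_add_abs_cos_bounds)
      have pos: "0 < \<theta> * ?m u" using m \<theta> by (intro mult_pos_pos) auto
      have fac: "1 + 1 / (\<theta> * ?m u) = (1 + 1 / \<theta>) * ((\<theta> * ?m u + 1) / (?m u * (\<theta> + 1)))"
      proof -
        have "(1 + 1 / \<theta>) * ((\<theta> * M + 1) / (M * (\<theta> + 1))) = 1 + 1 / (\<theta> * M)" if "1 \<le> M" for M
          using \<theta> that by (simp add: divide_simps)
        from this[OF m] show ?thesis ..
      qed
      have "ln (1 + 1 / (\<theta> * ?m u)) = ln (1 + 1 / \<theta>) + ln ((\<theta> * ?m u + 1) / (?m u * (\<theta> + 1)))"
      proof -
        have "0 < (\<theta> * M + 1) / (M * (\<theta> + 1))" if "1 \<le> M" for M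
          using \<theta> that by (intro divide_pos_pos add_pos_pos mult_pos_pos) auto
        moreover have "0 < 1 + 1 / \<theta>"
          using \<theta> by (simp add: add_pos_pos)
        ultimately have "0 < 1 + 1 / \<theta>" "0 < (\<theta> * ?m u + 1) / (?m u * (\<theta> + 1))"
          using m by blast+
        then show ?thesis
          unfolding fac by (rule ln_mult_pos)
      qed
      then show ?thesis
        unfolding f_def Gamma0_eq[OF pos] by (simp add: algebra_simps)
    qed
    have "ell h \<theta> = ?c * (LINT u|lborel. ln (1 + 1 / \<theta>) * (indicator {0..2*pi} u * ?W u) + f \<theta> u)"
      unfolding ell_def set_lebesgue_integral_def eq ..
    also have "(LINT u|lborel. ln (1 + 1 / \<theta>) * (indicator {0..2*pi} u * ?W u) + f \<theta> u) =
       ln (1 + 1 / \<theta>) * (2 * Gamma h * Gamma (1 - h)) + integral\<^sup>L lborel (f \<theta>)"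
      using angular_weight(2)[OF h]
      by (subst Bochner_Integration.integral_add[OF integrable_mult_right[OF W] f_int])
         (simp add: set_lebesgue_integral_def)
    also have "?c * \<dots> = ln (1 + 1 / \<theta>) + ell_gap h \<theta>"
    proof -
      have "0 < Gamma h" "0 < Gamma (1 - h)" using h by (auto intro!: Gamma_real_pos)
      then show ?thesis unfolding gap by (simp add: distrib_left)
    qed
    finally show ?thesis .
  qed
qed

section \<open>The expectation of the approximate self-intersection local time\<close>

lemma nn_integral_vec_prod:
  fixes f :: "'n::finite \<Rightarrow> real \<Rightarrow> ennreal"
  assumes [measurable]: "\<And>j. f j \<in> borel_measurable borel"
  shows "(\<integral>\<^sup>+x. (\<Prod>j\<in>UNIV. f j (x $ j)) \<partial>(lborel :: (real ^ 'n) measure)) = (\<Prod>j\<in>UNIV. \<integral>\<^sup>+x. f j x \<partial>lborel)"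
proof -
  \<comment> \<open>The product rule for \<open>lborel\<close> runs over basis vectors;
    \<open>idx\<close> recovers the coordinate from its basis vector.\<close>
  define idx :: "real ^ 'n \<Rightarrow> 'n" where "idx = inv (\<lambda>j. axis j 1)"
  have inj: "inj (\<lambda>j::'n. axis j (1::real))"
    by (auto simp: inj_on_def axis_eq_axis)
  have idx: "idx (axis j 1) = j" for j
    unfolding idx_def by (rule inv_f_f[OF inj])
  have Basis: "(Basis :: (real ^ 'n) set) = range (\<lambda>j. axis j 1)"
    by (auto simp: Basis_vec_def)
  have prod: "(\<Prod>b\<in>(Basis :: (real ^ 'n) set). g b) = (\<Prod>j\<in>UNIV. g (axis j 1))" for g :: "_ \<Rightarrow> ennreal"
    unfolding Basis by (subst prod.reindex[OF inj]) simp
  have "(\<integral>\<^sup>+x. (\<Prod>b\<in>(Basis :: (real ^ 'n) set). f (idx b) (x \<bullet> b)) \<partial>lborel) = (\<Prod>b\<in>(Basis :: (real ^ 'n) set). \<integral>\<^sup>+x. f (idx b) x \<partial>lborel)"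
    by (rule nn_integral_lborel_prod) auto
  then show ?thesis
    unfolding prod idx by (simp add: inner_axis)
qed

lemma borel_measurable_vec_nth' [measurable (raw)]:
  fixes f :: "'a \<Rightarrow> real ^ 'n"
  assumes "f \<in> borel_measurable M"
  shows "(\<lambda>x. f x $ j) \<in> borel_measurable M"
  by (rule measurable_compose[OF assms]) (intro borel_measurable_continuous_onI continuous_intros)

lemma measurable_vec_lambda_borel [measurable]:
  "(\<lambda>x. \<chi> j. x j) \<in> PiM UNIV (\<lambda>j::'n::finite. (borel :: real measure)) \<rightarrow>\<^sub>M borel"
proof (rule borel_measurable_euclidean_space[THEN iffD2, rule_format])
  fix b :: "real ^ 'n" assume "b \<in> Basis"
  then obtain j where b: "b = axis j 1" by (auto simp: Basis_vec_def)
  have "(\<lambda>x. x j) \<in> PiM UNIV (\<lambda>j::'n. (borel :: real measure)) \<rightarrow>\<^sub>M borel"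
    by measurable
  then show "(\<lambda>x. (\<chi> j. x j) \<bullet> b) \<in> PiM UNIV (\<lambda>j::'n. (borel :: real measure)) \<rightarrow>\<^sub>M borel"
    unfolding b by (simp add: inner_axis)
qed

section \<open>Product structure of the spatial covariance\<close>

lemma sets_PiM_cov_factor [measurable_cong]:
  "sets (PiM UNIV (\<lambda>j::'n::finite. cov_factor (H j))) = sets (PiM UNIV (\<lambda>j. (borel :: real measure)))"
  by (intro sets_PiM_cong) auto

lemma sets_space_cov [simp, measurable_cong]: "sets (space_cov H) = sets borel"
  by (simp add: space_cov_def)

lemma nn_integral_space_cov_prod:
  fixes f :: "'n::finite \<Rightarrow> real \<Rightarrow> ennreal"
  assumes [measurable]: "\<And>j. f j \<in> borel_measurable borel"
  shows "(\<integral>\<^sup>+y. (\<Prod>j\<in>UNIV. f j (y $ j)) \<partial>space_cov H) = (\<Prod>j\<in>UNIV. \<integral>\<^sup>+y. f j y \<partial>cov_factor (H j))"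
proof -
  interpret product_sigma_finite "\<lambda>j. cov_factor (H j)"
    by (simp add: product_sigma_finite_def sigma_finite_cov_factor)
  have "(\<integral>\<^sup>+y. (\<Prod>j\<in>UNIV. f j (y $ j)) \<partial>space_cov H) = (\<integral>\<^sup>+x. (\<Prod>j\<in>UNIV. f j (x j)) \<partial>PiM UNIV (\<lambda>j. cov_factor (H j)))"
    unfolding space_cov_def by (subst nn_integral_distr) auto
  also have "\<dots> = (\<Prod>j\<in>UNIV. \<integral>\<^sup>+y. f j y \<partial>cov_factor (H j))"
    by (rule product_nn_integral_prod) auto
  finally show ?thesis .
qed

text \<open>An image measure need not inherit sigma-finiteness, so the argument runs backwards:
  mapping to coordinates returns the product measure, and sigma-finiteness of an image passes to its
  source.\<close>

lemma sigma_finite_space_cov: "sigma_finite_measure (space_cov (H :: 'n::finite \<Rightarrow> real))"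
proof -
  let ?P = "PiM UNIV (\<lambda>j. cov_factor (H j))"
  interpret product_sigma_finite "\<lambda>j. cov_factor (H j)"
    by (simp add: product_sigma_finite_def sigma_finite_cov_factor)
  interpret finite_product_sigma_finite "\<lambda>j. cov_factor (H j)" UNIV
    by standard simp
  have g: "(\<lambda>y j. y $ j) \<in> space_cov H \<rightarrow>\<^sub>M ?P"
    by (rule measurable_PiM_single') auto
  have "distr (space_cov H) ?P (\<lambda>y j. y $ j) = distr ?P ?P ((\<lambda>y j. y $ j) \<circ> (\<lambda>x. \<chi> j. x j))"
    unfolding space_cov_def by (rule distr_distr) (use g in \<open>auto simp: space_cov_def\<close>)
  also have "\<dots> = ?P"
    by (simp add: comp_def vec_lambda_inverse)
  finally have "sigma_finite_measure (distr (space_cov H) ?P (\<lambda>y j. y $ j))"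
    using sigma_finite_measure_axioms by simp
  then show ?thesis
    by (rule sigma_finite_measure_distr[OF _ g])
qed

text \<open>The doubling of the parameter makes the time factor Cauchy of scale e and each spatial
  factor Gaussian of variance e. This is why r + e is the variance after averaging over an increment
  of length r.\<close>

lemma mollifier_eq:
  fixes x :: "real ^ 'n"
  assumes "0 < e"
  shows "mollifier (2 * e) (t, x) = cauchy_density e t * (\<Prod>j\<in>UNIV. normal_density 0 (sqrt e) (x $ j))"
proof -
  have norm: "(norm x)\<^sup>2 = (\<Sum>j\<in>UNIV. (x $ j)\<^sup>2)"
    unfolding power2_norm_eq_inner inner_vec_def by (simp add: power2_eq_square)
  have "(\<Prod>j\<in>UNIV. normal_density 0 (sqrt e) (x $ j)) =
      (\<Prod>j\<in>(UNIV :: 'n set). 1 / sqrt (2 * pi * e)) * (\<Prod>j\<in>UNIV. exp (- (x $ j)\<^sup>2 / (2 * e)))"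
    using assms by (subst prod.distrib[symmetric]) (simp add: normal_density_def)
  also have "(\<Prod>j\<in>UNIV. exp (- (x $ j)\<^sup>2 / (2 * e))) = exp (- (norm x)\<^sup>2 / (2 * e))"
    by (simp add: exp_sum[symmetric] norm sum_divide_distrib sum_negf)
  also have "(\<Prod>j\<in>(UNIV :: 'n set). 1 / sqrt (2 * pi * e)) = 1 / (pi * (2 * e)) powr (real CARD('n) / 2)"
  proof -
    have "(pi * (2 * e)) powr (real CARD('n) / 2) = ((pi * (2 * e)) powr (1 / 2)) powr real CARD('n)"
      by (simp add: powr_powr)
    also have "\<dots> = sqrt (2 * pi * e) ^ CARD('n)"
      using assms by (simp add: powr_half_sqrt powr_realpow mult_ac)
    finally show ?thesis by (simp add: power_divide)
  qed
  finally show ?thesis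
    by (simp add: mollifier_def)
qed

text \<open>Valued in \<open>ennreal\<close>, like \<open>space_kernel\<close>, so that products and
  integrals can be rearranged before finiteness is known.\<close>

definition time_kernel :: "real \<Rightarrow> real \<Rightarrow> real \<Rightarrow> ennreal" where
  "time_kernel h e t = (\<integral>\<^sup>+u. ennreal (cauchy_density e (t - u)) \<partial>cov_factor h)"

definition space_kernel :: "real \<Rightarrow> real \<Rightarrow> real \<Rightarrow> ennreal" where
  "space_kernel h e x = (\<integral>\<^sup>+y. ennreal (normal_density 0 (sqrt e) (x - y)) \<partial>cov_factor h)"

lemma time_kernel_measurable [measurable]: "time_kernel h e \<in> borel_measurable borel"
proof -
  interpret sigma_finite_measure "cov_factor h" by (rule sigma_finite_cov_factor)
  show ?thesis unfolding time_kernel_def by measurable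
qed

lemma space_kernel_measurable [measurable]: "space_kernel h e \<in> borel_measurable borel"
proof -
  interpret sigma_finite_measure "cov_factor h" by (rule sigma_finite_cov_factor)
  show ?thesis unfolding space_kernel_def by measurable
qed

text \<open>The law of an increment is given for ordered times; evenness handles the reverse
  order.\<close>

lemma space_kernel_even: "space_kernel h e (- x) = space_kernel h e x"
proof -
  have "space_kernel h e (- x) = (\<integral>\<^sup>+y. ennreal (normal_density 0 (sqrt e) (x - (- y))) \<partial>cov_factor h)"
    unfolding space_kernel_def
    by (intro nn_integral_cong) (simp add: normal_density_def power2_eq_square algebra_simps)
  also have "\<dots> = space_kernel h e x"
  proof (cases "h = 1/2")
    case True
    then show ?thesis unfolding space_kernel_def True by (simp add: nn_integral_cov_factor_half)
  next
    case False
    show ?thesis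
      unfolding space_kernel_def using False
      by (simp add: nn_integral_cov_factor) (subst nn_integral_real_affine[where c = "-1" and t = 0]; simp)
  qed
  finally show ?thesis .
qed

text \<open>For a nonnegative integrand the Bochner integral is \<open>enn2real\<close> of the
  nonnegative integral, even if that is infinite, since both are then 0. The product form of the
  mollifier and of the measure does the rest.\<close>

lemma cov_reg_eq:
  fixes x :: "real ^ 'n" and H :: "'n \<Rightarrow> real"
  assumes e: "0 < e"
  shows "cov_reg H0 H e (t, x) = enn2real (time_kernel H0 e t * (\<Prod>j\<in>UNIV. space_kernel (H j) e (x $ j)))"
proof -
  let ?k = "(\<Prod>j\<in>UNIV. space_kernel (H j) e (x $ j))"
  interpret S: sigma_finite_measure "space_cov H" by (rule sigma_finite_space_cov)
  have sets [measurable_cong]: "sets (time_space_cov H0 H) = sets (borel \<Otimes>\<^sub>M borel)"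
    unfolding time_space_cov_def by (rule sets_pair_measure_cong) auto
  let ?f = "\<lambda>u y. cauchy_density e (t - u) * (\<Prod>j\<in>UNIV. normal_density 0 (sqrt e) (x $ j - y $ j))"
  have f: "mollifier (2 * e) ((t, x) - z) = (case z of (u, y) \<Rightarrow> ?f u y)" for z
    by (cases z) (simp add: mollifier_eq[OF e])
  have nonneg: "0 \<le> (case z of (u, y) \<Rightarrow> ?f u y)" for z
    using e by (auto simp: prod_nonneg split: prod.split)
  have "cov_reg H0 H e (t, x) = enn2real (\<integral>\<^sup>+z. ennreal (case z of (u, y) \<Rightarrow> ?f u y) \<partial>time_space_cov H0 H)"
    unfolding cov_reg_def f
  proof (rule integral_eq_nn_integral)
    have "(\<lambda>z. case z of (u, y) \<Rightarrow> ?f u y) \<in> borel_measurable (borel \<Otimes>\<^sub>M borel)"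
      by measurable
    then show "(\<lambda>z. case z of (u, y) \<Rightarrow> ?f u y) \<in> borel_measurable (time_space_cov H0 H)"
      by (subst measurable_cong_sets[OF sets refl])
  qed (use nonneg in auto)
  also have "(\<integral>\<^sup>+z. ennreal (case z of (u, y) \<Rightarrow> ?f u y) \<partial>time_space_cov H0 H) =
     (\<integral>\<^sup>+u. (\<integral>\<^sup>+y. ennreal (?f u y) \<partial>space_cov H) \<partial>cov_factor H0)"
    unfolding time_space_cov_def by (subst S.nn_integral_fst[symmetric]) auto
  also have "\<dots> = (\<integral>\<^sup>+u. ennreal (cauchy_density e (t - u)) * ?k \<partial>cov_factor H0)"
  proof (rule nn_integral_cong)
    fix u
    have "(\<integral>\<^sup>+y. ennreal (?f u y) \<partial>space_cov H) =
       (\<integral>\<^sup>+y. ennreal (cauchy_density e (t - u)) * (\<Prod>j\<in>UNIV. ennreal (normal_density 0 (sqrt e) (x $ j - y $ j))) \<partial>space_cov H)"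
      using e by (intro nn_integral_cong) (simp add: ennreal_mult'[symmetric] prod_ennreal)
    also have "\<dots> = ennreal (cauchy_density e (t - u)) * (\<integral>\<^sup>+y. (\<Prod>j\<in>UNIV. ennreal (normal_density 0 (sqrt e) (x $ j - y $ j))) \<partial>space_cov H)"
      by (rule nn_integral_cmult) auto
    also have "(\<integral>\<^sup>+y. (\<Prod>j\<in>UNIV. ennreal (normal_density 0 (sqrt e) (x $ j - y $ j))) \<partial>space_cov H) = ?k"
      unfolding space_kernel_def by (rule nn_integral_space_cov_prod) auto
    finally show "(\<integral>\<^sup>+y. ennreal (?f u y) \<partial>space_cov H) =
       ennreal (cauchy_density e (t - u)) * ?k" .
  qed
  also have "\<dots> = time_kernel H0 e t * ?k"
    unfolding time_kernel_def by (rule nn_integral_multc) auto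
  finally show ?thesis .
qed

text \<open>Integrating over the increment first convolves two Gaussians, so the variances add to r
  + e; what remains is the Gaussian average of \<open>cov_factor h\<close>.\<close>

lemma nn_integral_normal_space_kernel:
  fixes h e r :: real
  assumes h: "1/2 \<le> h" and e: "0 < e" and r: "0 < r"
  shows "(\<integral>\<^sup>+x. ennreal (normal_density 0 (sqrt r) x) * space_kernel h e x \<partial>lborel)
    = ennreal (2 powr (- h) * (Gamma (2 * h + 1) / Gamma h) * (r + e) powr (h - 1))"
proof -
  let ?n = "\<lambda>x y. ennreal (normal_density 0 (sqrt r) x) * ennreal (normal_density 0 (sqrt e) (x - y))"
  interpret C: sigma_finite_measure "cov_factor h" by (rule sigma_finite_cov_factor)
  interpret P: pair_sigma_finite "cov_factor h" lborel
    by (simp add: pair_sigma_finite_def sigma_finite_cov_factor sigma_finite_lborel)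
  have "(\<integral>\<^sup>+x. ennreal (normal_density 0 (sqrt r) x) * space_kernel h e x \<partial>lborel)
    = (\<integral>\<^sup>+x. (\<integral>\<^sup>+y. ?n x y \<partial>cov_factor h) \<partial>lborel)"
    unfolding space_kernel_def by (intro nn_integral_cong nn_integral_cmult[symmetric]) auto
  also have "\<dots> = (\<integral>\<^sup>+y. (\<integral>\<^sup>+x. ?n x y \<partial>lborel) \<partial>cov_factor h)"
    by (rule P.Fubini') measurable
  also have "\<dots> = (\<integral>\<^sup>+y. ennreal (normal_density 0 (sqrt (r + e)) y) \<partial>cov_factor h)"
  proof (rule nn_integral_cong)
    fix y :: real
    have "(\<integral>\<^sup>+x. ?n x y \<partial>lborel) =
      (\<integral>\<^sup>+x. ennreal (normal_density 0 (sqrt e) (y - x) * normal_density 0 (sqrt r) x) \<partial>lborel)"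
      using normal_density_zero_even[of "sqrt e" "y - x" for x]
      by (intro nn_integral_cong) (simp add: ennreal_mult'[symmetric] mult.commute)
    also have "\<dots> = ennreal (normal_density 0 (sqrt (r + e)) y)"
      using fun_cong[OF conv_normal_density_zero_mean[of "sqrt e" "sqrt r"], of y] e r
      by (simp add: add.commute)
    finally show "(\<integral>\<^sup>+x. ?n x y \<partial>lborel) =
      ennreal (normal_density 0 (sqrt (r + e)) y)" .
  qed
  also have "\<dots> = ennreal (2 powr (- h) * (Gamma (2 * h + 1) / Gamma h) * (r + e) powr (h - 1))"
    using e r by (intro nn_integral_cov_factor_normal_density h) auto
  finally show ?thesis .
qed

definition space_const :: "('n::finite \<Rightarrow> real) \<Rightarrow> real" where
  "space_const H = 2 powr (- hsum H) * (\<Prod>j\<in>UNIV. Gamma (2 * H j + 1) / Gamma (H j))"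

lemma space_const_nonneg:
  assumes "\<And>j. 1/2 \<le> H j" shows "0 \<le> space_const H"
  unfolding space_const_def
proof (intro mult_nonneg_nonneg prod_nonneg ballI divide_nonneg_nonneg Gamma_real_nonneg)
  fix j
  show "0 < 2 * H j + 1" "0 < H j" using assms[of j] by auto
qed auto

text \<open>Coordinates factorise, and the exponents \<open>H j - 1\<close> add up to minus d -
  H.\<close>

lemma nn_integral_gaussian_space_kernel:
  fixes H :: "'n::finite \<Rightarrow> real"
  assumes H: "\<And>j. 1/2 \<le> H j" and e: "0 < e" and r: "0 < r"
  shows "(\<integral>\<^sup>+x. ennreal (\<Prod>j\<in>UNIV. normal_density 0 (sqrt r) (x $ j)) * (\<Prod>j\<in>UNIV. space_kernel (H j) e (x $ j)) \<partial>lborel)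
    = ennreal (space_const H * (r + e) powr (- (real CARD('n) - hsum H)))"
proof -
  let ?m = "\<lambda>j. 2 powr (- H j) * (Gamma (2 * H j + 1) / Gamma (H j)) * (r + e) powr (H j - 1)"
  have "(\<integral>\<^sup>+x. ennreal (\<Prod>j\<in>UNIV. normal_density 0 (sqrt r) (x $ j)) * (\<Prod>j\<in>UNIV. space_kernel (H j) e (x $ j)) \<partial>lborel)
    = (\<integral>\<^sup>+x. (\<Prod>j\<in>UNIV. ennreal (normal_density 0 (sqrt r) (x $ j)) * space_kernel (H j) e (x $ j)) \<partial>lborel)"
    by (intro nn_integral_cong) (simp add: prod.distrib prod_ennreal)
  also have "\<dots> = (\<Prod>j\<in>UNIV. \<integral>\<^sup>+x. ennreal (normal_density 0 (sqrt r) x) * space_kernel (H j) e x \<partial>lborel)"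
    by (rule nn_integral_vec_prod) auto
  also have "\<dots> = (\<Prod>j\<in>UNIV. ennreal (?m j))"
    by (simp only: nn_integral_normal_space_kernel[OF H e r])
  also have "\<dots> = ennreal (\<Prod>j\<in>UNIV. ?m j)"
  proof (rule prod_ennreal)
    fix j
    show "0 \<le> ?m j"
      using H[of j] by (intro mult_nonneg_nonneg divide_nonneg_nonneg Gamma_real_nonneg) auto
  qed
  also have "(\<Prod>j\<in>UNIV. ?m j) =
     (\<Prod>j\<in>UNIV. 2 powr (- H j)) * (\<Prod>j\<in>UNIV. Gamma (2 * H j + 1) / Gamma (H j)) * (\<Prod>j\<in>UNIV. (r + e) powr (H j - 1))"
    by (simp only: prod.distrib)
  also have "(\<Prod>j\<in>UNIV. 2 powr (- H j)) = (2 powr (- hsum H) :: real)"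
    by (simp add: powr_sum[symmetric] hsum_def sum_negf)
  also have "(\<Prod>j\<in>UNIV. (r + e) powr (H j - 1)) = (r + e) powr (- (real CARD('n) - hsum H))"
    using r e by (subst powr_sum[symmetric]) (auto simp: hsum_def sum_subtractf)
  finally show ?thesis by (simp add: space_const_def)
qed

text \<open>For a fixed difference r the admissible s fill an interval of length max 0 (1 - |r|).
  Evenness in r gives the factor 2, which later cancels the 1/2 in front of the local time.\<close>

lemma nn_integral_square_diff:
  fixes G :: "real \<Rightarrow> ennreal"
  assumes [measurable]: "G \<in> borel_measurable borel"
  shows "(\<integral>\<^sup>+z. G \<bar>snd z - fst z\<bar> * indicator ({0..1} \<times> {0..1}) z \<partial>(lborel :: (real \<times> real) measure)) =
    2 * (\<integral>\<^sup>+r\<in>{0<..<1}. ennreal (1 - r) * G r \<partial>lborel)"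
proof -
  let ?g = "\<lambda>s r. G \<bar>r\<bar> * (indicator {0..1} s * indicator {0..1} (s + r))"
  have "(\<integral>\<^sup>+z. G \<bar>snd z - fst z\<bar> * indicator ({0..1} \<times> {0..1}) z \<partial>(lborel :: (real \<times> real) measure)) =
    (\<integral>\<^sup>+s. (\<integral>\<^sup>+t. G \<bar>t - s\<bar> * (indicator {0..1} s * indicator {0..1} t) \<partial>lborel) \<partial>lborel)"
    unfolding lborel_prod[symmetric]
    by (subst lborel.nn_integral_fst[symmetric]) (auto simp: indicator_times)
  also have "\<dots> = (\<integral>\<^sup>+s. (\<integral>\<^sup>+r. ?g s r \<partial>lborel) \<partial>lborel)"
  proof (rule nn_integral_cong)
    fix s :: real
    show "(\<integral>\<^sup>+t. G \<bar>t - s\<bar> * (indicator {0..1} s * indicator {0..1} t) \<partial>lborel) =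
      (\<integral>\<^sup>+r. ?g s r \<partial>lborel)"
      using nn_integral_real_affine[of "\<lambda>t. G \<bar>t - s\<bar> * (indicator {0..1} s * indicator {0..1} t)" 1 s] by simp
  qed
  also have "\<dots> = (\<integral>\<^sup>+r. (\<integral>\<^sup>+s. ?g s r \<partial>lborel) \<partial>lborel)"
    by (rule lborel_pair.Fubini') measurable
  also have "\<dots> = (\<integral>\<^sup>+r. G \<bar>r\<bar> * ennreal (max 0 (1 - \<bar>r\<bar>)) \<partial>lborel)"
  proof (rule nn_integral_cong)
    fix r :: real
    have "(\<integral>\<^sup>+s. ?g s r \<partial>lborel) = G \<bar>r\<bar> * (\<integral>\<^sup>+s. indicator {max 0 (- r)..min 1 (1 - r)} s \<partial>lborel)"
      by (subst nn_integral_cmult[symmetric]) (auto intro!: nn_integral_cong split: split_indicator)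
    also have "(\<integral>\<^sup>+s. indicator {max 0 (- r)..min 1 (1 - r)} s \<partial>lborel) = ennreal (max 0 (1 - \<bar>r\<bar>))"
    proof (cases "max 0 (- r) \<le> min 1 (1 - r)")
      case True
      then have "min 1 (1 - r) - max 0 (- r) = max 0 (1 - \<bar>r\<bar>)" by (auto simp: min_def max_def abs_if)
      then show ?thesis using True by simp
    next
      case False
      then have "max 0 (1 - \<bar>r\<bar>) = 0" by (auto simp: min_def max_def abs_if split: if_splits)
      moreover have "{max 0 (- r)..min 1 (1 - r)} = {}" using False by simp
      ultimately show ?thesis by (simp only: ennreal_0) simp
    qed
    finally show "(\<integral>\<^sup>+s. ?g s r \<partial>lborel) = G \<bar>r\<bar> * ennreal (max 0 (1 - \<bar>r\<bar>))" .
  qed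
  also have "\<dots> = 2 * (\<integral>\<^sup>+r\<in>{0<..}. G \<bar>r\<bar> * ennreal (max 0 (1 - \<bar>r\<bar>)) \<partial>lborel)"
    by (rule nn_integral_even) auto
  also have "(\<integral>\<^sup>+r\<in>{0<..}. G \<bar>r\<bar> * ennreal (max 0 (1 - \<bar>r\<bar>)) \<partial>lborel) = (\<integral>\<^sup>+r\<in>{0<..<1}. ennreal (1 - r) * G r \<partial>lborel)"
    by (intro nn_integral_cong) (auto simp: indicator_def max_def mult.commute)
  finally show ?thesis .
qed

text \<open>Time is rounded up to the grid of mesh 1 / (n + 1). The discretised process is
  measurable as a countable patchwork, and path continuity passes to the limit. Truncation at 0
  keeps times in the half-line where paths are continuous.\<close>

lemma (in standard_brownian_motion) measurable_BM_joint:
  "(\<lambda>z. B (max 0 (fst z)) (snd z)) \<in> (borel :: real measure) \<Otimes>\<^sub>M M \<rightarrow>\<^sub>M borel"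
proof (rule borel_measurable_LIMSEQ_metric)
  let ?y = "\<lambda>n s. real (nat \<lceil>real (Suc n) * max 0 s\<rceil>) / real (Suc n)"
  fix n :: nat
  show "(\<lambda>z. B (?y n (fst z)) (snd z)) \<in> borel \<Otimes>\<^sub>M M \<rightarrow>\<^sub>M borel"
  proof (rule measurable_compose_countable[where f = "\<lambda>k z. B (real k / real (Suc n)) (snd z)"
        and g = "\<lambda>z. nat \<lceil>real (Suc n) * max 0 (fst z)\<rceil>"])
    show "(\<lambda>z. B (real k / real (Suc n)) (snd z)) \<in> borel \<Otimes>\<^sub>M M \<rightarrow>\<^sub>M borel" for k :: nat
      by (rule measurable_compose[OF measurable_snd measurable_BM]) auto
    show "(\<lambda>z. nat \<lceil>real (Suc n) * max 0 (fst z)\<rceil>) \<in> borel \<Otimes>\<^sub>M M \<rightarrow>\<^sub>M count_space UNIV"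
      by measurable
  qed
next
  let ?y = "\<lambda>n s. real (nat \<lceil>real (Suc n) * max 0 s\<rceil>) / real (Suc n)"
  fix z :: "real \<times> 'w" assume z: "z \<in> space (borel \<Otimes>\<^sub>M M)"
  define s where "s = max 0 (fst z)"
  have s: "0 \<le> s" by (simp add: s_def)
  have bounds: "s \<le> ?y n (fst z)" "?y n (fst z) \<le> s + 1 / real (Suc n)" for n
  proof -
    have nonneg: "0 \<le> real (Suc n) * s" using s by simp
    have "real (nat \<lceil>real (Suc n) * s\<rceil>) = of_int \<lceil>real (Suc n) * s\<rceil>"
      using nonneg by (simp add: of_nat_nat)
    then have "real (Suc n) * s \<le> real (nat \<lceil>real (Suc n) * s\<rceil>)" "real (nat \<lceil>real (Suc n) * s\<rceil>) \<le> real (Suc n) * s + 1"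
      by linarith+
    then have "real (Suc n) * s / real (Suc n) \<le> ?y n (fst z)" "?y n (fst z) \<le> (real (Suc n) * s + 1) / real (Suc n)"
      unfolding s_def[symmetric] by (intro divide_right_mono; simp)+
    then show "s \<le> ?y n (fst z)" "?y n (fst z) \<le> s + 1 / real (Suc n)"
      by (simp_all add: add_divide_distrib)
  qed
  have lim: "(\<lambda>n. ?y n (fst z)) \<longlonglongrightarrow> s"
  proof (rule tendsto_sandwich[of "\<lambda>_. s" _ _ "\<lambda>n. s + 1 / real (Suc n)"])
    show "(\<lambda>n. s + 1 / real (Suc n)) \<longlonglongrightarrow> s"
      using tendsto_add[OF tendsto_const[of s] LIMSEQ_inverse_real_of_nat] by (simp add: inverse_eq_divide)
  qed (use bounds in auto)
  have cont: "continuous_on {0..} (\<lambda>t. B t (snd z))"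
    using z by (intro continuous_BM) (auto simp: space_pair_measure)
  have "\<forall>\<^sub>F n in sequentially. ?y n (fst z) \<in> {0..}"
    by (intro always_eventually allI) (simp only: atLeast_iff order_trans[OF s bounds(1)])
  with s show "(\<lambda>n. B (?y n (fst z)) (snd z)) \<longlonglongrightarrow> B (max 0 (fst z)) (snd z)"
    by (intro continuous_on_tendsto_compose[OF cont lim[unfolded s_def]]) (simp_all add: s_def)
qed

section \<open>Expectation over the Brownian path\<close>

lemma cauchy_cov_even: "cauchy_cov h (- x) = cauchy_cov h x"
  by (simp add: cauchy_cov_def)

lemma cauchy_cov_abs_divide: "0 < e \<Longrightarrow> cauchy_cov h (x / e) = cauchy_cov h (\<bar>x\<bar> / e)"
  using cauchy_cov_even[of h "x / e"] by (auto simp: abs_if)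

lemma (in standard_brownian_motion) nn_integral_space_kernel_increment:
  fixes H :: "'n \<Rightarrow> real"
  assumes H: "\<And>j. 1/2 \<le> H j" and e: "0 < e" and st: "0 \<le> s" "0 \<le> t" "s \<noteq> t"
  shows "(\<integral>\<^sup>+\<omega>. (\<Prod>j\<in>UNIV. space_kernel (H j) e ((B t \<omega> - B s \<omega>) $ j)) \<partial>M)
    = ennreal (space_const H * (\<bar>t - s\<bar> + e) powr (- (real CARD('n) - hsum H)))"
proof -
  have *: "(\<integral>\<^sup>+\<omega>. (\<Prod>j\<in>UNIV. space_kernel (H j) e ((B t \<omega> - B s \<omega>) $ j)) \<partial>M)
    = ennreal (space_const H * (t - s + e) powr (- (real CARD('n) - hsum H)))" if "0 \<le> s" "s < t" for s t
  proof -
    have "(\<lambda>x :: real ^ 'n. \<Prod>j\<in>UNIV. space_kernel (H j) e (x $ j)) \<in> borel_measurable lborel"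
      by measurable
    from distributed_nn_integral[OF gaussian_increments_BM[OF that] this]
    show ?thesis
      using nn_integral_gaussian_space_kernel[of H e "t - s", OF H e] that by simp
  qed
  show ?thesis
  proof (cases "s < t")
    case True
    then show ?thesis using *[of s t] st by simp
  next
    case False
    with st have "t < s" by simp
    have "space_kernel (H j) e ((B t \<omega> - B s \<omega>) $ j) = space_kernel (H j) e ((B s \<omega> - B t \<omega>) $ j)" for j \<omega>
      using space_kernel_even[of "H j" e "(B s \<omega> - B t \<omega>) $ j"] by simp
    then show ?thesis using *[of t s] st \<open>t < s\<close> by simp
  qed
qed

text \<open>The hypothesis \<open>fin\<close> supplies the finite value of the time integral. This
  finiteness is what allows the \<open>ennreal\<close> computation to be turned into a statement
  about the Bochner integrals defining the local time and its mean.\<close>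

lemma (in standard_brownian_motion) expectation_approx_silt:
  fixes H :: "'n \<Rightarrow> real"
  assumes H0: "1/2 \<le> H0" "H0 \<le> 1" and H: "\<And>j. 1/2 \<le> H j" and e: "0 < e" and c: "0 \<le> c"
    and fin: "(\<integral>\<^sup>+r\<in>{0<..<1}. ennreal ((1 - r) * (e powr (2 * H0 - 2) * cauchy_cov H0 (r / e) *
        (r + e) powr (- (real CARD('n) - hsum H)))) \<partial>lborel) = ennreal c"
  shows "(LINT \<omega>|M. approx_silt H0 H e 1 (\<lambda>s. B s \<omega>)) = 2 * space_const H * c"
proof -
  let ?a = "real CARD('n) - hsum H"
  let ?S = "{0..1::real} \<times> {0..1::real}"
  \<comment> \<open>Truncating times at 0 changes nothing on \<open>?S\<close> and makes F jointly
    measurable on the whole plane.\<close>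
  define F where "F \<omega> z = time_kernel H0 e (snd z - fst z) *
    (\<Prod>j\<in>UNIV. space_kernel (H j) e ((B (max 0 (snd z)) \<omega> - B (max 0 (fst z)) \<omega>) $ j)) * indicator ?S z" for \<omega> and z :: "real \<times> real"
  define G where "G r = ennreal (e powr (2 * H0 - 2) * cauchy_cov H0 (r / e) * (space_const H * (r + e) powr (- ?a)))" for r
  let ?I = "\<lambda>\<omega>. \<integral>\<^sup>+z. F \<omega> z \<partial>lborel"
  interpret P: pair_sigma_finite M "lborel :: (real \<times> real) measure"
    by (simp add: pair_sigma_finite_def sigma_finite_lborel sigma_finite_measure_axioms)
  have space_H: "0 \<le> space_const H"
    by (rule space_const_nonneg) (rule H)
  have [measurable]: "cauchy_cov H0 \<in> borel_measurable borel"
    using H0 by (intro borel_measurable_continuous_onI continuous_on_cauchy_cov)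
  have [measurable]: "(\<lambda>x. B (max 0 (f x)) (g x)) \<in> N \<rightarrow>\<^sub>M borel"
    if "f \<in> N \<rightarrow>\<^sub>M borel" "g \<in> N \<rightarrow>\<^sub>M M" for f g and N :: "'c measure"
    using measurable_compose[OF measurable_Pair[OF that] measurable_BM_joint] by simp
  have F_meas [measurable]: "(\<lambda>(\<omega>, z). F \<omega> z) \<in> borel_measurable (M \<Otimes>\<^sub>M lborel)"
  proof -
    have "(\<lambda>(\<omega>, z). F \<omega> z) \<in> borel_measurable (M \<Otimes>\<^sub>M ((borel :: real measure) \<Otimes>\<^sub>M (borel :: real measure)))"
      unfolding F_def by measurable
    moreover have sets: "sets (M \<Otimes>\<^sub>M (lborel :: (real \<times> real) measure)) = sets (M \<Otimes>\<^sub>M ((borel :: real measure) \<Otimes>\<^sub>M (borel :: real measure)))"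
      by (intro sets_pair_measure_cong refl) (simp only: borel_prod sets_lborel)
    ultimately show ?thesis
      by (subst measurable_cong_sets[OF sets refl])
  qed
  have F_meas': "F \<omega> \<in> borel_measurable lborel" if "\<omega> \<in> space M" for \<omega>
    using measurable_compose[OF measurable_Pair1'[OF that, of lborel] F_meas] by (simp only: split_conv)
  have G_meas [measurable]: "G \<in> borel_measurable borel"
    unfolding G_def by measurable
  have silt: "approx_silt H0 H e 1 (\<lambda>s. B s \<omega>) = enn2real (\<integral>\<^sup>+z. ennreal (enn2real (F \<omega> z)) \<partial>lborel)" if \<omega>: "\<omega> \<in> space M" for \<omega>
  proof -
    have "indicator ?S z *\<^sub>R (case z of (s1, s2) \<Rightarrow> cov_reg H0 H e (s2 - s1, B s2 \<omega> - B s1 \<omega>)) = enn2real (F \<omega> z)" for z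
      by (cases z) (auto simp: F_def cov_reg_eq[OF e] indicator_def)
    then have "approx_silt H0 H e 1 (\<lambda>s. B s \<omega>) = (LINT z|lborel. enn2real (F \<omega> z))"
      unfolding approx_silt_def set_lebesgue_integral_def by simp
    also have "\<dots> = enn2real (\<integral>\<^sup>+z. ennreal (enn2real (F \<omega> z)) \<partial>lborel)"
      using F_meas'[OF \<omega>] by (intro integral_eq_nn_integral) auto
    finally show ?thesis .
  qed
  have FG: "(\<integral>\<^sup>+\<omega>. F \<omega> (s, t) \<partial>M) = G \<bar>t - s\<bar> * indicator ?S (s, t)" if "s \<noteq> t" for s t
  proof (cases "(s, t) \<in> ?S")
    case True
    then have st: "0 \<le> s" "0 \<le> t" by auto
    have "(\<integral>\<^sup>+\<omega>. F \<omega> (s, t) \<partial>M) = (\<integral>\<^sup>+\<omega>. time_kernel H0 e (t - s) * (\<Prod>j\<in>UNIV. space_kernel (H j) e ((B t \<omega> - B s \<omega>) $ j)) \<partial>M)"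
      using True by (simp add: F_def)
    also have "\<dots> = time_kernel H0 e (t - s) * (\<integral>\<^sup>+\<omega>. (\<Prod>j\<in>UNIV. space_kernel (H j) e ((B t \<omega> - B s \<omega>) $ j)) \<partial>M)"
      using measurable_BM[OF st(1)] measurable_BM[OF st(2)] by (intro nn_integral_cmult) measurable
    also have "\<dots> = ennreal (e powr (2 * H0 - 2) * cauchy_cov H0 (\<bar>t - s\<bar> / e)) * ennreal (space_const H * (\<bar>t - s\<bar> + e) powr (- ?a))"
      unfolding nn_integral_space_kernel_increment[OF H e st that] time_kernel_def
      using nn_integral_cov_factor_cauchy[OF H0 e, of "t - s"] that
      by (simp add: cauchy_cov_abs_divide[OF e, of H0 "t - s"])
    also have "\<dots> = G \<bar>t - s\<bar>"
      unfolding G_def using cauchy_cov_nonneg[OF H0] by (subst ennreal_mult') auto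
    finally show ?thesis using True by simp
  qed (simp add: F_def)
  have "(\<integral>\<^sup>+\<omega>. ?I \<omega> \<partial>M) = (\<integral>\<^sup>+z. (\<integral>\<^sup>+\<omega>. F \<omega> z \<partial>M) \<partial>lborel)"
    by (rule P.Fubini'[OF F_meas, symmetric])
  also have "\<dots> = (\<integral>\<^sup>+s. (\<integral>\<^sup>+t. (\<integral>\<^sup>+\<omega>. F \<omega> (s, t) \<partial>M) \<partial>lborel) \<partial>lborel)"
    unfolding lborel_prod[symmetric] using P.borel_measurable_nn_integral_fst
    by (intro lborel.nn_integral_fst[symmetric]) (simp add: lborel_prod)
  also have "\<dots> = (\<integral>\<^sup>+s. (\<integral>\<^sup>+t. G \<bar>t - s\<bar> * indicator ?S (s, t) \<partial>lborel) \<partial>lborel)"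
  proof (rule nn_integral_cong, rule nn_integral_cong_AE)
    fix s :: real
    show "AE t in lborel. (\<integral>\<^sup>+\<omega>. F \<omega> (s, t) \<partial>M) = G \<bar>t - s\<bar> * indicator ?S (s, t)"
      \<comment> \<open>The diagonal is discarded here: \<open>FG\<close> requires s and t to
        differ, as the increment would otherwise have no density.\<close>
      using AE_lborel_singleton[of s] by eventually_elim (rule FG, simp)
  qed
  also have "\<dots> = (\<integral>\<^sup>+z. G \<bar>snd z - fst z\<bar> * indicator ?S z \<partial>lborel)"
    unfolding lborel_prod[symmetric] by (subst lborel.nn_integral_fst[symmetric]) auto
  also have "\<dots> = 2 * (\<integral>\<^sup>+r\<in>{0<..<1}. ennreal (1 - r) * G r \<partial>lborel)"
    by (rule nn_integral_square_diff) measurable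
  also have "(\<integral>\<^sup>+r\<in>{0<..<1}. ennreal (1 - r) * G r \<partial>lborel) =
    (\<integral>\<^sup>+r. ennreal (space_const H) * (ennreal ((1 - r) * (e powr (2 * H0 - 2) * cauchy_cov H0 (r / e) * (r + e) powr (- ?a))) * indicator {0<..<1} r) \<partial>lborel)"
    using space_H
    by (intro nn_integral_cong) (auto simp: G_def indicator_def ennreal_mult'[symmetric] mult_ac)
  also have "\<dots> = ennreal (space_const H) * (\<integral>\<^sup>+r\<in>{0<..<1}. ennreal ((1 - r) * (e powr (2 * H0 - 2) * cauchy_cov H0 (r / e) * (r + e) powr (- ?a))) \<partial>lborel)"
    by (rule nn_integral_cmult) measurable
  also note fin
  also have "2 * (ennreal (space_const H) * ennreal c) = ennreal (2 * space_const H * c)"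
    using space_H by (simp add: ennreal_mult' mult.assoc)
  finally have T: "(\<integral>\<^sup>+\<omega>. ?I \<omega> \<partial>M) = ennreal (2 * space_const H * c)" .
  have int_meas [measurable]: "?I \<in> borel_measurable M"
    by measurable
  \<comment> \<open>The kernels are not shown to be finite pointwise: finiteness of the total mass \<open>T\<close> suffices to undo \<^const>\<open>enn2real\<close>.\<close>
  have "AE \<omega> in M. ?I \<omega> \<noteq> \<infinity>"
    by (rule nn_integral_PInf_AE) (auto simp: T)
  then have AE: "AE \<omega> in M. approx_silt H0 H e 1 (\<lambda>s. B s \<omega>) = enn2real (?I \<omega>)
      \<and> ?I \<omega> \<noteq> \<infinity>"
    using AE_space
  proof eventually_elim
    case (elim \<omega>)
    have "AE z in lborel. F \<omega> z \<noteq> \<infinity>"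
      using F_meas'[OF elim(2)] elim(1) by (intro nn_integral_PInf_AE) auto
    then have "(\<integral>\<^sup>+z. ennreal (enn2real (F \<omega> z)) \<partial>lborel) = ?I \<omega>"
      by (intro nn_integral_cong_AE) (auto elim!: eventually_mono simp: less_top)
    then show ?case using silt[OF elim(2)] elim(1) by simp
  qed
  have "(LINT \<omega>|M. approx_silt H0 H e 1 (\<lambda>s. B s \<omega>)) = (LINT \<omega>|M. enn2real (?I \<omega>))"
  proof (rule integral_cong_AE)
    have "(\<lambda>\<omega>. enn2real (\<integral>\<^sup>+z. ennreal (enn2real (F \<omega> z)) \<partial>lborel)) \<in> borel_measurable M"
      by measurable
    then show "(\<lambda>\<omega>. approx_silt H0 H e 1 (\<lambda>s. B s \<omega>)) \<in> borel_measurable M"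
      by (rule measurable_cong[THEN iffD1, rotated]) (simp add: silt)
  qed (use AE in auto)
  also have "\<dots> = enn2real (\<integral>\<^sup>+\<omega>. ennreal (enn2real (?I \<omega>)) \<partial>M)"
    by (rule integral_eq_nn_integral) auto
  also have "(\<integral>\<^sup>+\<omega>. ennreal (enn2real (?I \<omega>)) \<partial>M) = ennreal (2 * space_const H * c)"
    unfolding T[symmetric]
  proof (rule nn_integral_cong_AE)
    show "AE \<omega> in M. ennreal (enn2real (?I \<omega>)) = ?I \<omega>"
      using AE by eventually_elim (simp add: less_top)
  qed
  finally show ?thesis
    using space_H c by simp
qed

section \<open>The expectation as the energy of a scaling profile\<close>

lemma (in scaling_profile) nn_integral_energy:
  assumes e: "0 < e"
  shows "(\<integral>\<^sup>+r\<in>{0<..<1}. ennreal ((1 - r) * scaled e r) \<partial>lborel) = ennreal (energy e)"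
    and "0 \<le> energy e"
proof -
  let ?f = "\<lambda>r. indicator {0<..<1} r * ((1 - r) * scaled e r)"
  have nonneg: "0 \<le> ?f r" for r
    using scaled_nonneg[OF e, of r] by (auto simp: indicator_def)
  have le: "?f r \<le> K * e powr (\<rho> - 1) * indicator {0<..<1} r" for r
  proof (cases "r \<in> {0<..<1}")
    case True
    then have "(1 - r) * scaled e r \<le> 1 * scaled e r"
      using scaled_nonneg[OF e, of r] by (intro mult_right_mono) auto
    also have "\<dots> \<le> K * (e + r) powr (\<rho> - 1)"
      using scaled_le[OF e, of r] True by simp
    also have "\<dots> \<le> K * e powr (\<rho> - 1)"
      using True e \<rho>_le_1 K_nonneg by (intro mult_left_mono powr_mono2') auto
    finally show ?thesis using True by simp
  qed auto
  have "integrable lborel (\<lambda>r. K * e powr (\<rho> - 1) * indicator {0<..<1::real} r)"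
    by (intro integrable_mult_right integrable_real_indicator) auto
  then have int: "integrable lborel ?f"
  proof (rule Bochner_Integration.integrable_bound)
    show "?f \<in> borel_measurable lborel"
      using scaled_measurable[OF e, of "{0<..<1}" "\<lambda>r. 1 - r"] by (simp add: subset_eq)
    show "AE r in lborel. norm (?f r) \<le> norm (K * e powr (\<rho> - 1) * indicator {0<..<1} r)"
      using nonneg le by (intro AE_I2) (metis abs_ge_self abs_of_nonneg order_trans real_norm_def)
  qed
  have E: "energy e = integral\<^sup>L lborel ?f"
    by (simp add: energy_def set_lebesgue_integral_def)
  show "(\<integral>\<^sup>+r\<in>{0<..<1}. ennreal ((1 - r) * scaled e r) \<partial>lborel) = ennreal (energy e)"
    unfolding E nn_integral_eq_integral[OF int AE_I2[OF nonneg], symmetric]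
    by (intro nn_integral_cong) (auto simp: indicator_def)
  show "0 \<le> energy e"
    unfolding E using nonneg by (intro Bochner_Integration.integral_nonneg) auto
qed

text \<open>After dividing by x powr (- a) this is a Bernoulli inequality for (1 + 1 / x) powr (-
  a), from exp y \<ge> 1 + y and ln (1 + y) \<le> y.\<close>

lemma powr_one_plus_diff_le:
  fixes a x :: real
  assumes "0 \<le> a" "0 < x"
  shows "\<bar>(1 + x) powr (- a) - x powr (- a)\<bar> \<le> a * x powr (- a - 1)"
proof -
  have "1 - a * (1 / x) \<le> 1 - a * ln (1 + 1 / x)"
    using assms ln_add_one_self_le_self[of "1 / x"] by (intro diff_left_mono mult_left_mono) auto
  also have "\<dots> \<le> exp (- (a * ln (1 + 1 / x)))"
    using exp_ge_add_one_self[of "- (a * ln (1 + 1 / x))"] by simp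
  also have "\<dots> = (1 + 1 / x) powr (- a)"
  proof -
    have "0 < 1 + 1 / x" using assms by (simp add: add_pos_pos)
    then show ?thesis by (simp add: powr_def)
  qed
  finally have "x powr (- a) * (1 - a * (1 / x)) \<le> x powr (- a) * (1 + 1 / x) powr (- a)"
    by (rule mult_left_mono) simp
  also have "\<dots> = (x * (1 + 1 / x)) powr (- a)"
    using assms by (simp add: powr_mult)
  also have "x * (1 + 1 / x) = 1 + x"
    using assms by (simp add: field_simps)
  finally have "x powr (- a) - (1 + x) powr (- a) \<le> a * (x powr (- a) / x)"
    by (simp add: algebra_simps)
  also have "x powr (- a) / x = x powr (- a - 1)"
    using assms by (simp add: powr_diff)
  finally have "x powr (- a) - (1 + x) powr (- a) \<le> a * x powr (- a - 1)" .
  moreover have "(1 + x) powr (- a) \<le> x powr (- a)"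
    using assms by (intro powr_mono2') auto
  ultimately show ?thesis by simp
qed

text \<open>The asymptotics split into the error of \<open>cauchy_cov\<close>, with (1 + x) powr (-
  a) bounded by x powr (- a), and the error of replacing 1 + x by x in that power. Both are of order
  x powr (2 h - 3 - a); K adds up the constants.\<close>

lemma scaling_profile_cauchy_cov:
  fixes h a :: real
  assumes h: "1/2 \<le> h" "h \<le> 1" and a: "0 < a"
  obtains K where "scaling_profile (\<lambda>x. cauchy_cov h x * (1 + x) powr (- a)) (h * (2 * h - 1)) K (2 * h - 1 - a)"
proof -
  obtain K1 where K1: "0 < K1" "\<And>x. 0 \<le> x \<Longrightarrow> cauchy_cov h x \<le> K1 * (1 + x) powr (2 * h - 2)"
    using cauchy_cov_le[OF h] by blast
  obtain K2 where K2: "0 < K2" "\<And>x. 0 < x \<Longrightarrow> \<bar>cauchy_cov h x - h * (2 * h - 1) * x powr (2 * h - 2)\<bar> \<le> K2 * x powr (2 * h - 3)"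
    using cauchy_cov_asymp[OF h] by blast
  let ?k = "h * (2 * h - 1)"
  have k: "0 \<le> ?k" using h by simp
  define K where "K = K1 + K2 + ?k * a"
  have "scaling_profile (\<lambda>x. cauchy_cov h x * (1 + x) powr (- a)) ?k K (2 * h - 1 - a)"
  proof
    show "continuous_on {0..} (\<lambda>x. cauchy_cov h x * (1 + x) powr (- a))"
      by (intro continuous_on_mult continuous_on_cauchy_cov h continuous_on_powr continuous_on_add continuous_on_const continuous_on_id) auto
    show "0 \<le> cauchy_cov h x * (1 + x) powr (- a)" for x
      using cauchy_cov_nonneg[OF h] by simp
    show "cauchy_cov h x * (1 + x) powr (- a) \<le> K * (1 + x) powr (2 * h - 1 - a - 1)" if "0 \<le> x" for x
    proof -
      have "cauchy_cov h x * (1 + x) powr (- a) \<le> K1 * (1 + x) powr (2 * h - 2) * (1 + x) powr (- a)"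
        using K1(2)[OF that] by (rule mult_right_mono) simp
      also have "\<dots> = K1 * (1 + x) powr (2 * h - 1 - a - 1)"
      proof -
        have "2 * h - 1 - a - 1 = (2 * h - 2) + (- a)" by simp
        then show ?thesis by (simp only: powr_add mult.assoc)
      qed
      also have "\<dots> \<le> K * (1 + x) powr (2 * h - 1 - a - 1)"
        unfolding K_def using K2(1) k a by (intro mult_right_mono) auto
      finally show ?thesis .
    qed
    show "\<bar>cauchy_cov h x * (1 + x) powr (- a) - ?k * x powr (2 * h - 1 - a - 1)\<bar> \<le> K * x powr (2 * h - 1 - a - 2)" if x: "0 < x" for x
    proof -
      have e1: "x powr (2 * h - 1 - a - 1) = x powr (2 * h - 2) * x powr (- a)"
        and e2: "x powr (2 * h - 3) * x powr (- a) = x powr (2 * h - 1 - a - 2)"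
        and e3: "x powr (2 * h - 2) * x powr (- a - 1) = x powr (2 * h - 1 - a - 2)"
        using powr_add[of x "2 * h - 2" "- a"] powr_add[of x "2 * h - 3" "- a"] powr_add[of x "2 * h - 2" "- a - 1"]
        by (simp_all add: algebra_simps)
      have "\<bar>(cauchy_cov h x - ?k * x powr (2 * h - 2)) * (1 + x) powr (- a)\<bar> \<le> (K2 * x powr (2 * h - 3)) * x powr (- a)"
        unfolding abs_mult[of _ "(1 + x) powr (- a)"] using K2 x a by (intro mult_mono) (auto intro!: powr_mono2')
      moreover have "\<bar>?k * x powr (2 * h - 2) * ((1 + x) powr (- a) - x powr (- a))\<bar> \<le> ?k * x powr (2 * h - 2) * (a * x powr (- a - 1))"
      proof -
        have "\<bar>?k * x powr (2 * h - 2) * ((1 + x) powr (- a) - x powr (- a))\<bar> =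
           ?k * x powr (2 * h - 2) * \<bar>(1 + x) powr (- a) - x powr (- a)\<bar>"
        proof -
          have "0 \<le> ?k * x powr (2 * h - 2)" by (intro mult_nonneg_nonneg k) simp
          then show ?thesis by (subst abs_mult) (simp only: abs_of_nonneg)
        qed
        also have "\<dots> \<le> ?k * x powr (2 * h - 2) * (a * x powr (- a - 1))"
          using k powr_one_plus_diff_le[of a x] a x by (intro mult_left_mono) auto
        finally show ?thesis .
      qed
      moreover have "cauchy_cov h x * (1 + x) powr (- a) - ?k * x powr (2 * h - 1 - a - 1) =
        (cauchy_cov h x - ?k * x powr (2 * h - 2)) * (1 + x) powr (- a) + ?k * x powr (2 * h - 2) * ((1 + x) powr (- a) - x powr (- a))"
        unfolding e1 by (simp add: algebra_simps)
      ultimately have "\<bar>cauchy_cov h x * (1 + x) powr (- a) - ?k * x powr (2 * h - 1 - a - 1)\<bar> \<le>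
        K2 * (x powr (2 * h - 3) * x powr (- a)) + ?k * a * (x powr (2 * h - 2) * x powr (- a - 1))"
        by (simp add: mult_ac)
      also have "\<dots> = (K2 + ?k * a) * x powr (2 * h - 1 - a - 2)"
        unfolding e2 e3 by (simp add: algebra_simps)
      also have "\<dots> \<le> K * x powr (2 * h - 1 - a - 2)"
        unfolding K_def using K1(1) by (intro mult_right_mono) auto
      finally show ?thesis .
    qed
    show "2 * h - 1 - a \<le> 1" using h a by simp
  qed
  then show ?thesis by (rule that)
qed

text \<open>Since \<rho> - 1 = (2 H0 - 2) - (d - H), the prefactor in \<open>scaled\<close> splits
  into the scaling of the time kernel and that of (r + e) powr (- (d - H)).\<close>

lemma (in standard_brownian_motion) expectation_approx_silt_energy:
  fixes H :: "'n \<Rightarrow> real"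
  assumes H0: "1/2 \<le> H0" "H0 \<le> 1" and H: "\<And>j. 1/2 \<le> H j"
    and prof: "scaling_profile (\<lambda>x. cauchy_cov H0 x * (1 + x) powr (- (real CARD('n) - hsum H))) k K (rho H0 H)"
    and e: "0 < e"
  shows "(LINT \<omega>|M. \<kappa>\<^sup>2 / 2 * approx_silt H0 H e 1 (\<lambda>s. B s \<omega>)) =
    \<kappa>\<^sup>2 * (space_const H * scaling_profile.energy (\<lambda>x. cauchy_cov H0 x * (1 + x) powr (- (real CARD('n) - hsum H))) (rho H0 H) e)"
proof -
  let ?g = "\<lambda>r. e powr (2 * H0 - 2) * cauchy_cov H0 (r / e) * (r + e) powr (- (real CARD('n) - hsum H))"
  let ?a = "real CARD('n) - hsum H"
  interpret S: scaling_profile "\<lambda>x. cauchy_cov H0 x * (1 + x) powr (- ?a)" k K "rho H0 H"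
    by (rule prof)
  have eq: "S.scaled e r = ?g r" if "0 < r" for r
  proof -
    have 1: "1 + r / e = (r + e) / e" using e by (simp add: field_simps)
    have "rho H0 H - 1 = (2 * H0 - 2) + (- ?a)"
      by (simp add: rho_def)
    then have 2: "e powr (rho H0 H - 1) = e powr (2 * H0 - 2) * e powr (- ?a)"
      by (simp only: powr_add)
    have 3: "e powr (- ?a) * ((r + e) / e) powr (- ?a) = (r + e) powr (- ?a)"
      using e by (subst powr_divide) simp
    have "S.scaled e r = e powr (2 * H0 - 2) * cauchy_cov H0 (r / e) * (e powr (- ?a) * ((r + e) / e) powr (- ?a))"
      unfolding S.scaled_def 1 2 by (simp only: mult_ac)
    then show ?thesis unfolding 3 .
  qed
  have "(\<integral>\<^sup>+r\<in>{0<..<1}. ennreal ((1 - r) * ?g r) \<partial>lborel)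
    = (\<integral>\<^sup>+r\<in>{0<..<1}. ennreal ((1 - r) * S.scaled e r) \<partial>lborel)"
  proof (rule nn_integral_cong)
    fix r :: real
    show "ennreal ((1 - r) * ?g r) * indicator {0<..<1} r =
      ennreal ((1 - r) * S.scaled e r) * indicator {0<..<1} r"
    proof (cases "r \<in> {0<..<1}")
      case True
      then have "0 < r" by simp
      show ?thesis unfolding eq[OF \<open>0 < r\<close>] ..
    qed simp
  qed
  also have "\<dots> = ennreal (S.energy e)"
    by (rule S.nn_integral_energy(1)[OF e])
  finally show ?thesis
    using expectation_approx_silt[OF H0 H e S.nn_integral_energy(2)[OF e]] by simp
qed

lemma b_const_eq: "b_const H0 H = space_const H * (H0 * (2 * H0 - 1))"
  by (simp add: b_const_def space_const_def powr_minus_divide)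

text \<open>For H0 = 1 the condition \<rho> = 0 forces d - H = 1, so the profile is 1 / (1 + x) and
  the energy has an elementary antiderivative. This explains the form (1 + \<theta>) ln (1 + 1 /
  \<theta>) and makes the correction a constant.\<close>

lemma energy_one:
  assumes prof: "scaling_profile (\<lambda>x. cauchy_cov 1 x * (1 + x) powr (- 1)) k K 0" and e: "0 < e"
  shows "scaling_profile.energy (\<lambda>x. cauchy_cov 1 x * (1 + x) powr (- 1)) 0 e = (1 + e) * ln (1 + 1 / e) - 1"
proof -
  interpret S: scaling_profile "\<lambda>x. cauchy_cov 1 x * (1 + x) powr (- 1)" k K 0
    by (rule prof)
  have "((\<lambda>r. (1 - r) / (r + e)) has_integral ((1 + e) * ln (1 + e) - 1) - ((1 + e) * ln (0 + e) - 0)) {0..1}"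
  proof (rule fundamental_theorem_of_calculus)
    fix r :: real assume "r \<in> {0..1}"
    then have "((\<lambda>r. (1 + e) * ln (r + e) - r) has_field_derivative (1 - r) / (r + e)) (at r within {0..1})"
      using e by (auto intro!: derivative_eq_intros simp: field_simps)
    then show "((\<lambda>r. (1 + e) * ln (r + e) - r) has_vector_derivative (1 - r) / (r + e)) (at r within {0..1})"
      by (simp add: has_real_derivative_iff_has_vector_derivative)
  qed simp
  also have "((1 + e) * ln (1 + e) - 1) - ((1 + e) * ln (0 + e) - 0) = (1 + e) * ln (1 + 1 / e) - 1"
  proof -
    have "1 + 1 / e = (1 + e) / e" using e by (simp add: field_simps)
    then have ln: "ln (1 + 1 / e) = ln (1 + e) - ln e" using e by (simp add: ln_div)
    show ?thesis unfolding ln by (simp add: algebra_simps)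
  qed
  finally have int: "((\<lambda>r. (1 - r) / (r + e)) has_integral (1 + e) * ln (1 + 1 / e) - 1) {0<..<1}"
    by (simp add: has_integral_Icc_iff_Ioo)
  have eq: "(1 - r) * S.scaled e r = (1 - r) / (r + e)" if "0 < r" for r
  proof -
    have "1 + r / e = (r + e) / e" using e by (simp add: field_simps)
    then show ?thesis
      unfolding S.scaled_def using e that by (simp add: cauchy_cov_def powr_minus)
  qed
  have "ennreal (S.energy e) = (\<integral>\<^sup>+r\<in>{0<..<1}. ennreal ((1 - r) / (r + e)) \<partial>lborel)"
    unfolding S.nn_integral_energy(1)[OF e, symmetric]
  proof (rule nn_integral_cong)
    fix r :: real
    show "ennreal ((1 - r) * S.scaled e r) * indicator {0<..<1} r = ennreal ((1 - r) / (r + e)) * indicator {0<..<1} r"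
    proof (cases "r \<in> {0<..<1}")
      case True
      then have "0 < r" by simp
      show ?thesis unfolding eq[OF \<open>0 < r\<close>] ..
    qed simp
  qed
  also have "\<dots> = ennreal ((1 + e) * ln (1 + 1 / e) - 1)"
    using int by (rule nn_integral_has_integral_lebesgue'[rotated]) (use e in auto)
  finally show ?thesis
    using S.nn_integral_energy(2)[OF e] has_integral_nonneg[OF int] e by (auto simp: ennreal_inj)
qed

theorem proposition4p8:
  fixes M :: "'w measure"
    and B :: "real \<Rightarrow> 'w \<Rightarrow> real ^ 'n"
    and H0 \<kappa> :: real
    and H :: "'n \<Rightarrow> real"
  assumes BM: "standard_brownian_motion M B"
    and H0: "1/2 \<le> H0" "H0 \<le> 1"
    and H: "\<And>j. 1/2 \<le> H j" "\<And>j. H j < 1"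
    and le_1: "real CARD('n) - hsum H \<le> 1"
    and less: "real CARD('n) - hsum H < 2 * H0 - 1/2"
    and \<kappa>: "0 < \<kappa>"
  shows
    "(rho H0 H > 0 \<longrightarrow>
        ((\<lambda>\<theta>. LINT \<omega>|M. \<kappa>\<^sup>2 / 2 * approx_silt H0 H \<theta> 1 (\<lambda>s. B s \<omega>))
          \<longlongrightarrow> \<kappa>\<^sup>2 * b_const H0 H / ((1 + rho H0 H) * rho H0 H)) (at_right 0))
   \<and> (rho H0 H = 0 \<longrightarrow>
        (\<exists>b1 b2 :: real \<Rightarrow> real.
           continuous_on {0..} b1 \<and> bounded (b1 ` {0..}) \<and>
           continuous_on {0..} b2 \<and> bounded (b2 ` {0..}) \<and>
           (\<forall>\<theta>>0. (LINT \<omega>|M. \<kappa>\<^sup>2 / 2 * approx_silt H0 H \<theta> 1 (\<lambda>s. B s \<omega>)) =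
              (if H0 < 1 then \<kappa>\<^sup>2 * b_const H0 H * ell H0 \<theta> + \<kappa>\<^sup>2 * b1 \<theta>
               else \<kappa>\<^sup>2 * b_const H0 H * (1 + \<theta>) * ln (1 + 1 / \<theta>) + \<kappa>\<^sup>2 * b2 \<theta>))))
   \<and> (rho H0 H < 0 \<longrightarrow>
        (\<exists>z :: real \<Rightarrow> real.
           continuous_on {0<..} z \<and> bounded (z ` {0<..}) \<and>
           (\<forall>\<theta>>0. (LINT \<omega>|M. \<kappa>\<^sup>2 / 2 * approx_silt H0 H \<theta> 1 (\<lambda>s. B s \<omega>)) =
              \<kappa>\<^sup>2 * d_const H0 H * \<theta> powr rho H0 H + \<kappa>\<^sup>2 * z \<theta>) \<and>
           (H0 > 1/2 \<longrightarrow>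
              (z \<longlongrightarrow> b_const H0 H / ((1 + rho H0 H) * rho H0 H)) (at_right 0)) \<and>
           (H0 = 1/2 \<longrightarrow> (z \<longlongrightarrow> 0) (at_right 0))))"
proof -
  interpret BM: standard_brownian_motion M B by (rule BM)
  let ?a = "real CARD('n) - hsum H"
  let ?p = "\<lambda>x. cauchy_cov H0 x * (1 + x) powr (- ?a)"
  let ?k = "H0 * (2 * H0 - 1)"
  let ?c = "space_const H"
  let ?E = "\<lambda>\<theta>. LINT \<omega>|M. \<kappa>\<^sup>2 / 2 * approx_silt H0 H \<theta> 1 (\<lambda>s. B s \<omega>)"
  \<comment> \<open>Strictness comes from every \<open>H j\<close> lying below 1, the index type
    being nonempty.\<close>
  have "hsum H < (\<Sum>j\<in>(UNIV :: 'n set). 1)"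
    unfolding hsum_def by (rule sum_strict_mono) (auto simp: H)
  then have a: "0 < ?a" by simp
  have rho: "rho H0 H = 2 * H0 - 1 - ?a" by (simp add: rho_def)
  obtain K where prof: "scaling_profile ?p ?k K (rho H0 H)"
    using scaling_profile_cauchy_cov[OF H0 a] unfolding rho by blast
  interpret S: scaling_profile ?p ?k K "rho H0 H" by (rule prof)
  have E: "?E \<theta> = \<kappa>\<^sup>2 * (?c * S.energy \<theta>)" if "0 < \<theta>" for \<theta>
    by (rule BM.expectation_approx_silt_energy[OF H0 _ prof that]) (rule H)
  have b: "b_const H0 H = ?c * ?k" by (rule b_const_eq)
  have bounded_mult: "bounded ((\<lambda>x. r * f x) ` T)" if "bounded (f ` T)" for r and f :: "real \<Rightarrow> real" and T
    using bounded_scaleR_comp[OF that, of r] by simp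
  have pos: "(?E \<longlongrightarrow> \<kappa>\<^sup>2 * b_const H0 H / ((1 + rho H0 H) * rho H0 H)) (at_right 0)" if "0 < rho H0 H"
  proof -
    have "((\<lambda>\<theta>. \<kappa>\<^sup>2 * (?c * S.energy \<theta>)) \<longlongrightarrow> \<kappa>\<^sup>2 * (?c * (?k / ((1 + rho H0 H) * rho H0 H)))) (at_right 0)"
      by (intro tendsto_mult_left S.energy_tendsto_pos that)
    then have "(?E \<longlongrightarrow> \<kappa>\<^sup>2 * (?c * (?k / ((1 + rho H0 H) * rho H0 H)))) (at_right 0)"
    proof (rule Lim_transform_eventually)
      show "\<forall>\<^sub>F \<theta> in at_right 0. \<kappa>\<^sup>2 * (?c * S.energy \<theta>) = ?E \<theta>"
        by (rule eventually_mono[OF eventually_at_right_less]) (simp only: E)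
    qed
    then show ?thesis unfolding b by (simp add: mult.assoc)
  qed
  have zero: "\<exists>b1 b2. continuous_on {0..} b1 \<and> bounded (b1 ` {0..}) \<and>
           continuous_on {0..} b2 \<and> bounded (b2 ` {0..}) \<and>
           (\<forall>\<theta>>0. ?E \<theta> = (if H0 < 1 then \<kappa>\<^sup>2 * b_const H0 H * ell H0 \<theta> + \<kappa>\<^sup>2 * b1 \<theta>
               else \<kappa>\<^sup>2 * b_const H0 H * (1 + \<theta>) * ln (1 + 1 / \<theta>) + \<kappa>\<^sup>2 * b2 \<theta>))" if zero: "rho H0 H = 0"
  proof (cases "H0 < 1")
    case True
    have H0': "0 < H0" using H0 by simp
    \<comment> \<open>What remains once the logarithms of the energy and of \<open>ell\<close>
      cancel. Only one branch of the conditional applies for a given H0, so the same witness is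
      taken for both functions.\<close>
    define b1 where "b1 \<theta> = ?c * (S.log_bulk \<theta> - S.log_edge \<theta> - ?k * ell_gap H0 \<theta>)" for \<theta>
    have "continuous_on {0..} b1"
      unfolding b1_def
      by (intro continuous_on_mult_left continuous_on_diff S.log_bulk_continuous S.log_edge_continuous zero
          ell_gap_continuous H0' True)
    moreover have "bounded (b1 ` {0..})"
      unfolding b1_def
      by (intro bounded_mult bounded_minus_comp S.log_bulk_bounded S.log_edge_bounded zero
          ell_gap_bounded H0' True)
    moreover have "?E \<theta> = \<kappa>\<^sup>2 * b_const H0 H * ell H0 \<theta> + \<kappa>\<^sup>2 * b1 \<theta>" if "0 < \<theta>" for \<theta>
      unfolding E[OF that] b b1_def S.energy_eq_zero[OF zero that] ell_eq[OF H0' True that]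
      by (simp add: algebra_simps)
    ultimately show ?thesis
      using True by (intro exI[of _ b1]) auto
  next
    case False
    with H0 have one: "H0 = 1" by simp
    have a1: "?a = 1" using zero unfolding one by (simp add: rho_def)
    have "?E \<theta> = \<kappa>\<^sup>2 * b_const H0 H * (1 + \<theta>) * ln (1 + 1 / \<theta>) + \<kappa>\<^sup>2 * (- ?c)" if "0 < \<theta>" for \<theta>
    proof -
      have en: "S.energy \<theta> = (1 + \<theta>) * ln (1 + 1 / \<theta>) - 1"
        using energy_one[of ?k K \<theta>] prof that unfolding one zero[unfolded one] a1 by blast
      show ?thesis
        unfolding E[OF that] b en by (simp add: one algebra_simps)
    qed
    then show ?thesis
      using False by (intro exI[of _ "\<lambda>_. - ?c"]) (auto simp: image_constant_conv)
  qed
  have neg: "\<exists>z. continuous_on {0<..} z \<and> bounded (z ` {0<..}) \<and>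
           (\<forall>\<theta>>0. ?E \<theta> = \<kappa>\<^sup>2 * d_const H0 H * \<theta> powr rho H0 H + \<kappa>\<^sup>2 * z \<theta>) \<and>
           (H0 > 1/2 \<longrightarrow> (z \<longlongrightarrow> b_const H0 H / ((1 + rho H0 H) * rho H0 H)) (at_right 0)) \<and>
           (H0 = 1/2 \<longrightarrow> (z \<longlongrightarrow> 0) (at_right 0))" if neg: "rho H0 H < 0"
  proof -
    have \<rho>: "-1 < rho H0 H" using less by (simp add: rho)
    \<comment> \<open>From \<rho> < 0 and d - H \<le> 1: 2 H0 - 1 < d - H \<le> 1, which excludes H0
      = 1.\<close>
    have H1: "H0 < 1" and a': "2 * H0 - 1 < ?a" using neg le_1 by (auto simp: rho)
    note int = cauchy_cov_integral[OF H0(1) H1 a' a]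
    have d: "d_const H0 H = ?c * (LINT x:{0<..}|lborel. ?p x)"
    proof -
      have "- rho H0 H = ?a - (2 * H0 - 1)" by (simp add: rho)
      then show ?thesis
        unfolding int(2) d_const_def space_const_def by (simp add: powr_minus_divide mult_ac)
    qed
    define z where "z \<theta> = ?c * S.remainder \<theta>" for \<theta>
    have "continuous_on {0<..} z"
      unfolding z_def by (intro continuous_on_mult_left S.remainder_continuous \<rho> neg)
    moreover have "bounded (z ` {0<..})"
      unfolding z_def by (intro bounded_mult S.remainder_bounded \<rho> neg)
    moreover have "?E \<theta> = \<kappa>\<^sup>2 * d_const H0 H * \<theta> powr rho H0 H + \<kappa>\<^sup>2 * z \<theta>" if "0 < \<theta>" for \<theta>
      unfolding E[OF that] d z_def S.energy_eq_neg[OF \<rho> neg int(1) that] by (simp add: algebra_simps)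
    moreover have lim: "(z \<longlongrightarrow> b_const H0 H / ((1 + rho H0 H) * rho H0 H)) (at_right 0)"
    proof -
      have "((\<lambda>\<theta>. ?c * S.remainder \<theta>) \<longlongrightarrow> ?c * (?k / ((1 + rho H0 H) * rho H0 H))) (at_right 0)"
        by (intro tendsto_mult_left S.remainder_tendsto \<rho> neg)
      then show ?thesis unfolding z_def b by (simp only: times_divide_eq_right)
    qed
    moreover have "(z \<longlongrightarrow> 0) (at_right 0)" if "H0 = 1/2"
    proof -
      have "b_const H0 H = 0" unfolding b using that by simp
      with lim show ?thesis by simp
    qed
    ultimately show ?thesis by (intro exI[of _ z]) blast
  qed
  show ?thesis using pos zero neg by blast
qed

end
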